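(* Let $d\ge 1$, $\mathcal D=[0,1]^d$, let $\mathbf l=(l_1,\dots,l_k)$ be a decomposition vector of $d$, and let $\boldsymbol\alpha=(\alpha_1,\dots,\alpha_k)$ with $0<\alpha_j<2$. Let $X\in\mathcal B^{\boldsymbol\alpha}_{\mathbf l}(\mathcal D,c(\cdot))$ be a locally stationary random field with local stationarity functions $c(\cdot)=(c_1(\cdot),\dots,c_k(\cdot))$, and let $I(X)=\int_{\mathcal D}X(\mathbf t)\,d\mathbf t$ be approximated by the stratified Monte Carlo quadrature $I_N(X,T_N)$, where $T_N$ is $cRS(h,\pi,\mathbf l)$ with withincomponent densities $h=(h_1,\dots,h_k)$ and intercomponent grid distribution $\pi(N)=(n_1(N),\dots,n_k(N))$. Then $$\|I(X)-I_N(X,T_N)\|^2\sim\frac1N\sum_{j=1}^k\frac{v_j}{n_j^{\alpha_j}}\quad\text{as }N\to\infty,$$ where, for $j=1,\dots,k$, $$v_j:=\int_{\mathcal D}c_j(\mathbf t)\,b_{\alpha_j,l_j}(D_j(\mathbf t^j))\prod_{m=1}^d h_m^*(t_m)^{-1}\,d\mathbf t>0,\qquad D_j(\mathbf t^j):=\bigl(1/h_j(t_{L_{j-1}+1}),\dots,1/h_j(t_{L_j})\bigr).$$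
   Context: Norms. For a square-integrable random variable $\xi$, $\|\xi\|=(\mathrm E\,\xi^2)^{1/2}$; for a vector, $\|\cdot\|$ is the Euclidean norm. $a_N\sim b_N$ means $a_N/b_N\to1$. The symbol $*$ between vectors denotes coordinatewise multiplication. Decomposition. $\mathbf l=(l_1,\dots,l_k)$, $k\le d$, is a vector of positive integers with $\sum_j l_j=d$; $L_0=0$, $L_i=\sum_{j\le i}l_j$. For $\mathbf s\in\mathbb R^d$, $\mathbf s^j=(s_{L_{j-1}+1},\dots,s_{L_j})$. Random fields. $X(\mathbf t)$, $\mathbf t\in\mathcal D=[0,1]^d$, is a random field with finite second moments, continuous in quadratic mean (and taken jointly measurable). $X\in\mathcal B^{\boldsymbol\alpha}_{\mathbf l}(\mathcal D,c(\cdot))$ (locally stationary) means $$\frac{\|X(\mathbf t+\mathbf s)-X(\mathbf t)\|^2}{\sum_{j=1}^k c_j(\mathbf t)\|\mathbf s^j\|^{\alpha_j}}\to1\quad\text{as }\mathbf s\to0,\text{ uniformly in }\mathbf t\in\mathcal D$$ (with $\mathbf t,\mathbf t+\mathbf s\in\mathcal D$), where $c_1,\dots,c_k$ are positive continuous functions on $\mathcal D$ and $c_j$ is invariant under permutations of the coordinates within the $j$-th component $\mathbf t^j$. Designs. $T_N$ is $cRS(h,\pi,\mathbf l)$ (cross regular sequence): $h=(h_1,\dots,h_k)$ are positive continuous probability densities on $[0,1]$, $\pi(N)=(n_1(N),\dots,n_k(N))$ are positive integers; put $h_i^*=h_j$ and $n_i^*=n_j$ for $i=L_{j-1}+1,\dots,L_j$,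 $j=1,\dots,k$. It is required that $\prod_{i=1}^d n_i^*(N)=\prod_{j=1}^k n_j(N)^{l_j}=N$ and $n_j(N)\to\infty$ as $N\to\infty$ ($N$ ranging over an infinite set of positive integers for which such a factorization is available). The one-dimensional grid points are defined by $\int_0^{t_{m,i}}h_m^*(v)\,dv=i/n_m^*$, $i=0,\dots,n_m^*$, $m=1,\dots,d$, and $T_N$ is the product grid. It partitions $\mathcal D$ into the $N$ hyperrectangles (strata) $\mathcal D_{\mathbf i}=\prod_{m=1}^d[t_{m,i_m},t_{m,i_m+1}]$, $\mathbf i\in\mathbf I=\{(i_1,\dots,i_d):0\le i_m\le n_m^*-1\}$. Quadrature. $I_N(X,T_N)=\sum_{\mathbf i\in\mathbf I}X(\boldsymbol\eta_{\mathbf i})|\mathcal D_{\mathbf i}|$, where $|\mathcal D_{\mathbf i}|$ is the volume and $\boldsymbol\eta_{\mathbf i}$ is uniformly distributed on $\mathcal D_{\mathbf i}$; the $\boldsymbol\eta_{\mathbf i}$ are mutually independent and independent of $X$. The error $\|I(X)-I_N(X,T_N)\|^2$ is the expectation over both $X$ and the $\boldsymbol\eta_{\mathbf i}$. Constant. For $0<\beta<2$, $m\in\mathbb N$, $\mathbf u\in\mathbb R_+^m$: $b_{\beta,m}(\mathbf u)=\frac12\int_{[0,1]^m}\int_{[0,1]^m}\|\mathbf u*(\mathbf t-\mathbf v)\|^\beta\,d\mathbf t\,d\mathbf v$. *)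

theory Defs
  imports "HOL-Probability.Probability" "HOL-Combinatorics.Permutations"
begin

text \<open>
  Points of \<open>\<real>\<^sup>m\<close> are functions \<open>nat \<Rightarrow> real\<close> in the carrier \<open>{..<m} \<rightarrow>\<^sub>E UNIV\<close>; all indices
  start at 0. The Euclidean norm of \<open>u\<close> is \<open>L2_set u {..<m}\<close>, and on this carrier the product
  topology of the function space is the usual one.
\<close>

definition leb :: "nat \<Rightarrow> (nat \<Rightarrow> real) measure" where
  "leb m = PiM {..<m} (\<lambda>_. lborel)"

definition cube :: "nat \<Rightarrow> (nat \<Rightarrow> real) set" where
  "cube m = ({..<m} \<rightarrow>\<^sub>E {0..1})"

definition decomposition :: "nat \<Rightarrow> nat list \<Rightarrow> bool" where
  "decomposition d l \<longleftrightarrow> (\<forall>x\<in>set l. 0 < x) \<and> sum_list l = d"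

definition L :: "nat list \<Rightarrow> nat \<Rightarrow> nat" where
  "L l j = sum_list (take j l)"

text \<open>The component \<open>s\<^sup>j\<close>, re-indexed from 0 as a vector with \<open>l ! j\<close> coordinates.\<close>

definition component :: "nat list \<Rightarrow> nat \<Rightarrow> (nat \<Rightarrow> real) \<Rightarrow> nat \<Rightarrow> real" where
  "component l j s = (\<lambda>i\<in>{..<l ! j}. s (L l j + i))"

text \<open>
  The component to which coordinate \<open>m\<close> belongs: the unique \<open>j\<close> with
  \<open>L l j \<le> m < L l (Suc j)\<close>. Hence the starred quantities \<open>h\<^sub>m\<^sup>*\<close> and \<open>n\<^sub>m\<^sup>*\<close> are
  \<open>h (comp_of l m)\<close> and \<open>n (comp_of l m)\<close>.
\<close>

definition comp_of :: "nat list \<Rightarrow> nat \<Rightarrow> nat" where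
  "comp_of l m = (LEAST j. m < L l (Suc j))"

definition rv_norm :: "'w measure \<Rightarrow> ('w \<Rightarrow> real) \<Rightarrow> real" where
  "rv_norm M \<xi> = sqrt (LINT w|M. (\<xi> w)\<^sup>2)"

text \<open>
  Joint measurability is required with respect to a sub-\<open>\<sigma>\<close>-algebra \<open>F\<close> of \<open>M\<close> (for instance
  the one generated by the field). Randomisation that is independent of \<open>F\<close> is then independent
  of the field also as far as compositions \<open>X (\<eta> w) w\<close> are concerned; independence of
  \<open>X t\<close>, \<open>t \<in> cube d\<close>, alone would not be enough for a field that is jointly measurable only with
  respect to the whole of \<open>M\<close>.
\<close>

definition random_field ::
  "'w measure \<Rightarrow> 'w measure \<Rightarrow> nat \<Rightarrow> ((nat \<Rightarrow> real) \<Rightarrow> 'w \<Rightarrow> real) \<Rightarrow> bool" where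
  "random_field M F d X \<longleftrightarrow>
     subalgebra M F \<and>
     (\<lambda>(t, w). X t w) \<in> borel_measurable (restrict_space (leb d) (cube d) \<Otimes>\<^sub>M F) \<and>
     (\<forall>t\<in>cube d. integrable M (\<lambda>w. (X t w)\<^sup>2)) \<and>
     (\<forall>t\<in>cube d. ((\<lambda>u. rv_norm M (\<lambda>w. X u w - X t w)) \<longlongrightarrow> 0) (at t within cube d))"

text \<open>The sum \<open>t + s\<close> is restricted to \<open>{..<d}\<close> so that it stays in the carrier.\<close>

definition vplus :: "nat \<Rightarrow> (nat \<Rightarrow> real) \<Rightarrow> (nat \<Rightarrow> real) \<Rightarrow> nat \<Rightarrow> real" where
  "vplus d t s = (\<lambda>i\<in>{..<d}. t i + s i)"

definition locally_stationary ::
  "'w measure \<Rightarrow> nat \<Rightarrow> nat list \<Rightarrow> (nat \<Rightarrow> real) \<Rightarrow> (nat \<Rightarrow> (nat \<Rightarrow> real) \<Rightarrow> real) \<Rightarrow>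
    ((nat \<Rightarrow> real) \<Rightarrow> 'w \<Rightarrow> real) \<Rightarrow> bool" where
  "locally_stationary M d l \<alpha> c X \<longleftrightarrow>
     (\<forall>j<length l. continuous_on (cube d) (c j) \<and> (\<forall>t\<in>cube d. 0 < c j t) \<and>
        (\<forall>p. p permutes {L l j..<L l (Suc j)} \<longrightarrow> (\<forall>t\<in>cube d. c j (t \<circ> p) = c j t))) \<and>
     (\<forall>\<epsilon>>0. \<exists>\<delta>>0. \<forall>t\<in>cube d. \<forall>s. vplus d t s \<in> cube d \<and>
        0 < L2_set s {..<d} \<and> L2_set s {..<d} < \<delta> \<longrightarrow>
        \<bar>(rv_norm M (\<lambda>w. X (vplus d t s) w - X t w))\<^sup>2 /
          (\<Sum>j<length l. c j t * (L2_set (component l j s) {..<l ! j}) powr \<alpha> j) - 1\<bar> < \<epsilon>)"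

text \<open>
  The sample size \<open>N\<close> ranges over \<open>S\<close>, so limits are taken along
  \<open>inf sequentially (principal S)\<close>. The number \<open>n\<^sub>j(N)\<close> is \<open>n j N\<close>.
\<close>

definition cross_regular ::
  "nat set \<Rightarrow> nat list \<Rightarrow> (nat \<Rightarrow> real \<Rightarrow> real) \<Rightarrow> (nat \<Rightarrow> nat \<Rightarrow> nat) \<Rightarrow> bool" where
  "cross_regular S l h n \<longleftrightarrow>
     infinite S \<and> (\<forall>N\<in>S. 0 < N) \<and>
     (\<forall>j<length l. continuous_on {0..1} (h j) \<and> (\<forall>v\<in>{0..1}. 0 < h j v) \<and>
        (LINT v:{0..1}|lborel. h j v) = 1) \<and>
     (\<forall>N\<in>S. (\<forall>j<length l. 0 < n j N) \<and> (\<Prod>j<length l. n j N ^ (l ! j)) = N) \<and>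
     (\<forall>j<length l. filterlim (n j) at_top (inf sequentially (principal S)))"

text \<open>For a positive continuous density \<open>f\<close> the point is unique.\<close>

definition grid_point :: "(real \<Rightarrow> real) \<Rightarrow> nat \<Rightarrow> nat \<Rightarrow> real" where
  "grid_point f q i =
     (THE t. t \<in> {0..1} \<and> (LINT v:{0..t}|lborel. f v) = real i / real q)"

definition multi_indices :: "nat \<Rightarrow> nat list \<Rightarrow> (nat \<Rightarrow> nat \<Rightarrow> nat) \<Rightarrow> nat \<Rightarrow> (nat \<Rightarrow> nat) set" where
  "multi_indices d l n N = (\<Pi>\<^sub>E m\<in>{..<d}. {..<n (comp_of l m) N})"

definition stratum ::
  "nat \<Rightarrow> nat list \<Rightarrow> (nat \<Rightarrow> real \<Rightarrow> real) \<Rightarrow> (nat \<Rightarrow> nat \<Rightarrow> nat) \<Rightarrow> nat \<Rightarrow>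
    (nat \<Rightarrow> nat) \<Rightarrow> (nat \<Rightarrow> real) set" where
  "stratum d l h n N i =
     (\<Pi>\<^sub>E m\<in>{..<d}. {grid_point (h (comp_of l m)) (n (comp_of l m) N) (i m) ..
                      grid_point (h (comp_of l m)) (n (comp_of l m) N) (Suc (i m))})"

text \<open>
  The sampling points take values in their strata everywhere, not just almost surely, because
  the field carries information on \<open>cube d\<close> only.
\<close>

definition stratified_sampling ::
  "'w measure \<Rightarrow> 'w measure \<Rightarrow> nat \<Rightarrow> nat list \<Rightarrow> (nat \<Rightarrow> real \<Rightarrow> real) \<Rightarrow>
    (nat \<Rightarrow> nat \<Rightarrow> nat) \<Rightarrow> nat \<Rightarrow> ((nat \<Rightarrow> nat) \<Rightarrow> 'w \<Rightarrow> nat \<Rightarrow> real) \<Rightarrow> bool" where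
  "stratified_sampling M F d l h n N \<eta> \<longleftrightarrow>
     (\<forall>i\<in>multi_indices d l n N.
        \<eta> i \<in> measurable M (leb d) \<and>
        (\<forall>w\<in>space M. \<eta> i w \<in> stratum d l h n N i) \<and>
        distr M (leb d) (\<eta> i) = uniform_measure (leb d) (stratum d l h n N i)) \<and>
     prob_space.indep_vars M (\<lambda>_. leb d) \<eta> (multi_indices d l n N) \<and>
     prob_space.indep_set M (sets F)
       (sets (vimage_algebra (space M) (\<lambda>w. \<lambda>i\<in>multi_indices d l n N. \<eta> i w)
                (PiM (multi_indices d l n N) (\<lambda>_. leb d))))"

definition field_integral :: "nat \<Rightarrow> ((nat \<Rightarrow> real) \<Rightarrow> 'w \<Rightarrow> real) \<Rightarrow> 'w \<Rightarrow> real" where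
  "field_integral d X w = (LINT t:cube d|leb d. X t w)"

definition quadrature ::
  "nat \<Rightarrow> nat list \<Rightarrow> (nat \<Rightarrow> real \<Rightarrow> real) \<Rightarrow> (nat \<Rightarrow> nat \<Rightarrow> nat) \<Rightarrow> nat \<Rightarrow>
    ((nat \<Rightarrow> nat) \<Rightarrow> 'w \<Rightarrow> nat \<Rightarrow> real) \<Rightarrow> ((nat \<Rightarrow> real) \<Rightarrow> 'w \<Rightarrow> real) \<Rightarrow> 'w \<Rightarrow> real" where
  "quadrature d l h n N \<eta> X w =
     (\<Sum>i\<in>multi_indices d l n N. X (\<eta> i w) w * measure (leb d) (stratum d l h n N i))"

definition b_const :: "real \<Rightarrow> nat \<Rightarrow> (nat \<Rightarrow> real) \<Rightarrow> real" where
  "b_const \<beta> m u =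
     1 / 2 * (LINT t:cube m|leb m. (LINT v:cube m|leb m.
       (L2_set (\<lambda>i. u i * (t i - v i)) {..<m}) powr \<beta>))"

definition D_vec :: "nat list \<Rightarrow> (nat \<Rightarrow> real \<Rightarrow> real) \<Rightarrow> nat \<Rightarrow> (nat \<Rightarrow> real) \<Rightarrow> nat \<Rightarrow> real" where
  "D_vec l h j t = (\<lambda>i\<in>{..<l ! j}. 1 / h j (component l j t i))"

definition v_const ::
  "nat \<Rightarrow> nat list \<Rightarrow> (nat \<Rightarrow> real) \<Rightarrow> (nat \<Rightarrow> (nat \<Rightarrow> real) \<Rightarrow> real) \<Rightarrow>
    (nat \<Rightarrow> real \<Rightarrow> real) \<Rightarrow> nat \<Rightarrow> real" where
  "v_const d l \<alpha> c h j =
     (LINT t:cube d|leb d. c j t * b_const (\<alpha> j) (l ! j) (D_vec l h j t) *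
        (\<Prod>m<d. inverse (h (comp_of l m) (t m))))"

end

theory Submission
  imports Defs
begin

text \<open>
  Given the field, the sampling points are independent and each stratum contributes a centred term,
  so the mean square error is the sum over the strata of half the mean of
  \<open>E (X t - X u)\<^sup>2\<close> over two independent uniform points of the stratum, times the squared
  volume. On a small stratum, local stationarity replaces the variogram by
  \<open>\<Sum>\<^sub>j c\<^sub>j(\<tau>) \<parallel>(t - u)\<^sup>j\<parallel> powr \<alpha>\<^sub>j\<close>, with an arbitrary point \<open>\<tau>\<close> of the stratum, up to
  a factor \<open>r > 1\<close>; rescaling the stratum to the unit cube produces the constant \<open>b\<close>
  at the vector of side lengths, and by uniform continuity of \<open>h\<close> a side length is
  \<open>1 / (n h(\<tau>))\<close> up to a factor \<open>r\<close>. Since the resulting two-sided bound holds for every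
  \<open>\<tau>\<close>, averaging it over the stratum and summing turns the constants into exactly \<open>v\<^sub>j\<close>, without
  Riemann sums; finally \<open>r\<close> tends to 1.
\<close>

section \<open>Boxes and uniform measures\<close>

text \<open>All comparisons are multiplicative because the terms
  \<open>v_const d l \<alpha> c h j / real (n j N) powr \<alpha> j\<close> may have different orders
  as N grows: a factor common to all components controls their sum whichever of them dominates, and
  it tolerates arbitrarily elongated strata. The loss is always \<open>r ^ (d + 4)\<close>: d
  factors r from the side lengths in one volume, two from the homogeneity degree
  \<open>\<alpha> j < 2\<close> of b, one from the variogram and one from \<open>c j\<close>. Of the
  squared volume only one factor is converted into 1/N times the product of the
  \<open>1 / h\<close>; the other is kept, as the weight of the stratum in the integral defining v.
  Conditioning on the field means a product law on \<open>F\<close> times the law of the sampling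
  vector. Integrals are exchanged in \<open>ennreal\<close>; the finiteness behind the square
  integrable paths comes from a uniform second moment bound, a consequence of mean square continuity
  on the compact cube.\<close>

abbreviation rect :: "nat \<Rightarrow> (nat \<Rightarrow> real) \<Rightarrow> (nat \<Rightarrow> real) \<Rightarrow> (nat \<Rightarrow> real) set" where
  "rect m a b \<equiv> (\<Pi>\<^sub>E i\<in>{..<m}. {a i..b i})"

lemma space_leb: "space (leb m) = extensional {..<m}"
  by (auto simp: leb_def space_PiM PiE_def)

lemma rect_in_leb [measurable]: "rect m a b \<in> sets (leb m)"
  unfolding leb_def by (intro sets_PiM_I_finite) auto

lemma cube_eq_rect: "cube m = rect m (\<lambda>_. 0) (\<lambda>_. 1)"
  by (simp add: cube_def)

lemma cube_in_leb [measurable]: "cube m \<in> sets (leb m)"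
  unfolding cube_eq_rect by measurable

lemma leb_component [measurable]: "i < m \<Longrightarrow> (\<lambda>x. x i) \<in> borel_measurable (leb m)"
  using measurable_component_singleton[of i "{..<m}" "\<lambda>_. lborel :: real measure"]
  by (simp add: leb_def)

lemma emeasure_leb_PiE:
  assumes "\<And>i. i < m \<Longrightarrow> A i \<in> sets borel"
  shows "emeasure (leb m) (Pi\<^sub>E {..<m} A) = (\<Prod>i<m. emeasure lborel (A i))"
proof -
  interpret product_sigma_finite "\<lambda>_. lborel :: real measure" by standard
  show ?thesis unfolding leb_def by (rule emeasure_PiM) (use assms in auto)
qed

lemma emeasure_leb_rect:
  assumes "\<And>i. i < m \<Longrightarrow> a i \<le> b i"
  shows "emeasure (leb m) (rect m a b) = ennreal (\<Prod>i<m. b i - a i)"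
  using assms by (subst emeasure_leb_PiE) (auto intro!: prod_ennreal)

lemma measure_leb_rect:
  assumes "\<And>i. i < m \<Longrightarrow> a i \<le> b i"
  shows "measure (leb m) (rect m a b) = (\<Prod>i<m. b i - a i)"
proof -
  have "0 \<le> (\<Prod>i<m. b i - a i)" using assms by (intro prod_nonneg) auto
  moreover have "emeasure (leb m) (rect m a b) = ennreal (\<Prod>i<m. b i - a i)"
    using assms by (rule emeasure_leb_rect)
  ultimately show ?thesis by (simp add: measure_def)
qed

lemma emeasure_leb_cube: "emeasure (leb m) (cube m) = 1"
  unfolding cube_eq_rect by (subst emeasure_leb_rect) auto

lemma prob_uniform_Icc: "a < b \<Longrightarrow> prob_space (uniform_measure lborel {a..b::real})"
  by (intro prob_space_uniform_measure) auto

lemma prob_uniform_rect: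
  assumes "\<And>i. i < m \<Longrightarrow> a i < b i"
  shows "prob_space (uniform_measure (leb m) (rect m a b))"
proof (rule prob_space_uniform_measure)
  have "(\<Prod>i<m. b i - a i) > 0" using assms by (intro prod_pos) auto
  then show "emeasure (leb m) (rect m a b) \<noteq> 0" "emeasure (leb m) (rect m a b) \<noteq> \<infinity>"
    using assms by (subst emeasure_leb_rect; force simp: less_imp_le)+
qed

text \<open>Division in \<open>ennreal\<close> fails to distribute over products when zero and
  infinite denominators meet; positive real denominators exclude this.\<close>

lemma prod_divide_ennreal:
  fixes x :: "'a \<Rightarrow> ennreal" and w :: "'a \<Rightarrow> real"
  assumes "finite I" "\<And>i. i \<in> I \<Longrightarrow> 0 < w i"
  shows "(\<Prod>i\<in>I. x i / ennreal (w i)) = (\<Prod>i\<in>I. x i) / ennreal (\<Prod>i\<in>I. w i)"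
  using assms
proof (induction I rule: finite_induct)
  case (insert j I)
  have pos: "0 < (\<Prod>i\<in>I. w i)" "0 < w j" using insert by (auto intro: prod_pos)
  have "a / ennreal u * (c / ennreal v) = a * c / ennreal (u * v)"
    if "0 < u" "0 < v" for a c :: ennreal and u v :: real
    using that by (simp add: divide_ennreal_def inverse_ennreal ennreal_mult algebra_simps
        flip: ennreal_mult)
  with insert pos show ?case by simp
qed simp

lemma uniform_rect_eq_PiM:
  assumes ab: "\<And>i. i < m \<Longrightarrow> a i < b i"
  shows "uniform_measure (leb m) (rect m a b) = PiM {..<m} (\<lambda>i. uniform_measure lborel {a i..b i})"
proof -
  \<comment> \<open>Indices from m on receive \<open>lborel\<close> as a filler, since the product
    locale asks for a sigma-finite measure at every index while \<open>a i < b i\<close> is known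
    only below m.\<close>
  define M where "M i = (if i < m then uniform_measure lborel {a i..b i} else lborel)" for i
  have "\<And>i. sigma_finite_measure (M i)"
    by (auto simp: M_def intro!: prob_space_imp_sigma_finite prob_uniform_Icc ab sigma_finite_lborel)
  then interpret product_sigma_finite M by (simp add: product_sigma_finite_def)
  have "uniform_measure (leb m) (rect m a b) = PiM {..<m} M"
  proof (rule PiM_eqI)
    show "sets (uniform_measure (leb m) (rect m a b)) = sets (PiM {..<m} M)"
      by (auto simp: leb_def M_def intro!: sets_PiM_cong)
    fix A assume A: "\<And>i. i \<in> {..<m} \<Longrightarrow> A i \<in> sets (M i)"
    then have A': "\<And>i. i < m \<Longrightarrow> A i \<in> sets borel" by (auto simp: M_def)
    have "Pi\<^sub>E {..<m} A \<in> sets (leb m)"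
      unfolding leb_def by (intro sets_PiM_I_finite) (use A' in auto)
    then have "emeasure (uniform_measure (leb m) (rect m a b)) (Pi\<^sub>E {..<m} A) =
        emeasure (leb m) (rect m a b \<inter> Pi\<^sub>E {..<m} A) / emeasure (leb m) (rect m a b)"
      by (intro emeasure_uniform_measure) auto
    also have "rect m a b \<inter> Pi\<^sub>E {..<m} A = (\<Pi>\<^sub>E i\<in>{..<m}. {a i..b i} \<inter> A i)"
      by (simp add: PiE_Int)
    also have "emeasure (leb m) \<dots> / emeasure (leb m) (rect m a b) =
        (\<Prod>i<m. emeasure lborel ({a i..b i} \<inter> A i)) / ennreal (\<Prod>i<m. b i - a i)"
      using A' ab by (subst emeasure_leb_PiE) (auto simp: emeasure_leb_rect less_imp_le)
    also have "\<dots> = (\<Prod>i<m. emeasure lborel ({a i..b i} \<inter> A i) / ennreal (b i - a i))"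
      using ab by (subst prod_divide_ennreal) auto
    also have "\<dots> = (\<Prod>i<m. emeasure (M i) (A i))"
      using ab A' by (intro prod.cong) (auto simp: M_def less_imp_le)
    finally show "emeasure (uniform_measure (leb m) (rect m a b)) (Pi\<^sub>E {..<m} A) =
      (\<Prod>i\<in>{..<m}. emeasure (M i) (A i))" by simp
  qed simp
  also have "\<dots> = PiM {..<m} (\<lambda>i. uniform_measure lborel {a i..b i})"
    by (intro PiM_cong) (auto simp: M_def)
  finally show ?thesis .
qed

lemma ennreal_divide_one [simp]: "x / 1 = (x :: ennreal)"
  by (simp add: divide_ennreal_def)

section \<open>Rescaling uniform laws to the unit cube\<close>

lemma uniform_Icc_affine:
  fixes a b :: real
  assumes "a < b"
  shows "distr (uniform_measure lborel {a..b}) borel (\<lambda>x. (x - a) / (b - a))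
    = uniform_measure lborel {0..1}"
proof (rule measure_eqI)
  show "sets (distr (uniform_measure lborel {a..b}) borel (\<lambda>x. (x - a) / (b - a))) =
    sets (uniform_measure lborel {0..1})" by simp
  fix A assume "A \<in> sets (distr (uniform_measure lborel {a..b}) borel (\<lambda>x. (x - a) / (b - a)))"
  then have A [measurable]: "A \<in> sets borel" by simp
  have w: "b - a \<noteq> 0" "b - a > 0" using assms by auto
  let ?g = "\<lambda>x. (x - a) / (b - a)"
  have "emeasure lborel ({a..b} \<inter> ?g -` A) = (\<integral>\<^sup>+x. indicator ({a..b} \<inter> ?g -` A) x \<partial>lborel)"
    by (subst nn_integral_indicator) auto
  also have "\<dots> = ennreal (b - a) * (\<integral>\<^sup>+x. indicator ({a..b} \<inter> ?g -` A) (a + (b - a) * x) \<partial>lborel)"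
    using w by (subst nn_integral_real_affine[where c="b - a" and t=a]) (auto)
  also have "(\<lambda>x. indicator ({a..b} \<inter> ?g -` A) (a + (b - a) * x)) = (indicator ({0..1} \<inter> A) :: real \<Rightarrow> ennreal)"
  proof
    fix x
    have "a + (b - a) * x \<in> {a..b} \<longleftrightarrow> x \<in> {0..1}"
    proof -
      have "a + (b - a) * x \<le> b \<longleftrightarrow> (b - a) * x \<le> (b - a) * 1" by (auto simp: algebra_simps)
      also have "\<dots> \<longleftrightarrow> x \<le> 1" using w(2) by (rule mult_le_cancel_left_pos)
      finally show ?thesis using w by (auto simp: zero_le_mult_iff)
    qed
    moreover have "?g (a + (b - a) * x) = x" using w by simp
    ultimately show "indicator ({a..b} \<inter> ?g -` A) (a + (b - a) * x) = (indicator ({0..1} \<inter> A) x :: ennreal)"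
      by (auto simp: indicator_def)
  qed
  also have "(\<integral>\<^sup>+x. indicator ({0..1} \<inter> A) x \<partial>lborel) = emeasure lborel ({0..1} \<inter> A)"
    by (subst nn_integral_indicator) auto
  finally have "emeasure lborel ({a..b} \<inter> ?g -` A) = ennreal (b - a) * emeasure lborel ({0..1} \<inter> A)" .
  then have "emeasure lborel ({a..b} \<inter> ?g -` A) / ennreal (b - a) = emeasure lborel ({0..1} \<inter> A)"
    using w by (simp add: divide_ennreal_def inverse_ennreal mult.commute[of "ennreal (b - a)"] mult.assoc flip: ennreal_mult)
  moreover have g: "?g \<in> borel_measurable borel" by simp
  moreover have "?g -` A \<in> sets borel" using measurable_sets_borel[OF g A] .
  ultimately show "emeasure (distr (uniform_measure lborel {a..b}) borel ?g) A =
      emeasure (uniform_measure lborel {0..1}) A"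
    using w A by (simp add: emeasure_distr measurable_def emeasure_uniform_measure less_imp_le)
qed

text \<open>The injection f picks out the coordinates of one component. Injective reindexing sends a
  product law to the product of the selected factors, and the affine rescaling then acts on each
  coordinate separately.\<close>

lemma distr_uniform_rect_coords:
  assumes ab: "\<And>i. i < d \<Longrightarrow> a i < b i"
    and f: "inj_on f {..<m}" "f \<in> {..<m} \<rightarrow> {..<d}"
  shows "distr (uniform_measure (leb d) (rect d a b)) (leb m)
      (\<lambda>x. \<lambda>i\<in>{..<m}. (x (f i) - a (f i)) / (b (f i) - a (f i)))
    = uniform_measure (leb m) (cube m)"
proof -
  define U where "U i = uniform_measure lborel {a i..b i}" for i
  have U [simp]: "sets (U i) = sets borel" "space (U i) = UNIV" for i by (auto simp: U_def)
  have fm: "f i < d" if "i < m" for i using f that by auto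
  have pU: "i < d \<Longrightarrow> prob_space (U i)" for i using ab prob_uniform_Icc by (simp add: U_def)
  \<comment> \<open>Only the indices below m matter; the uniform law on the unit interval fills the
    others with probability measures, as the locale requires.\<close>
  define V where "V i = (if i < m then U (f i) else uniform_measure lborel {0..1})" for i
  have pV: "prob_space (V i)" for i using pU fm prob_uniform_Icc by (simp add: V_def)
  interpret product_prob_space V by (intro product_prob_spaceI pV)
  have V [simp]: "sets (V i) = sets borel" "space (V i) = UNIV" for i by (auto simp: V_def)
  define W where "W i = (uniform_measure lborel {0..1} :: real measure)" for i :: nat
  have pW: "prob_space (W i)" for i using prob_uniform_Icc by (simp add: W_def)
  interpret W: product_prob_space W by (intro product_prob_spaceI pW)
  have [simp]: "sets (W i) = sets borel" "space (W i) = UNIV" for i by (auto simp: W_def)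
  define g where "g i x = (x - a (f i)) / (b (f i) - a (f i))" for i x
  have g [measurable]: "g i \<in> borel_measurable borel" for i by (simp add: g_def[abs_def])
  have VF: "PiM {..<m} V = (PiM {..<m} (\<lambda>i. U (f i)))"
    by (intro PiM_cong) (auto simp: V_def)
  have sV [measurable_cong]: "sets (PiM {..<m} V) = sets (PiM {..<m} (\<lambda>_. borel))"
    by (intro sets_PiM_cong) auto
  have sU [measurable_cong]: "sets (PiM {..<d} U) = sets (PiM {..<d} (\<lambda>_. borel))"
    by (intro sets_PiM_cong) auto
  have sL [measurable_cong]: "sets (leb m) = sets (PiM {..<m} (\<lambda>_. borel))" for m
    unfolding leb_def by (intro sets_PiM_cong) auto
  have m1 [measurable]: "(\<lambda>x. \<lambda>i\<in>{..<m}. g i (x i)) \<in> PiM {..<m} V \<rightarrow>\<^sub>M leb m"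
    by measurable
  have m2 [measurable]: "(\<lambda>x. \<lambda>i\<in>{..<m}. x (f i)) \<in> PiM {..<d} U \<rightarrow>\<^sub>M PiM {..<m} V"
    by (rule measurable_restrict) (use measurable_component_singleton[of _ "{..<d}" U] fm in \<open>auto simp: V_def\<close>)
  have "uniform_measure (leb d) (rect d a b) = PiM {..<d} U"
    unfolding U_def using ab by (rule uniform_rect_eq_PiM)
  then have "distr (uniform_measure (leb d) (rect d a b)) (leb m) (\<lambda>x. \<lambda>i\<in>{..<m}. g i (x (f i)))
     = distr (distr (PiM {..<d} U) (PiM {..<m} V) (\<lambda>x. \<lambda>i\<in>{..<m}. x (f i))) (leb m) (\<lambda>x. \<lambda>i\<in>{..<m}. g i (x i))"
    by (subst distr_distr) (auto intro!: distr_cong simp: o_def)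
  also have "distr (PiM {..<d} U) (PiM {..<m} V) (\<lambda>x. \<lambda>i\<in>{..<m}. x (f i)) = PiM {..<m} V"
    unfolding VF by (rule distr_PiM_reindex) (use pU f in auto)
  also have "distr (PiM {..<m} V) (leb m) (\<lambda>x. \<lambda>i\<in>{..<m}. g i (x i)) = PiM {..<m} W"
  proof (rule W.PiM_eqI)
    show "sets (distr (PiM {..<m} V) (leb m) (\<lambda>x. \<lambda>i\<in>{..<m}. g i (x i))) = sets (PiM {..<m} W)"
      by (simp add: leb_def W_def cong: sets_PiM_cong)
    fix A :: "nat \<Rightarrow> real set" assume "\<And>i. i \<in> {..<m} \<Longrightarrow> A i \<in> sets (W i)"
    then have A: "i < m \<Longrightarrow> A i \<in> sets borel" for i by simp
    have PA: "Pi\<^sub>E {..<m} A \<in> sets (leb m)"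
      unfolding leb_def by (intro sets_PiM_I_finite) (use A in auto)
    have pre: "(\<lambda>x. \<lambda>i\<in>{..<m}. g i (x i)) -` (Pi\<^sub>E {..<m} A) \<inter> space (PiM {..<m} V) =
        (\<Pi>\<^sub>E i\<in>{..<m}. g i -` A i)"
      by (auto simp: space_PiM PiE_def Pi_def extensional_def)
    have "emeasure (distr (PiM {..<m} V) (leb m) (\<lambda>x. \<lambda>i\<in>{..<m}. g i (x i))) (Pi\<^sub>E {..<m} A) =
        emeasure (PiM {..<m} V) (\<Pi>\<^sub>E i\<in>{..<m}. g i -` A i)"
      using PA by (subst emeasure_distr[OF m1]) (auto simp: pre)
    also have "\<dots> = (\<Prod>i<m. emeasure (V i) (g i -` A i))"
      by (subst emeasure_PiM) (auto intro!: measurable_sets_borel[OF g] A)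
    also have "\<dots> = (\<Prod>i<m. emeasure (W i) (A i))"
    proof (intro prod.cong refl)
      fix i assume "i \<in> {..<m}"
      then have i: "i < m" by simp
      have "W i = distr (V i) borel (g i)"
        using i uniform_Icc_affine[OF ab[OF fm[OF i]]] by (simp add: W_def V_def U_def g_def[abs_def])
      then show "emeasure (V i) (g i -` A i) = emeasure (W i) (A i)"
        using A[OF i] g[of i] by (simp add: emeasure_distr measurable_def)
    qed
    finally show "emeasure (distr (PiM {..<m} V) (leb m) (\<lambda>x. \<lambda>i\<in>{..<m}. g i (x i))) (Pi\<^sub>E {..<m} A)
       = (\<Prod>i\<in>{..<m}. emeasure (W i) (A i))" .
  qed simp
  also have "\<dots> = uniform_measure (leb m) (cube m)"
    unfolding W_def cube_eq_rect by (subst uniform_rect_eq_PiM) auto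
  finally show ?thesis unfolding g_def .
qed

text \<open>Normalising by the positive finite mass of A. The identity covers nonintegrable f as
  well, both integrals being 0 by convention.\<close>

lemma set_integral_uniform_measure:
  fixes f :: "'a \<Rightarrow> real"
  assumes A [measurable]: "A \<in> sets M" and f [measurable]: "f \<in> borel_measurable M"
    and fin: "emeasure M A \<noteq> 0" "emeasure M A \<noteq> \<infinity>"
  shows "(LINT x:A|M. f x) = measure M A * (LINT x|uniform_measure M A. f x)"
proof -
  have m: "emeasure M A = ennreal (measure M A)" "measure M A > 0"
    using fin by (auto simp: emeasure_eq_ennreal_measure zero_less_measure_iff)
  have "indicator A x / emeasure M A = ennreal (indicator A x / measure M A)" for x
    using m divide_ennreal[of 1 "measure M A"] by (auto simp: indicator_def)
  then have "uniform_measure M A = density M (\<lambda>x. ennreal (indicator A x / measure M A))"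
    by (simp add: uniform_measure_def)
  then have "(LINT x|uniform_measure M A. f x) = (LINT x|M. (indicator A x / measure M A) *\<^sub>R f x)"
    using m by (simp add: integral_density)
  also have "\<dots> = (LINT x|M. indicator A x *\<^sub>R f x / measure M A)"
    by (simp)
  also have "\<dots> = (LINT x:A|M. f x) / measure M A"
    unfolding set_lebesgue_integral_def by (rule integral_divide_zero)
  finally show ?thesis using m by simp
qed

section \<open>Mean square error of stratified sampling\<close>

text \<open>Twice the variance, obtained by expanding the square and integrating first over u, then
  over t. The left side is a nonnegative iterated integral so that it can later be exchanged with
  the expectation over the field.\<close>

lemma (in prob_space) nn_integral_square_diff:
  fixes f :: "'a \<Rightarrow> real"
  assumes f [measurable]: "f \<in> borel_measurable M" and sq: "integrable M (\<lambda>x. (f x)\<^sup>2)"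
  shows "(\<integral>\<^sup>+t. \<integral>\<^sup>+u. ennreal ((f t - f u)\<^sup>2) \<partial>M \<partial>M) = ennreal (2 * (LINT x|M. ((LINT y|M. f y) - f x)\<^sup>2))"
proof -
  have i1: "integrable M f" using f sq by (rule square_integrable_imp_integrable)
  define m where "m = (LINT y|M. f y)"
  define s where "s = (LINT y|M. (f y)\<^sup>2)"
  have exp: "(a - f u)\<^sup>2 = a\<^sup>2 - 2 * a * f u + (f u)\<^sup>2" for a u by (simp add: power2_eq_square algebra_simps)
  have int: "integrable M (\<lambda>u. (a - f u)\<^sup>2)" for a unfolding exp using i1 sq by simp
  have val: "(LINT u|M. (a - f u)\<^sup>2) = a\<^sup>2 - 2 * a * m + s" for a
    unfolding exp using i1 sq by (simp add: m_def s_def prob_space)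
  have "(\<integral>\<^sup>+t. \<integral>\<^sup>+u. ennreal ((f t - f u)\<^sup>2) \<partial>M \<partial>M) = (\<integral>\<^sup>+t. ennreal ((f t)\<^sup>2 - 2 * f t * m + s) \<partial>M)"
    by (simp add: nn_integral_eq_integral[OF int] val)
  also have "\<dots> = ennreal (LINT t|M. (f t)\<^sup>2 - 2 * f t * m + s)"
  proof (rule nn_integral_eq_integral)
    show "integrable M (\<lambda>t. (f t)\<^sup>2 - 2 * f t * m + s)" using i1 sq by simp
    show "AE t in M. 0 \<le> (f t)\<^sup>2 - 2 * f t * m + s" by (auto simp flip: val)
  qed
  also have "(LINT t|M. (f t)\<^sup>2 - 2 * f t * m + s) = s - 2 * m * m + s"
    using i1 sq by (simp add: prob_space flip: m_def s_def)
  also have "\<dots> = 2 * (LINT x|M. (m - f x)\<^sup>2)" unfolding val by (simp add: power2_eq_square)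
  finally show ?thesis by (simp add: m_def)
qed

text \<open>Orthogonality: centred functions of different coordinates have a product of mean zero
  under a product law, so the off-diagonal terms of the squared sum disappear.\<close>

lemma integral_square_sum_PiM:
  fixes f :: "'i \<Rightarrow> 'a \<Rightarrow> real"
  assumes fin: "finite I" and U: "\<And>i. i \<in> I \<Longrightarrow> prob_space (U i)"
    and f [measurable]: "\<And>i. i \<in> I \<Longrightarrow> f i \<in> borel_measurable (U i)"
    and sq: "\<And>i. i \<in> I \<Longrightarrow> integrable (U i) (\<lambda>x. (f i x)\<^sup>2)"
    and zero: "\<And>i. i \<in> I \<Longrightarrow> (LINT x|U i. f i x) = 0"
  shows "integrable (PiM I U) (\<lambda>x. (\<Sum>i\<in>I. f i (x i))\<^sup>2)"
    and "(LINT x|PiM I U. (\<Sum>i\<in>I. f i (x i))\<^sup>2) = (\<Sum>i\<in>I. LINT x|U i. (f i x)\<^sup>2)"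
proof -
  \<comment> \<open>A point mass serves as filler outside I, where nothing is known about
    \<open>U i\<close>.\<close>
  define V where "V i = (if i \<in> I then U i else return (count_space UNIV) undefined)" for i
  have pV: "prob_space (V i)" for i using U by (simp add: V_def prob_space_return)
  interpret product_prob_space V by (intro product_prob_spaceI pV)
  have PV: "PiM I U = PiM I V" by (intro PiM_cong) (auto simp: V_def)
  have [measurable]: "i \<in> I \<Longrightarrow> f i \<in> borel_measurable (V i)" for i using f by (simp add: V_def)
  have comp: "distr (PiM I V) (V i) (\<lambda>x. x i) = V i" if "i \<in> I" for i
    using that pV by (intro distr_PiM_component) auto
  have fI: "integrable (V i) (f i)" if "i \<in> I" for i
    using that finite_measure.square_integrable_imp_integrable[OF prob_space.finite_measure[OF pV], of "f i" i] sq
    by (simp add: V_def)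
  have diag: "integrable (PiM I V) (\<lambda>x. f i (x i) * f i (x i))"
    "(LINT x|PiM I V. f i (x i) * f i (x i)) = (LINT x|U i. (f i x)\<^sup>2)" if i: "i \<in> I" for i
  proof -
    have "integrable (distr (PiM I V) (V i) (\<lambda>x. x i)) (\<lambda>x. (f i x)\<^sup>2)"
      unfolding comp[OF i] using sq[OF i] i by (simp add: V_def)
    then show "integrable (PiM I V) (\<lambda>x. f i (x i) * f i (x i))"
      using i by (subst (asm) integrable_distr_eq) (auto simp: power2_eq_square)
    have "(LINT x|U i. (f i x)\<^sup>2) = (LINT x|distr (PiM I V) (V i) (\<lambda>x. x i). (f i x)\<^sup>2)"
      unfolding comp[OF i] using i by (simp add: V_def)
    also have "\<dots> = (LINT x|PiM I V. (f i (x i))\<^sup>2)" using i by (subst integral_distr) auto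
    finally show "(LINT x|PiM I V. f i (x i) * f i (x i)) = (LINT x|U i. (f i x)\<^sup>2)"
      by (simp add: power2_eq_square)
  qed
  have off: "integrable (PiM I V) (\<lambda>x. f i (x i) * f j (x j))"
    "(LINT x|PiM I V. f i (x i) * f j (x j)) = 0" if i: "i \<in> I" and j: "j \<in> I" and ij: "i \<noteq> j" for i j
  proof -
    \<comment> \<open>Padding with the constant 1 turns the cross term into a product over all of I;
      its expectation factorises, and the factor at i vanishes.\<close>
    define g where "g k = (if k \<in> {i, j} then f k else (\<lambda>_. 1))" for k
    have gI: "integrable (V k) (g k)" if "k \<in> I" for k
      using that fI prob_space.finite_measure[OF pV] by (simp add: g_def finite_measure.integrable_const)
    have g_prod: "f i (x i) * f j (x j) = (\<Prod>k\<in>I. g k (x k))" for x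
    proof -
      have "(\<Prod>k\<in>I. g k (x k)) = (\<Prod>k\<in>{i, j}. g k (x k))"
        using i j fin by (intro prod.mono_neutral_right) (auto simp: g_def)
      then show ?thesis using ij by (simp add: g_def)
    qed
    show "integrable (PiM I V) (\<lambda>x. f i (x i) * f j (x j))"
      unfolding g_prod using fin gI by (rule product_integrable_prod)
    have "(LINT x|PiM I V. f i (x i) * f j (x j)) = (\<Prod>k\<in>I. LINT x|V k. g k x)"
      unfolding g_prod using fin gI by (rule product_integral_prod)
    also have "\<dots> = 0"
      using i zero[OF i] fin by (intro prod_zero) (auto simp: g_def V_def intro!: bexI[of _ i])
    finally show "(LINT x|PiM I V. f i (x i) * f j (x j)) = 0" .
  qed
  have int: "integrable (PiM I V) (\<lambda>x. f i (x i) * f j (x j))" if "i \<in> I" "j \<in> I" for i j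
    using that diag off by (cases "i = j") auto
  have sq_sum: "(\<Sum>i\<in>I. f i (x i))\<^sup>2 = (\<Sum>i\<in>I. \<Sum>j\<in>I. f i (x i) * f j (x j))" for x
    by (simp add: power2_eq_square sum_product)
  show "integrable (PiM I U) (\<lambda>x. (\<Sum>i\<in>I. f i (x i))\<^sup>2)"
    unfolding PV sq_sum using int by (intro Bochner_Integration.integrable_sum) auto
  have "(LINT x|PiM I V. (\<Sum>i\<in>I. f i (x i))\<^sup>2) =
      (\<Sum>i\<in>I. \<Sum>j\<in>I. LINT x|PiM I V. f i (x i) * f j (x j))"
    unfolding sq_sum using int
    by (subst Bochner_Integration.integral_sum, fastforce intro!: Bochner_Integration.integrable_sum)
       (auto intro!: sum.cong Bochner_Integration.integral_sum)
  also have "\<dots> = (\<Sum>i\<in>I. \<Sum>j\<in>I. if i = j then (LINT x|U i. (f i x)\<^sup>2) else 0)"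
    using diag off by (intro sum.cong) auto
  also have "\<dots> = (\<Sum>i\<in>I. LINT x|U i. (f i x)\<^sup>2)" using fin by simp
  finally show "(LINT x|PiM I U. (\<Sum>i\<in>I. f i (x i))\<^sup>2) = (\<Sum>i\<in>I. LINT x|U i. (f i x)\<^sup>2)"
    unfolding PV .
qed

lemma distr_id_subalgebra:
  assumes "subalgebra M F"
  shows "(\<lambda>w. w) \<in> M \<rightarrow>\<^sub>M F"
  using assms by (intro measurableI) (auto simp: subalgebra_def dest: sets.sets_into_space)

text \<open>By Tonelli the integral over U is a function of w with finite expectation, hence finite
  for almost every w.\<close>

lemma AE_square_integrable_section:
  fixes Y :: "'t \<Rightarrow> 'w \<Rightarrow> real"
  assumes "sigma_finite_measure U" "sigma_finite_measure P"
    and Y [measurable]: "(\<lambda>(t, w). Y t w) \<in> borel_measurable (U \<Otimes>\<^sub>M P)"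
    and fin: "(\<integral>\<^sup>+t. \<integral>\<^sup>+w. ennreal ((Y t w)\<^sup>2) \<partial>P \<partial>U) < \<infinity>"
  shows "AE w in P. integrable U (\<lambda>t. (Y t w)\<^sup>2)"
proof -
  interpret U: sigma_finite_measure U by fact
  interpret P: sigma_finite_measure P by fact
  interpret pair_sigma_finite U P ..
  have "(\<integral>\<^sup>+w. \<integral>\<^sup>+t. ennreal ((Y t w)\<^sup>2) \<partial>U \<partial>P) = (\<integral>\<^sup>+t. \<integral>\<^sup>+w. ennreal ((Y t w)\<^sup>2) \<partial>P \<partial>U)"
    by (rule Fubini') measurable
  with fin have "AE w in P. (\<integral>\<^sup>+t. ennreal ((Y t w)\<^sup>2) \<partial>U) \<noteq> \<infinity>"
    by (intro nn_integral_PInf_AE) auto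
  then show ?thesis
    by (auto intro!: integrableI_nonneg simp: top.not_eq_extremum elim!: AE_mp)
qed

text \<open>
  Given the field, the centred terms of the sum are independent with mean 0, so only the diagonal
  survives; and a variance is half the mean squared difference of two independent copies.
\<close>

lemma stratified_mean_square_error:
  fixes Y :: "'t \<Rightarrow> 'w \<Rightarrow> real" and v :: "'i \<Rightarrow> real"
  assumes M: "prob_space M" and sub: "subalgebra M F" and I: "finite I" "I \<noteq> {}"
    and U: "\<And>i. i \<in> I \<Longrightarrow> prob_space (U i)"
    and sU: "\<And>i. i \<in> I \<Longrightarrow> sets (U i) = sets S"
    and \<eta> [measurable]: "\<And>i. i \<in> I \<Longrightarrow> \<eta> i \<in> M \<rightarrow>\<^sub>M S"
    and law: "\<And>i. i \<in> I \<Longrightarrow> distr M S (\<eta> i) = U i"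
    and ind: "prob_space.indep_vars M (\<lambda>_. S) \<eta> I"
    and indF: "prob_space.indep_set M (sets F)
       (sets (vimage_algebra (space M) (\<lambda>w. \<lambda>i\<in>I. \<eta> i w) (PiM I (\<lambda>_. S))))"
    and Y [measurable]: "(\<lambda>(t, w). Y t w) \<in> borel_measurable (S \<Otimes>\<^sub>M F)"
    and fin: "\<And>i. i \<in> I \<Longrightarrow> (\<integral>\<^sup>+t. \<integral>\<^sup>+w. ennreal ((Y t w)\<^sup>2) \<partial>M \<partial>U i) < \<infinity>"
  shows "(\<integral>\<^sup>+w. ennreal ((\<Sum>i\<in>I. v i * ((LINT t|U i. Y t w) - Y (\<eta> i w) w))\<^sup>2) \<partial>M) =
    (\<Sum>i\<in>I. ennreal ((v i)\<^sup>2 / 2) * (\<integral>\<^sup>+t. \<integral>\<^sup>+u. \<integral>\<^sup>+w. ennreal ((Y t w - Y u w)\<^sup>2) \<partial>M \<partial>U i \<partial>U i))"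
proof -
  interpret M: prob_space M by fact
  have idF [measurable]: "(\<lambda>w. w) \<in> M \<rightarrow>\<^sub>M F" using sub by (rule distr_id_subalgebra)
  \<comment> \<open>\<open>P\<close> is M restricted to \<open>F\<close>. The field variable is kept
    there because joint measurability of Y and independence from the sampling points are both stated
    relative to \<open>F\<close>.\<close>
  define P where "P = distr M F (\<lambda>w. w)"
  have sP [measurable_cong, simp]: "sets P = sets F" by (simp add: P_def)
  have spP: "space P = space F" by (simp add: P_def)
  interpret P: prob_space P unfolding P_def by (rule M.prob_space_distr) measurable
  \<comment> \<open>The filler is the law of some actual sampling point, a probability measure on
    the sigma-algebra of \<open>S\<close>; its existence rests on I being nonempty.\<close>
  define V where "V i = (if i \<in> I then U i else distr M S (\<eta> (SOME i. i \<in> I)))" for i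
  have some: "(SOME i. i \<in> I) \<in> I" using I by (simp add: some_in_eq)
  have pV: "prob_space (V i)" for i
    using U some by (auto simp: V_def intro!: M.prob_space_distr)
  have sV [measurable_cong, simp]: "sets (V i) = sets S" for i
    using sU some by (auto simp: V_def)
  interpret V: product_prob_space V by (intro product_prob_spaceI pV)
  define K where "K = PiM I V"
  interpret K: prob_space K unfolding K_def by (intro prob_space_PiM pV)
  have KU: "K = PiM I U" unfolding K_def by (intro PiM_cong) (auto simp: V_def)
  have sK [measurable_cong]: "sets K = sets (PiM I (\<lambda>_. S))"
    unfolding K_def by (intro sets_PiM_cong) auto
  have H [measurable]: "(\<lambda>w. \<lambda>i\<in>I. \<eta> i w) \<in> M \<rightarrow>\<^sub>M PiM I (\<lambda>_. S)" by measurable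
  have spF: "space F = space M" using sub by (simp add: subalgebra_def)
  \<comment> \<open>Independence of the whole sampling vector from \<open>F\<close> enters here: the
    pair of outcome and sampling vector has a product law. This is what makes "given the field" an
    iterated integral.\<close>
  have "distr M F (\<lambda>w. w) \<Otimes>\<^sub>M distr M (PiM I (\<lambda>_. S)) (\<lambda>w. \<lambda>i\<in>I. \<eta> i w) =
      distr M (F \<Otimes>\<^sub>M PiM I (\<lambda>_. S)) (\<lambda>w. (w, \<lambda>i\<in>I. \<eta> i w))"
  proof (rule pair_measure_eqI)
    show "sigma_finite_measure (distr M F (\<lambda>w. w))"
      by (intro prob_space_imp_sigma_finite M.prob_space_distr) measurable
    show "sigma_finite_measure (distr M (PiM I (\<lambda>_. S)) (\<lambda>w. \<lambda>i\<in>I. \<eta> i w))"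
      by (intro prob_space_imp_sigma_finite M.prob_space_distr) measurable
    show "sets (distr M F (\<lambda>w. w) \<Otimes>\<^sub>M distr M (PiM I (\<lambda>_. S)) (\<lambda>w. \<lambda>i\<in>I. \<eta> i w)) =
      sets (distr M (F \<Otimes>\<^sub>M PiM I (\<lambda>_. S)) (\<lambda>w. (w, \<lambda>i\<in>I. \<eta> i w)))"
      by (simp cong: sets_pair_measure_cong)
    fix A B assume "A \<in> sets (distr M F (\<lambda>w. w))" "B \<in> sets (distr M (PiM I (\<lambda>_. S)) (\<lambda>w. \<lambda>i\<in>I. \<eta> i w))"
    then have A [measurable]: "A \<in> sets F" and B [measurable]: "B \<in> sets (PiM I (\<lambda>_. S))" by auto
    let ?B = "(\<lambda>w. \<lambda>i\<in>I. \<eta> i w) -` B \<inter> space M"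
    have AM: "A \<subseteq> space M" using sets.sets_into_space[OF A] by (simp add: spF)
    have "?B \<in> sets (vimage_algebra (space M) (\<lambda>w. \<lambda>i\<in>I. \<eta> i w) (PiM I (\<lambda>_. S)))"
      using B by (rule in_vimage_algebra)
    then have "M.prob (A \<inter> ?B) = M.prob A * M.prob ?B"
      by (rule M.indep_setD[OF indF A])
    then have "emeasure M (A \<inter> ?B) = emeasure M A * emeasure M ?B"
      by (simp add: M.emeasure_eq_measure ennreal_mult)
    moreover have "(\<lambda>w. (w, \<lambda>i\<in>I. \<eta> i w)) -` (A \<times> B) \<inter> space M = A \<inter> ?B"
      using AM by auto
    moreover have "(\<lambda>w. w) -` A \<inter> space M = A" using AM by auto
    ultimately show "emeasure (distr M F (\<lambda>w. w)) A *
        emeasure (distr M (PiM I (\<lambda>_. S)) (\<lambda>w. \<lambda>i\<in>I. \<eta> i w)) B =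
        emeasure (distr M (F \<Otimes>\<^sub>M PiM I (\<lambda>_. S)) (\<lambda>w. (w, \<lambda>i\<in>I. \<eta> i w))) (A \<times> B)"
      by (simp add: emeasure_distr)
  qed
  moreover have "distr M (PiM I (\<lambda>_. S)) (\<lambda>w. \<lambda>i\<in>I. \<eta> i w) = PiM I (\<lambda>i. distr M S (\<eta> i))"
    using ind I \<eta> by (simp add: M.indep_vars_iff_distr_eq_PiM')
  moreover have "PiM I (\<lambda>i. distr M S (\<eta> i)) = K"
    unfolding KU using law by (intro PiM_cong) auto
  ultimately have joint: "distr M (F \<Otimes>\<^sub>M PiM I (\<lambda>_. S)) (\<lambda>w. (w, \<lambda>i\<in>I. \<eta> i w)) = P \<Otimes>\<^sub>M K"
    by (simp add: P_def)
  define m where "m i w = (LINT t|V i. Y t w)" for i w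
  have m [measurable]: "m i \<in> borel_measurable F" for i
  proof -
    have "(\<lambda>(w, t). Y t w) \<in> borel_measurable (F \<Otimes>\<^sub>M V i)" by measurable
    then show ?thesis unfolding m_def by measurable
  qed
  define G where "G = (\<lambda>(w, x). ennreal ((\<Sum>i\<in>I. v i * (m i w - Y (x i) w))\<^sup>2))"
  have Yx [measurable]: "(\<lambda>p. Y (snd p i) (fst p)) \<in> borel_measurable (F \<Otimes>\<^sub>M PiM I (\<lambda>_. S))" if "i \<in> I" for i
  proof -
    have "(\<lambda>p. (snd p i, fst p)) \<in> F \<Otimes>\<^sub>M PiM I (\<lambda>_. S) \<rightarrow>\<^sub>M S \<Otimes>\<^sub>M F"
      using that by measurable
    from measurable_compose[OF this Y] show ?thesis by simp
  qed
  have G [measurable]: "G \<in> borel_measurable (F \<Otimes>\<^sub>M PiM I (\<lambda>_. S))"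
    unfolding G_def case_prod_beta by measurable
  have "(\<integral>\<^sup>+w. ennreal ((\<Sum>i\<in>I. v i * ((LINT t|U i. Y t w) - Y (\<eta> i w) w))\<^sup>2) \<partial>M) =
      (\<integral>\<^sup>+w. G (w, \<lambda>i\<in>I. \<eta> i w) \<partial>M)"
    by (auto simp: G_def m_def V_def intro!: nn_integral_cong)
  also have "\<dots> = (\<integral>\<^sup>+p. G p \<partial>(P \<Otimes>\<^sub>M K))"
    unfolding joint[symmetric] by (subst nn_integral_distr) auto
  also have "\<dots> = (\<integral>\<^sup>+w. \<integral>\<^sup>+x. G (w, x) \<partial>K \<partial>P)"
    by (subst K.nn_integral_fst) auto
  also have "\<dots> = (\<integral>\<^sup>+w. (\<Sum>i\<in>I. ennreal ((v i)\<^sup>2 / 2) * (\<integral>\<^sup>+t. \<integral>\<^sup>+u. ennreal ((Y t w - Y u w)\<^sup>2) \<partial>V i \<partial>V i)) \<partial>P)"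
  proof (rule nn_integral_cong_AE)
    \<comment> \<open>Paths are square integrable only for almost every w, so the conditional
      computation is carried out outside a null set.\<close>
    have "AE w in P. integrable (V i) (\<lambda>t. (Y t w)\<^sup>2)" if i: "i \<in> I" for i
    proof (rule AE_square_integrable_section)
      show "sigma_finite_measure (V i)" by (intro prob_space_imp_sigma_finite pV)
      show "sigma_finite_measure P" by (intro prob_space_imp_sigma_finite) unfold_locales
      have "(\<integral>\<^sup>+w. ennreal ((Y t w)\<^sup>2) \<partial>P) = (\<integral>\<^sup>+w. ennreal ((Y t w)\<^sup>2) \<partial>M)" if "t \<in> space S" for t
        unfolding P_def using that by (subst nn_integral_distr) auto
      then have "(\<integral>\<^sup>+t. \<integral>\<^sup>+w. ennreal ((Y t w)\<^sup>2) \<partial>P \<partial>V i) = (\<integral>\<^sup>+t. \<integral>\<^sup>+w. ennreal ((Y t w)\<^sup>2) \<partial>M \<partial>U i)"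
        using i sets_eq_imp_space_eq[OF sU[OF i]] by (auto simp: V_def intro!: nn_integral_cong)
      then show "(\<integral>\<^sup>+t. \<integral>\<^sup>+w. ennreal ((Y t w)\<^sup>2) \<partial>P \<partial>V i) < \<infinity>" using fin[OF i] by simp
    qed measurable
    then have "AE w in P. \<forall>i\<in>I. integrable (V i) (\<lambda>t. (Y t w)\<^sup>2)"
      using I by (simp add: AE_finite_all)
    then show "AE w in P. (\<integral>\<^sup>+x. G (w, x) \<partial>K) =
      (\<Sum>i\<in>I. ennreal ((v i)\<^sup>2 / 2) * (\<integral>\<^sup>+t. \<integral>\<^sup>+u. ennreal ((Y t w - Y u w)\<^sup>2) \<partial>V i \<partial>V i))"
    proof (rule AE_mp, intro AE_I2 impI)
      fix w assume w: "w \<in> space P" and sq: "\<forall>i\<in>I. integrable (V i) (\<lambda>t. (Y t w)\<^sup>2)"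
      from w have wF: "w \<in> space F" by (simp add: spP)
      have Yw [measurable]: "(\<lambda>t. Y t w) \<in> borel_measurable S" using wF by measurable
      define f where "f i t = v i * (m i w - Y t w)" for i t
      have f [measurable]: "f i \<in> borel_measurable (V i)" for i unfolding f_def[abs_def] by measurable
      have Y1: "integrable (V i) (\<lambda>t. Y t w)" if "i \<in> I" for i
        using sq that finite_measure.square_integrable_imp_integrable[OF prob_space.finite_measure[OF pV],
            of "\<lambda>t. Y t w" i]
        by auto
      have fsq: "integrable (V i) (\<lambda>t. (f i t)\<^sup>2)" if "i \<in> I" for i
      proof -
        have *: "(f i t)\<^sup>2 = (v i)\<^sup>2 * ((m i w)\<^sup>2 - 2 * m i w * Y t w + (Y t w)\<^sup>2)" for t
          by (simp add: f_def power2_eq_square algebra_simps)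
        show ?thesis unfolding * using Y1[OF that] sq that prob_space.finite_measure[OF pV]
          by (simp add: finite_measure.integrable_const)
      qed
      have f0: "(LINT t|V i. f i t) = 0" if "i \<in> I" for i
      proof -
        show ?thesis unfolding f_def using Y1[OF that] by (simp add: m_def prob_space.prob_space[OF pV])
      qed
      have "(\<integral>\<^sup>+x. G (w, x) \<partial>K) = (\<integral>\<^sup>+x. ennreal ((\<Sum>i\<in>I. f i (x i))\<^sup>2) \<partial>PiM I V)"
        by (simp add: G_def f_def K_def)
      also have "\<dots> = ennreal (LINT x|PiM I V. (\<Sum>i\<in>I. f i (x i))\<^sup>2)"
        by (intro nn_integral_eq_integral integral_square_sum_PiM(1)) (use I pV fsq f0 in auto)
      also have "\<dots> = ennreal (\<Sum>i\<in>I. LINT t|V i. (f i t)\<^sup>2)"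
        by (subst integral_square_sum_PiM(2)) (use I pV fsq f0 in auto)
      also have "\<dots> = (\<Sum>i\<in>I. ennreal (LINT t|V i. (f i t)\<^sup>2))" by simp
      also have "\<dots> = (\<Sum>i\<in>I. ennreal ((v i)\<^sup>2 / 2) * (\<integral>\<^sup>+t. \<integral>\<^sup>+u. ennreal ((Y t w - Y u w)\<^sup>2) \<partial>V i \<partial>V i))"
      proof (intro sum.cong refl)
        fix i assume i: "i \<in> I"
        have "(LINT t|V i. (f i t)\<^sup>2) = (v i)\<^sup>2 * (LINT t|V i. (m i w - Y t w)\<^sup>2)"
          by (simp add: f_def power_mult_distrib)
        moreover have "(\<integral>\<^sup>+t. \<integral>\<^sup>+u. ennreal ((Y t w - Y u w)\<^sup>2) \<partial>V i \<partial>V i) =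
            ennreal (2 * (LINT t|V i. (m i w - Y t w)\<^sup>2))"
          unfolding m_def using sq i by (intro prob_space.nn_integral_square_diff[OF pV]) auto
        ultimately show "ennreal (LINT t|V i. (f i t)\<^sup>2) = ennreal ((v i)\<^sup>2 / 2) *
            (\<integral>\<^sup>+t. \<integral>\<^sup>+u. ennreal ((Y t w - Y u w)\<^sup>2) \<partial>V i \<partial>V i)"
          by (simp flip: ennreal_mult)
      qed
      finally show "(\<integral>\<^sup>+x. G (w, x) \<partial>K) =
        (\<Sum>i\<in>I. ennreal ((v i)\<^sup>2 / 2) * (\<integral>\<^sup>+t. \<integral>\<^sup>+u. ennreal ((Y t w - Y u w)\<^sup>2) \<partial>V i \<partial>V i))" .
    qed
  qed
  also have "\<dots> = (\<Sum>i\<in>I. ennreal ((v i)\<^sup>2 / 2) *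
      (\<integral>\<^sup>+w. \<integral>\<^sup>+t. \<integral>\<^sup>+u. ennreal ((Y t w - Y u w)\<^sup>2) \<partial>V i \<partial>V i \<partial>P))"
  proof -
    have [measurable]: "(\<lambda>w. \<integral>\<^sup>+t. \<integral>\<^sup>+u. ennreal ((Y t w - Y u w)\<^sup>2) \<partial>V i \<partial>V i) \<in> borel_measurable P" for i
    proof -
      show ?thesis by measurable
    qed
    show ?thesis by (subst nn_integral_sum) (auto simp: nn_integral_cmult)
  qed
  also have "\<dots> = (\<Sum>i\<in>I. ennreal ((v i)\<^sup>2 / 2) *
      (\<integral>\<^sup>+t. \<integral>\<^sup>+u. \<integral>\<^sup>+w. ennreal ((Y t w - Y u w)\<^sup>2) \<partial>M \<partial>U i \<partial>U i))"
  proof (intro sum.cong refl arg_cong2[where f="(*)"])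
    fix i assume i: "i \<in> I"
    interpret pair_sigma_finite P "V i" ..
    \<comment> \<open>Two exchanges bring the expectation over the field to the innermost place,
      where it yields the mean squared increment. The integrand is measurable for \<open>F\<close>,
      so \<open>P\<close> can then be replaced by M.\<close>
    have "(\<integral>\<^sup>+w. \<integral>\<^sup>+t. \<integral>\<^sup>+u. ennreal ((Y t w - Y u w)\<^sup>2) \<partial>V i \<partial>V i \<partial>P) =
        (\<integral>\<^sup>+t. \<integral>\<^sup>+w. \<integral>\<^sup>+u. ennreal ((Y t w - Y u w)\<^sup>2) \<partial>V i \<partial>P \<partial>V i)"
      by (rule Fubini'[symmetric]) measurable
    also have "\<dots> = (\<integral>\<^sup>+t. \<integral>\<^sup>+u. \<integral>\<^sup>+w. ennreal ((Y t w - Y u w)\<^sup>2) \<partial>P \<partial>V i \<partial>V i)"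
    proof (intro nn_integral_cong Fubini'[symmetric])
      fix t assume "t \<in> space (V i)"
      then have [measurable]: "t \<in> space S" by (simp add: sets_eq_imp_space_eq[OF sV])
      show "(\<lambda>(w, u). ennreal ((Y t w - Y u w)\<^sup>2)) \<in> borel_measurable (P \<Otimes>\<^sub>M V i)"
        by measurable
    qed
    also have "\<dots> = (\<integral>\<^sup>+t. \<integral>\<^sup>+u. \<integral>\<^sup>+w. ennreal ((Y t w - Y u w)\<^sup>2) \<partial>M \<partial>V i \<partial>V i)"
    proof (intro nn_integral_cong)
      fix t u assume "t \<in> space (V i)" "u \<in> space (V i)"
      then have [measurable]: "t \<in> space S" "u \<in> space S" by (simp_all add: sets_eq_imp_space_eq[OF sV])
      show "(\<integral>\<^sup>+w. ennreal ((Y t w - Y u w)\<^sup>2) \<partial>P) = (\<integral>\<^sup>+w. ennreal ((Y t w - Y u w)\<^sup>2) \<partial>M)"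
        unfolding P_def by (subst nn_integral_distr) auto
    qed
    finally show "(\<integral>\<^sup>+w. \<integral>\<^sup>+t. \<integral>\<^sup>+u. ennreal ((Y t w - Y u w)\<^sup>2) \<partial>V i \<partial>V i \<partial>P) =
      (\<integral>\<^sup>+t. \<integral>\<^sup>+u. \<integral>\<^sup>+w. ennreal ((Y t w - Y u w)\<^sup>2) \<partial>M \<partial>U i \<partial>U i)"
      using i by (simp add: V_def)
  qed
  finally show ?thesis .
qed

section \<open>Regular sequences and the grid of strata\<close>

context
  fixes f :: "real \<Rightarrow> real"
  assumes cont: "continuous_on {0..1} f" and pos: "\<forall>v\<in>{0..1}. 0 < f v"
    and tot: "(LINT v:{0..1}|lborel. f v) = 1"
begin

lemma cdf_eq_integral: "t \<in> {0..1} \<Longrightarrow> (LINT v:{0..t}|lborel. f v) = integral {0..t} f"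
  by (intro set_borel_integral_eq_integral borel_integrable_atLeastAtMost'
      continuous_on_subset[OF cont]) auto

lemma cdf_increment_bounds:
  assumes st: "0 \<le> s" "s \<le> t" "t \<le> 1"
    and m: "\<And>v. v \<in> {s..t} \<Longrightarrow> m \<le> f v \<and> f v \<le> m'"
  shows "m * (t - s) \<le> integral {0..t} f - integral {0..s} f"
    and "integral {0..t} f - integral {0..s} f \<le> m' * (t - s)"
proof -
  have int: "f integrable_on {x..y}" if "0 \<le> x" "y \<le> 1" for x y
    using that by (intro integrable_continuous_real continuous_on_subset[OF cont]) auto
  have "integral {0..s} f + integral {s..t} f = integral {0..t} f"
    using st int by (intro Henstock_Kurzweil_Integration.integral_combine) auto
  then have eq: "integral {0..t} f - integral {0..s} f = integral {s..t} f" by simp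
  have "integral {s..t} (\<lambda>_. m) \<le> integral {s..t} f"
    using st m int by (intro integral_le) auto
  then show "m * (t - s) \<le> integral {0..t} f - integral {0..s} f"
    using st by (simp add: eq mult.commute)
  have "integral {s..t} f \<le> integral {s..t} (\<lambda>_. m')"
    using st m int by (intro integral_le) auto
  then show "integral {0..t} f - integral {0..s} f \<le> m' * (t - s)"
    using st by (simp add: eq mult.commute)
qed

lemma density_lower_bound: obtains m where "0 < m" "\<And>v. v \<in> {0..1} \<Longrightarrow> m \<le> f v"
proof -
  obtain x where "x \<in> {0..1}" "\<forall>y\<in>{0..1}. f x \<le> f y"
    using continuous_attains_inf[OF compact_Icc _ cont] by auto
  with pos that[of "f x"] show ?thesis by blast
qed

lemma cdf_strict_mono:
  assumes "0 \<le> s" "s < t" "t \<le> 1"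
  shows "integral {0..s} f < integral {0..t} f"
proof -
  obtain m where m: "0 < m" "\<And>v. v \<in> {0..1} \<Longrightarrow> m \<le> f v" using density_lower_bound by blast
  obtain x where "\<forall>y\<in>{0..1}. f y \<le> f x"
    using continuous_attains_sup[OF compact_Icc _ cont] by auto
  then have "m * (t - s) \<le> integral {0..t} f - integral {0..s} f"
    using assms m by (intro cdf_increment_bounds(1)[where m'="f x"]) auto
  moreover have "0 < m * (t - s)" using m assms by simp
  ultimately show ?thesis by simp
qed

text \<open>The accumulated mass rises continuously from 0 to 1, which gives existence by the
  intermediate value theorem, and strictly, which gives uniqueness. Hence the description operator
  in \<open>grid_point\<close> denotes the intended point.\<close>

lemma grid_point_props:
  assumes q: "0 < q" "i \<le> q"
  shows "grid_point f q i \<in> {0..1}" "integral {0..grid_point f q i} f = real i / real q"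
proof -
  have one: "integral {0..1} f = 1" using tot cdf_eq_integral[of 1] by simp
  have "continuous_on {0..1} (\<lambda>t. integral {0..t} f)"
    by (intro indefinite_integral_continuous_1 integrable_continuous_real cont)
  then have "\<exists>t\<ge>0. t \<le> 1 \<and> integral {0..t} f = real i / real q"
    using q one by (intro IVT') auto
  then obtain t where t: "t \<in> {0..1}" "integral {0..t} f = real i / real q" by auto
  have "\<exists>!t. t \<in> {0..1} \<and> (LINT v:{0..t}|lborel. f v) = real i / real q"
  proof (rule ex1I[of _ t])
    fix s assume "s \<in> {0..1} \<and> (LINT v:{0..s}|lborel. f v) = real i / real q"
    then have s: "s \<in> {0..1}" "integral {0..s} f = real i / real q"
      using cdf_eq_integral by auto
    then show "s = t"
      using t cdf_strict_mono[of s t] cdf_strict_mono[of t s] by (cases s t rule: linorder_cases) auto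
  qed (use t cdf_eq_integral in auto)
  from theI'[OF this] show "grid_point f q i \<in> {0..1}" "integral {0..grid_point f q i} f = real i / real q"
    unfolding grid_point_def using cdf_eq_integral by auto
qed

lemma grid_point_less:
  assumes "i < j" "j \<le> q"
  shows "grid_point f q i < grid_point f q j"
proof (rule ccontr)
  assume "\<not> ?thesis"
  then have "integral {0..grid_point f q j} f \<le> integral {0..grid_point f q i} f"
    using grid_point_props(1)[of q i] grid_point_props(1)[of q j] assms
      cdf_strict_mono[of "grid_point f q j" "grid_point f q i"]
    by (cases "grid_point f q j = grid_point f q i") auto
  then show False using assms by (simp add: grid_point_props divide_simps)
qed

lemma grid_point_0:
  assumes "0 < q" shows "grid_point f q 0 = 0"
  using grid_point_props[of q 0] assms cdf_strict_mono[of 0 "grid_point f q 0"]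
  by (cases "grid_point f q 0 = 0") auto

lemma grid_point_q:
  assumes "0 < q" shows "grid_point f q q = 1"
  using grid_point_props[of q q] assms cdf_strict_mono[of "grid_point f q q" 1]
    tot cdf_eq_integral[of 1]
  by (cases "grid_point f q q = 1") auto

text \<open>Each cell carries mass exactly \<open>1 / real q\<close>, so bounds on the density over
  the cell become bounds on its width.\<close>

lemma grid_cell_width:
  assumes "i < q" and "\<And>v. v \<in> {grid_point f q i..grid_point f q (Suc i)} \<Longrightarrow> m \<le> f v \<and> f v \<le> m'"
  shows "m * (grid_point f q (Suc i) - grid_point f q i) \<le> 1 / real q"
    and "1 / real q \<le> m' * (grid_point f q (Suc i) - grid_point f q i)"
proof -
  have "integral {0..grid_point f q (Suc i)} f - integral {0..grid_point f q i} f = 1 / real q"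
    using assms(1) by (simp add: grid_point_props divide_simps)
  moreover have "0 \<le> grid_point f q i" "grid_point f q i \<le> grid_point f q (Suc i)" "grid_point f q (Suc i) \<le> 1"
    using grid_point_props(1)[of q i] grid_point_props(1)[of q "Suc i"] grid_point_less[of i "Suc i" q] assms(1)
    by auto
  ultimately show "m * (grid_point f q (Suc i) - grid_point f q i) \<le> 1 / real q"
    "1 / real q \<le> m' * (grid_point f q (Suc i) - grid_point f q i)"
    using cdf_increment_bounds assms(2) by metis+
qed

end

section \<open>Almost everywhere partition of the cube into cells\<close>

lemma sum_indicator_cells:
  fixes p :: "nat \<Rightarrow> real"
  assumes "\<And>k. k < q \<Longrightarrow> p k < p (Suc k)" and "x \<notin> p ` {..q}"
  shows "(\<Sum>k<q. indicator {p k..p (Suc k)} x :: real) = indicator {p 0..p q} x"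
  using assms
proof (induction q)
  case (Suc q)
  have "p 0 \<le> p k" if "k \<le> q" for k
    using that
  proof (induction k)
    case (Suc k)
    then show ?case using Suc.prems Suc_le_lessD \<open>\<And>k. k < Suc q \<Longrightarrow> p k < p (Suc k)\<close>[of k] by fastforce
  qed simp
  then have "p 0 \<le> p q" by simp
  moreover have "p q < p (Suc q)" using Suc.prems by simp
  moreover have "(\<Sum>k<q. indicator {p k..p (Suc k)} x :: real) = indicator {p 0..p q} x"
  proof (rule Suc.IH)
    show "x \<notin> p ` {..q}" using Suc.prems(2) by (simp add: atMost_Suc)
  qed (use Suc.prems in simp)
  \<comment> \<open>The last closed cell meets the union of the earlier ones only in the grid point
    \<open>p q\<close>, which x avoids; otherwise that point would be counted twice.\<close>
  ultimately show ?case using Suc.prems(2) by (auto simp: indicator_def)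
qed (auto simp: indicator_def)

text \<open>A null set of one coordinate is the base of a null cylinder, because the uniform law on
  the cube is a product.\<close>

lemma AE_uniform_cube_component:
  assumes "k < m" "AE x in lborel. P (x :: real)"
  shows "AE t in uniform_measure (leb m) (cube m). P (t k)"
proof -
  have "uniform_measure (leb m) (cube m) = PiM {..<m} (\<lambda>_. uniform_measure lborel {0..1})"
    unfolding cube_eq_rect by (rule uniform_rect_eq_PiM) auto
  moreover have "AE x in uniform_measure lborel {0..1}. P (x :: real)"
    using assms(2) by (intro AE_uniform_measureI) (auto elim: AE_mp)
  then have "AE t in PiM {..<m} (\<lambda>_. uniform_measure lborel {0..1}). P (t k)"
    using assms(1) prob_uniform_Icc[of 0 1] by (intro AE_PiM_component[where P=P]) auto
  ultimately show ?thesis by (simp only:)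
qed

text \<open>Closed cells overlap in their faces. Every face lies over a grid point of some
  coordinate, so the overlaps are confined to finitely many null hyperplanes.\<close>

lemma AE_sum_indicator_grid:
  fixes p :: "nat \<Rightarrow> nat \<Rightarrow> real" and q :: "nat \<Rightarrow> nat"
  assumes p: "\<And>m k. m < d \<Longrightarrow> k < q m \<Longrightarrow> p m k < p m (Suc k)"
    and ends: "\<And>m. m < d \<Longrightarrow> p m 0 = 0 \<and> p m (q m) = 1"
  shows "AE t in uniform_measure (leb d) (cube d).
    (\<Sum>i\<in>(\<Pi>\<^sub>E m\<in>{..<d}. {..<q m}). indicator (rect d (\<lambda>m. p m (i m)) (\<lambda>m. p m (Suc (i m)))) t :: real) = 1"
proof -
  have "AE t in uniform_measure (leb d) (cube d). \<forall>m\<in>{..<d}. t m \<notin> p m ` {..q m}"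
  proof (subst AE_finite_all, simp, intro ballI)
    fix m assume "m \<in> {..<d}"
    moreover have "AE x in lborel. x \<notin> p m ` {..q m}"
      by (rule AE_not_in) (auto intro!: finite_imp_null_set_lborel)
    ultimately show "AE t in uniform_measure (leb d) (cube d). t m \<notin> p m ` {..q m}"
      by (intro AE_uniform_cube_component) auto
  qed
  moreover have "AE t in uniform_measure (leb d) (cube d). t \<in> cube d"
    by (rule AE_uniform_measureI) auto
  ultimately show ?thesis
  proof eventually_elim
    fix t assume np: "\<forall>m\<in>{..<d}. t m \<notin> p m ` {..q m}" and t: "t \<in> cube d"
    have ext: "t \<in> extensional {..<d}" using t by (simp add: cube_def PiE_def)
    have "indicator (rect d a b) t = (\<Prod>m<d. indicator {a m..b m} (t m) :: real)" for a b
    proof (cases "t \<in> rect d a b")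
      case True then show ?thesis by (auto simp: indicator_def PiE_def Pi_def)
    next
      case False
      then have "\<exists>m<d. t m \<notin> {a m..b m}" using ext by (auto simp: PiE_def Pi_def)
      then have "(\<Prod>m<d. indicator {a m..b m} (t m) :: real) = 0"
        by (intro prod_zero) (auto simp: indicator_def)
      with False show ?thesis by simp
    qed
    then have "(\<Sum>i\<in>(\<Pi>\<^sub>E m\<in>{..<d}. {..<q m}). indicator (rect d (\<lambda>m. p m (i m)) (\<lambda>m. p m (Suc (i m)))) t :: real) =
      (\<Sum>i\<in>(\<Pi>\<^sub>E m\<in>{..<d}. {..<q m}). \<Prod>m<d. indicator {p m (i m)..p m (Suc (i m))} (t m))"
      by simp
    \<comment> \<open>The sum over all multi-indices factorises into one-dimensional sums, each
      equal to the indicator of the unit interval off the grid points.\<close>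
    also have "\<dots> = (\<Prod>m<d. \<Sum>k<q m. indicator {p m k..p m (Suc k)} (t m))"
      by (rule prod_sum_PiE[symmetric]) auto
    also have "\<dots> = (\<Prod>m<d. indicator {0..1} (t m))"
      using p ends np by (intro prod.cong refl) (subst sum_indicator_cells, auto)
    also have "\<dots> = 1" using t by (intro prod.neutral) (auto simp: cube_def PiE_def Pi_def)
    finally show "(\<Sum>i\<in>(\<Pi>\<^sub>E m\<in>{..<d}. {..<q m}). indicator (rect d (\<lambda>m. p m (i m)) (\<lambda>m. p m (Suc (i m)))) t :: real) = 1" .
  qed
qed

text \<open>The cover identity multiplies f by a sum of indicators that is almost everywhere 1. This
  serves twice: for the paths of the field, and for recombining the averages of the integrand of
  v.\<close>

lemma integral_cube_eq_sum_cells: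
  fixes f :: "(nat \<Rightarrow> real) \<Rightarrow> real"
  assumes fin: "finite I" and ab: "\<And>i m. i \<in> I \<Longrightarrow> m < d \<Longrightarrow> 0 \<le> a i m \<and> a i m < b i m \<and> b i m \<le> 1"
    and cover: "AE t in uniform_measure (leb d) (cube d). (\<Sum>i\<in>I. indicator (rect d (a i) (b i)) t :: real) = 1"
    and f [measurable]: "f \<in> borel_measurable (leb d)"
    and int: "integrable (uniform_measure (leb d) (cube d)) f"
  shows "(LINT t|uniform_measure (leb d) (cube d). f t) =
    (\<Sum>i\<in>I. measure (leb d) (rect d (a i) (b i)) * (LINT t|uniform_measure (leb d) (rect d (a i) (b i)). f t))"
proof -
  define Q where "Q = uniform_measure (leb d) (cube d)"
  have [measurable_cong]: "sets Q = sets (leb d)" by (simp add: Q_def)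
  have "(LINT t|Q. f t) = (LINT t|Q. (\<Sum>i\<in>I. indicator (rect d (a i) (b i)) t * f t))"
  proof (rule integral_cong_AE)
    show "AE t in Q. f t = (\<Sum>i\<in>I. indicator (rect d (a i) (b i)) t * f t)"
      using cover unfolding Q_def by eventually_elim (simp flip: sum_distrib_right)
  qed measurable
  also have "\<dots> = (\<Sum>i\<in>I. LINT t|Q. indicator (rect d (a i) (b i)) t * f t)"
  proof (rule Bochner_Integration.integral_sum)
    fix i
    show "integrable Q (\<lambda>t. indicator (rect d (a i) (b i)) t * f t)"
      using int integrable_real_mult_indicator[of "rect d (a i) (b i)" Q f]
      by (simp add: Q_def mult.commute)
  qed
  also have "\<dots> = (\<Sum>i\<in>I. measure (leb d) (rect d (a i) (b i)) * (LINT t|uniform_measure (leb d) (rect d (a i) (b i)). f t))"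
  proof (intro sum.cong refl)
    fix i assume i: "i \<in> I"
    have sub: "rect d (a i) (b i) \<subseteq> cube d"
      unfolding cube_eq_rect using ab[OF i] by (intro PiE_mono) fastforce
    have "emeasure (leb d) (rect d (a i) (b i)) = ennreal (\<Prod>m<d. b i m - a i m)"
      using ab[OF i] by (intro emeasure_leb_rect) (auto simp: less_imp_le)
    note vol = this
    have pos: "0 < (\<Prod>m<d. b i m - a i m)" using ab[OF i] by (intro prod_pos) auto
    have ne: "emeasure (leb d) (rect d (a i) (b i)) \<noteq> 0" "emeasure (leb d) (rect d (a i) (b i)) \<noteq> \<infinity>"
      using pos by (simp_all only: vol ennreal_eq_0_iff not_le ennreal_neq_top infinity_ennreal_def not_False_eq_True)
    have "(LINT t|Q. indicator (rect d (a i) (b i)) t * f t) =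
        (LINT t:cube d|leb d. indicator (rect d (a i) (b i)) t * f t)"
      using emeasure_leb_cube[of d] unfolding Q_def
      by (subst set_integral_uniform_measure) (auto simp: measure_def)
    also have "\<dots> = (LINT t:rect d (a i) (b i)|leb d. f t)"
      unfolding set_lebesgue_integral_def using sub
      by (intro Bochner_Integration.integral_cong) (auto simp: indicator_def)
    also have "\<dots> = measure (leb d) (rect d (a i) (b i)) * (LINT t|uniform_measure (leb d) (rect d (a i) (b i)). f t)"
      using ne by (intro set_integral_uniform_measure) auto
    finally show "(LINT t|Q. indicator (rect d (a i) (b i)) t * f t) =
      measure (leb d) (rect d (a i) (b i)) * (LINT t|uniform_measure (leb d) (rect d (a i) (b i)). f t)" .
  qed
  finally show ?thesis unfolding Q_def .
qed

section \<open>The constant b\<close>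

text \<open>Only coordinates below m enter, so differences of vectors can be passed as plain
  functions without restricting them to the carrier.\<close>

definition kern :: "real \<Rightarrow> nat \<Rightarrow> (nat \<Rightarrow> real) \<Rightarrow> real" where
  "kern \<beta> m s = (L2_set s {..<m}) powr \<beta>"

lemma kern_nonneg: "0 \<le> kern \<beta> m s"
  by (simp add: kern_def)

lemma measurable_kern [measurable (raw)]:
  assumes "\<And>i. i < m \<Longrightarrow> (\<lambda>x. f x i) \<in> borel_measurable N"
  shows "(\<lambda>x. kern \<beta> m (f x)) \<in> borel_measurable N"
proof -
  have [measurable]: "(\<lambda>x. \<Sum>i<m. (f x i)\<^sup>2) \<in> borel_measurable N"
    using assms by (intro borel_measurable_sum borel_measurable_power) auto
  show ?thesis unfolding kern_def L2_set_def by measurable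
qed

lemma L2_set_abs_mono:
  assumes "\<And>i. i \<in> A \<Longrightarrow> \<bar>f i\<bar> \<le> \<bar>g i\<bar>"
  shows "L2_set f A \<le> L2_set g A"
  unfolding L2_set_def using assms
  by (intro real_sqrt_le_mono sum_mono) (auto simp: abs_le_square_iff)

lemma kern_mono:
  assumes "0 \<le> \<beta>" "\<And>i. i < m \<Longrightarrow> \<bar>s i\<bar> \<le> \<bar>s' i\<bar>"
  shows "kern \<beta> m s \<le> kern \<beta> m s'"
  unfolding kern_def using assms by (intro powr_mono2 L2_set_abs_mono) auto

lemma kern_cmult: "0 < x \<Longrightarrow> kern \<beta> m (\<lambda>i. x * s i) = x powr \<beta> * kern \<beta> m s"
  unfolding kern_def L2_set_right_distrib[OF less_imp_le, symmetric] by (simp add: powr_mult)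

abbreviation unif_cube :: "nat \<Rightarrow> (nat \<Rightarrow> real) measure" where
  "unif_cube m \<equiv> uniform_measure (leb m) (cube m)"

lemma prob_unif_cube: "prob_space (unif_cube m)"
  by (rule prob_space_uniform_measure) (simp_all add: emeasure_leb_cube)

lemma AE_unif_cubeI: "(\<And>t. t \<in> cube m \<Longrightarrow> P t) \<Longrightarrow> AE t in unif_cube m. P t"
  by (rule AE_uniform_measureI) auto

lemma set_integral_cube:
  "f \<in> borel_measurable (leb m) \<Longrightarrow> (LINT t:cube m|leb m. f t) = (LINT t|unif_cube m. f (t :: nat \<Rightarrow> real) :: real)"
  by (subst set_integral_uniform_measure) (auto simp: emeasure_leb_cube measure_def)

text \<open>The cube has volume 1, so the set integrals are expectations under a probability law,
  for which bounded measurable functions are integrable.\<close>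

lemma b_const_eq:
  "b_const \<beta> m u = 1 / 2 * (LINT t|unif_cube m. LINT v|unif_cube m. kern \<beta> m (\<lambda>i. u i * (t i - v i)))"
proof -
  interpret prob_space "unif_cube m" by (rule prob_unif_cube)
  have inner: "(LINT v:cube m|leb m. kern \<beta> m (\<lambda>i. u i * (t i - v i))) =
      (LINT v|unif_cube m. kern \<beta> m (\<lambda>i. u i * (t i - v i)))" for t
    by (rule set_integral_cube) measurable
  show ?thesis
    unfolding b_const_def kern_def[symmetric] inner
    by (subst set_integral_cube) simp_all
qed

lemma measurable_b_const [measurable (raw)]:
  assumes [measurable]: "\<And>i. i < m \<Longrightarrow> (\<lambda>x. g x i) \<in> borel_measurable N"
  shows "(\<lambda>x. b_const \<beta> m (g x)) \<in> borel_measurable N"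
proof -
  interpret prob_space "unif_cube m" by (rule prob_unif_cube)
  show ?thesis unfolding b_const_eq by measurable
qed

lemma kern_cube_le:
  assumes "0 \<le> \<beta>" "t \<in> cube m" "v \<in> cube m"
  shows "kern \<beta> m (\<lambda>i. u i * (t i - v i)) \<le> kern \<beta> m u"
proof (rule kern_mono[OF assms(1)])
  fix i assume "i < m"
  then have "t i \<in> {0..1}" "v i \<in> {0..1}" using assms by (auto simp: cube_def PiE_def Pi_def)
  then have "\<bar>t i - v i\<bar> \<le> 1" by auto
  then show "\<bar>u i * (t i - v i)\<bar> \<le> \<bar>u i\<bar>" by (simp add: abs_mult mult_left_le)
qed

lemma kern_integrable:
  assumes "0 \<le> \<beta>" "t \<in> cube m"
  shows "integrable (unif_cube m) (\<lambda>v. kern \<beta> m (\<lambda>i. u i * (t i - v i)))"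
proof -
  interpret prob_space "unif_cube m" by (rule prob_unif_cube)
  show ?thesis
  proof (rule integrable_const_bound[where B="kern \<beta> m u"])
    show "AE v in unif_cube m. norm (kern \<beta> m (\<lambda>i. u i * (t i - v i))) \<le> kern \<beta> m u"
      using kern_cube_le[OF assms] by (intro AE_unif_cubeI) (simp add: kern_nonneg)
  qed measurable
qed

lemma kern_integral_le:
  assumes "0 \<le> \<beta>" "t \<in> cube m"
  shows "(LINT v|unif_cube m. kern \<beta> m (\<lambda>i. u i * (t i - v i))) \<le> kern \<beta> m u"
proof -
  interpret prob_space "unif_cube m" by (rule prob_unif_cube)
  have "(LINT v|unif_cube m. kern \<beta> m (\<lambda>i. u i * (t i - v i))) \<le> (LINT v|unif_cube m. kern \<beta> m u)"
    using kern_integrable[OF assms] kern_cube_le[OF assms]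
    by (intro integral_mono_AE AE_unif_cubeI) auto
  then show ?thesis by (simp add: prob_space[unfolded space_uniform_measure])
qed

lemma kern_integrable2:
  assumes "0 \<le> \<beta>"
  shows "integrable (unif_cube m) (\<lambda>t. LINT v|unif_cube m. kern \<beta> m (\<lambda>i. u i * (t i - v i)))"
proof -
  interpret prob_space "unif_cube m" by (rule prob_unif_cube)
  show ?thesis
  proof (rule integrable_const_bound[where B="kern \<beta> m u"])
    show "AE t in unif_cube m. norm (LINT v|unif_cube m. kern \<beta> m (\<lambda>i. u i * (t i - v i))) \<le> kern \<beta> m u"
      using kern_integral_le[OF assms] by (intro AE_unif_cubeI) (simp add: kern_nonneg)
  qed measurable
qed

lemma b_const_nonneg: "0 \<le> b_const \<beta> m u"
  unfolding b_const_eq by (simp add: kern_nonneg)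

text \<open>Together with the homogeneity in \<open>b_const_cmult\<close> this takes the place of
  continuity of b: side lengths known up to a factor r determine b up to the factor
  \<open>r powr \<beta>\<close>.\<close>

lemma b_const_mono:
  assumes \<beta>: "0 \<le> \<beta>" and u: "\<And>i. i < m \<Longrightarrow> \<bar>u i\<bar> \<le> \<bar>u' i\<bar>"
  shows "b_const \<beta> m u \<le> b_const \<beta> m u'"
proof -
  have "kern \<beta> m (\<lambda>i. u i * (t i - v i)) \<le> kern \<beta> m (\<lambda>i. u' i * (t i - v i))" for t v
    using u by (intro kern_mono[OF \<beta>]) (auto simp: abs_mult intro!: mult_right_mono)
  then have "AE t in unif_cube m. (LINT v|unif_cube m. kern \<beta> m (\<lambda>i. u i * (t i - v i))) \<le>
      (LINT v|unif_cube m. kern \<beta> m (\<lambda>i. u' i * (t i - v i)))"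
    by (intro AE_unif_cubeI integral_mono kern_integrable \<beta>)
  then have "(LINT t|unif_cube m. LINT v|unif_cube m. kern \<beta> m (\<lambda>i. u i * (t i - v i))) \<le>
      (LINT t|unif_cube m. LINT v|unif_cube m. kern \<beta> m (\<lambda>i. u' i * (t i - v i)))"
    by (intro integral_mono_AE kern_integrable2 \<beta>)
  then show ?thesis by (simp add: b_const_eq)
qed

lemma b_const_cmult: "0 < x \<Longrightarrow> b_const \<beta> m (\<lambda>i. x * u i) = x powr \<beta> * b_const \<beta> m u"
  by (simp add: b_const_eq mult.assoc kern_cmult)

text \<open>If the constant vanished, the kernel would be 0 for almost all pairs of points, whereas
  two independent uniform points almost surely differ already in coordinate 0.\<close>

lemma b_const_pos:
  assumes \<beta>: "0 \<le> \<beta>" and m: "0 < m" and u: "\<And>i. i < m \<Longrightarrow> u i \<noteq> 0"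
  shows "0 < b_const \<beta> m u"
proof (rule ccontr)
  interpret prob_space "unif_cube m" by (rule prob_unif_cube)
  let ?k = "\<lambda>t v. kern \<beta> m (\<lambda>i. u i * (t i - v i))"
  assume "\<not> ?thesis"
  then have "(LINT t|unif_cube m. LINT v|unif_cube m. ?k t v) = 0"
    using b_const_nonneg[of \<beta> m u] by (simp add: b_const_eq)
  then have "AE t in unif_cube m. (LINT v|unif_cube m. ?k t v) = 0"
    using kern_integrable2[OF \<beta>]
    by (subst (asm) integral_nonneg_eq_0_iff_AE) (auto simp: kern_nonneg)
  moreover have "AE t in unif_cube m. t \<in> cube m" by (rule AE_unif_cubeI)
  ultimately have "AE t in unif_cube m. False"
  proof eventually_elim
    fix t assume "(LINT v|unif_cube m. ?k t v) = 0" and t: "t \<in> cube m"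
    then have "AE v in unif_cube m. ?k t v = 0"
      using kern_integrable[OF \<beta> t]
      by (subst (asm) integral_nonneg_eq_0_iff_AE) (auto simp: kern_nonneg)
    moreover have "AE v in unif_cube m. v 0 \<noteq> t 0"
      by (rule AE_uniform_cube_component[OF m AE_lborel_singleton])
    ultimately have "AE v in unif_cube m. False"
    proof eventually_elim
      fix v assume "?k t v = 0" "v 0 \<noteq> t 0"
      then have "L2_set (\<lambda>i. u i * (t i - v i)) {..<m} = 0" by (simp add: kern_def)
      then have "u 0 * (t 0 - v 0) = 0" using m by (auto simp: L2_set_eq_0_iff)
      with u[OF m] \<open>v 0 \<noteq> t 0\<close> show False by simp
    qed
    then show False by simp
  qed
  then show False by simp
qed

text \<open>Rescaling the selected coordinates to the unit cube moves the side lengths into the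
  argument of b. The factor 2 cancels the one half in \<open>b_const\<close>.\<close>

lemma nn_integral_kern_rect:
  assumes \<beta>: "0 \<le> \<beta>" and ab: "\<And>i. i < d \<Longrightarrow> a i < b i"
    and f: "inj_on f {..<m}" "f \<in> {..<m} \<rightarrow> {..<d}"
  defines "U \<equiv> uniform_measure (leb d) (rect d a b)"
  shows "(\<integral>\<^sup>+t. \<integral>\<^sup>+v. ennreal (kern \<beta> m (\<lambda>i. t (f i) - v (f i))) \<partial>U \<partial>U) =
    ennreal (2 * b_const \<beta> m (\<lambda>i. b (f i) - a (f i)))"
proof -
  have [measurable_cong]: "sets U = sets (leb d)" by (simp add: U_def)
  interpret prob_space "unif_cube m" by (rule prob_unif_cube)
  define g where "g x = (\<lambda>i\<in>{..<m}. (x (f i) - a (f i)) / (b (f i) - a (f i)))" for x :: "nat \<Rightarrow> real"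
  have fd: "f i < d" if "i < m" for i using f that by auto
  have g [measurable]: "g \<in> U \<rightarrow>\<^sub>M leb m"
    unfolding g_def[abs_def] leb_def[of m]
  proof (rule measurable_restrict)
    fix i assume "i \<in> {..<m}"
    then have [measurable]: "(\<lambda>x. x (f i)) \<in> borel_measurable U"
      using fd leb_component[of "f i" d] by (simp cong: measurable_cong_sets)
    show "(\<lambda>x. (x (f i) - a (f i)) / (b (f i) - a (f i))) \<in> U \<rightarrow>\<^sub>M lborel" by measurable
  qed
  have law: "distr U (leb m) g = unif_cube m"
    unfolding U_def g_def[abs_def] using ab f by (rule distr_uniform_rect_coords)
  let ?w = "\<lambda>i. b (f i) - a (f i)"
  have eq: "kern \<beta> m (\<lambda>i. t (f i) - v (f i)) = kern \<beta> m (\<lambda>i. ?w i * (g t i - g v i))" for t v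
  proof -
    have "t (f i) - v (f i) = ?w i * (g t i - g v i)" if "i < m" for i
    proof -
      have "?w i \<noteq> 0" using ab[OF fd[OF that]] by simp
      then have *: "?w i * g x i = x (f i) - a (f i)" for x using that by (simp add: g_def)
      have "?w i * (g t i - g v i) = ?w i * g t i - ?w i * g v i" by (rule right_diff_distrib)
      then show ?thesis by (simp only: *)
    qed
    then show ?thesis unfolding kern_def by (intro arg_cong2[where f="(powr)"] L2_set_cong) auto
  qed
  have inner: "(\<integral>\<^sup>+v. ennreal (kern \<beta> m (\<lambda>i. ?w i * (x i - g v i))) \<partial>U) =
      ennreal (LINT v|unif_cube m. kern \<beta> m (\<lambda>i. ?w i * (x i - v i)))" if "x \<in> cube m" for x
  proof -
    have "(\<integral>\<^sup>+v. ennreal (kern \<beta> m (\<lambda>i. ?w i * (x i - g v i))) \<partial>U) =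
        (\<integral>\<^sup>+v. ennreal (kern \<beta> m (\<lambda>i. ?w i * (x i - v i))) \<partial>distr U (leb m) g)"
      by (subst nn_integral_distr) auto
    also have "\<dots> = ennreal (LINT v|unif_cube m. kern \<beta> m (\<lambda>i. ?w i * (x i - v i)))"
      unfolding law using kern_integrable[OF \<beta> that]
      by (intro nn_integral_eq_integral) (auto simp: kern_nonneg)
    finally show ?thesis .
  qed
  have meas: "(\<lambda>x. \<integral>\<^sup>+v. ennreal (kern \<beta> m (\<lambda>i. ?w i * (x i - g v i))) \<partial>U) \<in> borel_measurable (leb m)"
  proof -
    have "prob_space U" unfolding U_def using ab by (rule prob_uniform_rect)
    then interpret U: prob_space U .
    show ?thesis by measurable
  qed
  have "(\<integral>\<^sup>+t. \<integral>\<^sup>+v. ennreal (kern \<beta> m (\<lambda>i. t (f i) - v (f i))) \<partial>U \<partial>U) =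
      (\<integral>\<^sup>+x. \<integral>\<^sup>+v. ennreal (kern \<beta> m (\<lambda>i. ?w i * (x i - g v i))) \<partial>U \<partial>distr U (leb m) g)"
    unfolding eq using meas by (subst nn_integral_distr) auto
  also have "\<dots> = (\<integral>\<^sup>+x. ennreal (LINT v|unif_cube m. kern \<beta> m (\<lambda>i. ?w i * (x i - v i))) \<partial>unif_cube m)"
    unfolding law using inner by (intro nn_integral_cong_AE AE_unif_cubeI) auto
  also have "\<dots> = ennreal (LINT x|unif_cube m. LINT v|unif_cube m. kern \<beta> m (\<lambda>i. ?w i * (x i - v i)))"
    using kern_integrable2[OF \<beta>] by (intro nn_integral_eq_integral) (auto simp: kern_nonneg)
  finally show ?thesis by (simp add: b_const_eq)
qed

section \<open>Random fields on the cube\<close>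

lemma cube_component: "t \<in> cube m \<Longrightarrow> i < m \<Longrightarrow> t i \<in> {0..1}"
  by (auto simp: cube_def PiE_def Pi_def)

lemma compact_cube: "compact (cube m)"
proof -
  \<comment> \<open>Extensionality is encoded by singleton factors beyond m. The cube is then a full
    product of compact sets over all naturals, and Tychonoff applies.\<close>
  have "cube m = PiE UNIV (\<lambda>i. if i < m then {0..1} else {undefined})"
    by (auto simp: cube_def PiE_def Pi_def extensional_def split: if_splits)
  moreover have "compactin (product_topology (\<lambda>_. euclidean) UNIV)
      (PiE UNIV (\<lambda>i :: nat. if i < m then {0..1::real} else {undefined}))"
    unfolding compactin_PiE by auto
  ultimately show ?thesis
    by (simp add: euclidean_product_topology)
qed

lemma cube_nonempty: "(\<lambda>i\<in>{..<m}. 0) \<in> cube m"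
  by (auto simp: cube_def)

text \<open>The distance of two functions is the series of their truncated coordinate distances with
  weights \<open>(1 / 2) ^ n\<close>; the weights sum to 2.\<close>

lemma dist_fun_le:
  fixes t u :: "nat \<Rightarrow> real"
  assumes "0 \<le> \<delta>" "\<And>i. \<bar>t i - u i\<bar> \<le> \<delta>"
  shows "dist t u \<le> 2 * \<delta>"
proof -
  have sg: "summable (\<lambda>n. (1 / 2 :: real) ^ n)" by (simp add: summable_geometric_iff)
  have "dist t u = (\<Sum>n. (1 / 2) ^ n * min (dist (t (from_nat n)) (u (from_nat n))) 1)"
    by (simp add: dist_fun_def)
  also have "\<dots> \<le> (\<Sum>n. (1 / 2) ^ n * \<delta>)"
  proof (rule suminf_le)
    show "summable (\<lambda>n. (1 / 2) ^ n * min (dist (t (from_nat n)) (u (from_nat n))) 1)"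
      by (rule summable_comparison_test'[OF sg]) auto
    show "summable (\<lambda>n. (1 / 2) ^ n * \<delta>)" using sg by (rule summable_mult2)
    show "(1 / 2) ^ n * min (dist (t (from_nat n)) (u (from_nat n))) 1 \<le> (1 / 2) ^ n * \<delta>" for n
      using assms(2)[of "from_nat n"] by (intro mult_left_mono) (auto simp: dist_real_def)
  qed
  also have "\<dots> = 2 * \<delta>"
    using suminf_mult2[OF sg, of \<delta>] suminf_geometric[of "1 / 2 :: real"] by simp
  finally show ?thesis .
qed

text \<open>Coordinates beyond m are equal to \<open>undefined\<close> in both points. One third
  leaves room for strictness, since the coordinate bounds give distance at most two thirds of
  \<delta>.\<close>

lemma dist_cube_less:
  assumes "t \<in> cube m" "u \<in> cube m" "0 < \<delta>" "\<And>i. i < m \<Longrightarrow> \<bar>t i - u i\<bar> < \<delta> / 3"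
  shows "dist t u < \<delta>"
proof -
  have "\<bar>t i - u i\<bar> \<le> \<delta> / 3" for i
    using assms by (cases "i < m") (auto simp: cube_def PiE_def extensional_def less_imp_le)
  then have "dist t u \<le> 2 * (\<delta> / 3)" using assms(3) by (intro dist_fun_le) auto
  then show ?thesis using assms(3) by simp
qed

text \<open>Uniform continuity with the additive tolerance \<open>(r - 1) * f z\<close>, where f z
  is the minimum, is a relative tolerance: the error is at most \<open>(r - 1) * f y\<close> for
  every y.\<close>

lemma positive_continuous_ratio:
  fixes f :: "'a :: metric_space \<Rightarrow> real"
  assumes S: "compact S" and f: "continuous_on S f" and pos: "\<And>x. x \<in> S \<Longrightarrow> 0 < f x" and r: "1 < r"
  obtains \<delta> where "0 < \<delta>" "\<And>x y. x \<in> S \<Longrightarrow> y \<in> S \<Longrightarrow> dist x y < \<delta> \<Longrightarrow> f x \<le> r * f y"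
proof (cases "S = {}")
  case False
  then obtain z where z: "z \<in> S" "\<And>y. y \<in> S \<Longrightarrow> f z \<le> f y"
    using continuous_attains_inf[OF S _ f] by blast
  have "uniformly_continuous_on S f" using f S by (rule compact_uniformly_continuous)
  moreover have "0 < (r - 1) * f z" using r pos[OF z(1)] by simp
  ultimately obtain \<delta> where \<delta>: "0 < \<delta>"
    "\<And>x y. x \<in> S \<Longrightarrow> y \<in> S \<Longrightarrow> dist x y < \<delta> \<Longrightarrow> dist (f x) (f y) < (r - 1) * f z"
    unfolding uniformly_continuous_on_def by (metis dist_commute)
  have "f x \<le> r * f y" if xy: "x \<in> S" "y \<in> S" "dist x y < \<delta>" for x y
  proof -
    have "f x \<le> f y + (r - 1) * f z" using \<delta>(2)[OF xy] by (simp add: dist_real_def)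
    also have "(r - 1) * f z \<le> (r - 1) * f y" using r z(2)[OF xy(2)] by simp
    finally show ?thesis by (simp add: algebra_simps)
  qed
  with \<delta>(1) that show ?thesis by blast
qed (use that[of 1] in auto)

text \<open>Bridge between the product sigma-algebra on m coordinates and the Borel sets of the full
  function space, to which continuity refers. On the carrier every coordinate from m on is the
  constant \<open>undefined\<close>.\<close>

lemma borel_measurable_leb_id: "(\<lambda>t. t) \<in> borel_measurable (leb m)"
proof (rule measurable_coordinatewise_then_product)
  fix i
  show "(\<lambda>t. t i) \<in> borel_measurable (leb m)"
  proof (cases "i < m")
    case False
    then have "(\<lambda>t. t i) \<in> borel_measurable (leb m) \<longleftrightarrow> (\<lambda>t. undefined :: real) \<in> borel_measurable (leb m)"
      by (intro measurable_cong) (auto simp: space_leb extensional_def)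
    then show ?thesis by simp
  qed measurable
qed

lemma continuous_on_cube_measurable:
  fixes f :: "(nat \<Rightarrow> real) \<Rightarrow> real"
  assumes "continuous_on (cube m) f"
  shows "(\<lambda>t. indicator (cube m) t * f t) \<in> borel_measurable (leb m)"
proof -
  have "cube m \<in> sets borel" using compact_cube by (intro borel_closed compact_imp_closed)
  then have "(\<lambda>t. indicator (cube m) t *\<^sub>R f t) \<in> borel_measurable borel"
    using assms by (rule borel_measurable_continuous_on_indicator)
  from measurable_compose[OF borel_measurable_leb_id this] show ?thesis by simp
qed

lemma square_sum_le: "(x + y)\<^sup>2 \<le> 2 * x\<^sup>2 + 2 * (y :: real)\<^sup>2"
  using zero_le_power2[of "x - y"] by (simp add: power2_eq_square algebra_simps)

lemma rv_norm_square: "(rv_norm M f)\<^sup>2 = (LINT w|M. (f w)\<^sup>2)"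
  by (simp add: rv_norm_def)

section \<open>Moments and increments of the field\<close>

definition variogram :: "'w measure \<Rightarrow> ((nat \<Rightarrow> real) \<Rightarrow> 'w \<Rightarrow> real) \<Rightarrow> (nat \<Rightarrow> real) \<Rightarrow> (nat \<Rightarrow> real) \<Rightarrow> real" where
  "variogram M X t u = (LINT w|M. (X t w - X u w)\<^sup>2)"

context
  fixes M F :: "'w measure" and d :: nat and X :: "(nat \<Rightarrow> real) \<Rightarrow> 'w \<Rightarrow> real"
  assumes rf: "random_field M F d X"
begin

lemma field_section_measurable:
  assumes "t \<in> cube d"
  shows "X t \<in> borel_measurable M"
proof -
  have "t \<in> space (restrict_space (leb d) (cube d))"
    using assms sets.sets_into_space[OF cube_in_leb] by (auto simp: space_restrict_space)
  moreover have "(\<lambda>(t, w). X t w) \<in> borel_measurable (restrict_space (leb d) (cube d) \<Otimes>\<^sub>M F)"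
    using rf by (simp add: random_field_def)
  ultimately have "X t \<in> borel_measurable F" by (auto dest: measurable_Pair2)
  then show ?thesis using rf measurable_from_subalg by (auto simp: random_field_def)
qed

lemma field_increment_integrable:
  assumes "t \<in> cube d" "u \<in> cube d"
  shows "integrable M (\<lambda>w. (X t w - X u w)\<^sup>2)"
proof (rule Bochner_Integration.integrable_bound)
  show "integrable M (\<lambda>w. 2 * (X t w)\<^sup>2 + 2 * (X u w)\<^sup>2)"
    using rf assms by (auto simp: random_field_def)
  show "(\<lambda>w. (X t w - X u w)\<^sup>2) \<in> borel_measurable M"
    using field_section_measurable assms by measurable
  show "AE w in M. norm ((X t w - X u w)\<^sup>2) \<le> norm (2 * (X t w)\<^sup>2 + 2 * (X u w)\<^sup>2)"
    using square_sum_le[of "X t _" "- X u _"] by simp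
qed

lemma nn_integral_field_increment:
  assumes "t \<in> cube d" "u \<in> cube d"
  shows "(\<integral>\<^sup>+w. ennreal ((X t w - X u w)\<^sup>2) \<partial>M) = ennreal (variogram M X t u)"
  unfolding variogram_def by (intro nn_integral_eq_integral field_increment_integrable assms) auto

text \<open>Points with unbounded second moments would accumulate somewhere in the compact cube, but
  mean square continuity bounds the moments near the accumulation point.\<close>

lemma field_second_moment_bounded:
  obtains C where "0 \<le> C" "\<And>t. t \<in> cube d \<Longrightarrow> (LINT w|M. (X t w)\<^sup>2) \<le> C"
proof -
  have "\<exists>C. \<forall>t\<in>cube d. (LINT w|M. (X t w)\<^sup>2) \<le> C"
  proof (rule ccontr)
    assume "\<not> ?thesis"
    then have "\<forall>k :: nat. \<exists>t\<in>cube d. real k < (LINT w|M. (X t w)\<^sup>2)" by (meson not_le)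
    then obtain f where f: "\<And>k. f k \<in> cube d" "\<And>k :: nat. real k < (LINT w|M. (X (f k) w)\<^sup>2)" by metis
    obtain t \<sigma> where t: "t \<in> cube d" and \<sigma>: "strict_mono \<sigma>" and lim: "(f \<circ> \<sigma>) \<longlonglongrightarrow> t"
      using compact_cube[of d, unfolded compact_def] f(1) by metis
    have "((\<lambda>u. rv_norm M (\<lambda>w. X u w - X t w)) \<longlongrightarrow> 0) (at t within cube d)"
      using rf t by (auto simp: random_field_def)
    then have "\<forall>\<^sub>F u in at t within cube d. rv_norm M (\<lambda>w. X u w - X t w) < 1"
      by (rule order_tendstoD) simp
    then obtain e where e: "0 < e" "\<And>u. u \<in> cube d \<Longrightarrow> u \<noteq> t \<Longrightarrow> dist u t < e \<Longrightarrow>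
        rv_norm M (\<lambda>w. X u w - X t w) < 1"
      unfolding eventually_at by blast
    \<comment> \<open>Within distance e the increment has second moment at most 1; writing X u as X
      t plus the increment and using \<open>square_sum_le\<close> gives the constants 2 and
      2.\<close>
    have near: "(LINT w|M. (X u w)\<^sup>2) \<le> 2 * (LINT w|M. (X t w)\<^sup>2) + 2"
      if u: "u \<in> cube d" "dist u t < e" for u
    proof -
      have "(rv_norm M (\<lambda>w. X u w - X t w))\<^sup>2 \<le> 1"
      proof (cases "u = t")
        case False
        then have "rv_norm M (\<lambda>w. X u w - X t w) < 1" using e(2) u by auto
        moreover have "0 \<le> rv_norm M (\<lambda>w. X u w - X t w)" by (simp add: rv_norm_def)
        ultimately show ?thesis by (simp add: power_le_one)
      qed (simp add: rv_norm_def)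
      then have one: "(LINT w|M. (X u w - X t w)\<^sup>2) \<le> 1" by (simp add: rv_norm_square)
      have int: "integrable M (\<lambda>w. (X t w)\<^sup>2)" "integrable M (\<lambda>w. (X u w)\<^sup>2)"
        "integrable M (\<lambda>w. (X u w - X t w)\<^sup>2)"
        using rf t u field_increment_integrable by (auto simp: random_field_def)
      have "(LINT w|M. (X u w)\<^sup>2) \<le> (LINT w|M. 2 * (X t w)\<^sup>2 + 2 * (X u w - X t w)\<^sup>2)"
      proof (rule integral_mono)
        fix w
        show "(X u w)\<^sup>2 \<le> 2 * (X t w)\<^sup>2 + 2 * (X u w - X t w)\<^sup>2"
          using square_sum_le[of "X t w" "X u w - X t w"] by simp
      qed (use int in auto)
      also have "\<dots> = 2 * (LINT w|M. (X t w)\<^sup>2) + 2 * (LINT w|M. (X u w - X t w)\<^sup>2)"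
        using int by simp
      finally show ?thesis using one by simp
    qed
    obtain k0 where k0: "\<And>k. k \<ge> k0 \<Longrightarrow> dist (f (\<sigma> k)) t < e"
      using lim e(1) unfolding lim_sequentially by (auto simp: o_def)
    obtain k1 :: nat where k1: "2 * (LINT w|M. (X t w)\<^sup>2) + 2 < real k1" using reals_Archimedean2 by blast
    \<comment> \<open>Beyond \<open>k0\<close> the subsequence is close to t; beyond
      \<open>k1\<close> its second moments exceed the bound valid near t, because
      \<open>\<sigma> k\<close> is at least k.\<close>
    let ?k = "max k0 k1"
    have "real k1 \<le> real (\<sigma> ?k)" using seq_suble[OF \<sigma>, of ?k] by simp
    also have "\<dots> < (LINT w|M. (X (f (\<sigma> ?k)) w)\<^sup>2)" by (rule f(2))
    also have "\<dots> \<le> 2 * (LINT w|M. (X t w)\<^sup>2) + 2" using f(1) k0 by (intro near) auto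
    finally show False using k1 by simp
  qed
  then obtain C where "\<And>t. t \<in> cube d \<Longrightarrow> (LINT w|M. (X t w)\<^sup>2) \<le> C" by blast
  then have "\<And>t. t \<in> cube d \<Longrightarrow> (LINT w|M. (X t w)\<^sup>2) \<le> max 0 C" by (meson max.coboundedI2)
  then show ?thesis using that[of "max 0 C"] by simp
qed

lemma field_extension_measurable:
  "(\<lambda>(t, w). indicator (cube d) t * X t w) \<in> borel_measurable (leb d \<Otimes>\<^sub>M F)"
proof -
  \<comment> \<open>A measurable retraction onto the cube. Composing with it extends joint
    measurability from the restricted space to all of \<open>leb d\<close>; the indicator then
    discards the artificial values.\<close>
  define \<rho> where "\<rho> t = (if t \<in> cube d then t else (\<lambda>i\<in>{..<d}. 0))" for t :: "nat \<Rightarrow> real"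
  have \<rho>: "\<rho> t \<in> cube d" for t using cube_nonempty by (auto simp: \<rho>_def)
  have 0: "(\<lambda>i\<in>{..<d}. 0) \<in> space (leb d)" by (simp add: space_leb)
  have "\<rho> \<in> leb d \<rightarrow>\<^sub>M leb d" unfolding \<rho>_def[abs_def]
    using 0 by (intro measurable_If_set measurable_const) auto
  then have [measurable]: "\<rho> \<in> leb d \<rightarrow>\<^sub>M restrict_space (leb d) (cube d)"
    using \<rho> by (intro measurable_restrict_space2) auto
  have [measurable]: "(\<lambda>(t, w). X t w) \<in> borel_measurable (restrict_space (leb d) (cube d) \<Otimes>\<^sub>M F)"
    using rf by (simp add: random_field_def)
  have "(\<lambda>p. (\<rho> (fst p), snd p)) \<in> leb d \<Otimes>\<^sub>M F \<rightarrow>\<^sub>M restrict_space (leb d) (cube d) \<Otimes>\<^sub>M F"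
    by measurable
  from measurable_compose[OF this, of "\<lambda>(t, w). X t w" borel]
  have [measurable]: "(\<lambda>p. X (\<rho> (fst p)) (snd p)) \<in> borel_measurable (leb d \<Otimes>\<^sub>M F)" by simp
  have "(\<lambda>p. indicator (cube d) (fst p) * X (\<rho> (fst p)) (snd p)) \<in> borel_measurable (leb d \<Otimes>\<^sub>M F)"
    by measurable
  also have "(\<lambda>p. indicator (cube d) (fst p) * X (\<rho> (fst p)) (snd p)) =
      (\<lambda>(t, w). indicator (cube d) t * X t w)"
    by (auto simp: fun_eq_iff \<rho>_def indicator_def)
  finally show ?thesis .
qed

text \<open>Two inequalities without a quotient, valid also for t = u, where the ratio in the
  definition of local stationarity has a vanishing denominator.\<close>

lemma locally_stationary_ratio:
  assumes ls: "locally_stationary M d l \<alpha> c X" and r: "1 < r"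
  obtains \<delta> where "0 < \<delta>" "\<And>t u. t \<in> cube d \<Longrightarrow> u \<in> cube d \<Longrightarrow> (\<And>i. i < d \<Longrightarrow> \<bar>t i - u i\<bar> < \<delta>) \<Longrightarrow>
    variogram M X t u \<le> r * (\<Sum>j<length l. c j t * kern (\<alpha> j) (l ! j) (\<lambda>i. t (L l j + i) - u (L l j + i))) \<and>
    (\<Sum>j<length l. c j t * kern (\<alpha> j) (l ! j) (\<lambda>i. t (L l j + i) - u (L l j + i))) \<le> r * variogram M X t u"
proof -
  \<comment> \<open>Chosen so that \<open>1 - \<epsilon>\<close> is exactly \<open>1 / r\<close>;
    the upper estimate \<open>1 + \<epsilon> \<le> r\<close> then amounts to
    \<open>(r - 1)\<^sup>2 / r\<close> being nonnegative.\<close>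
  define \<epsilon> where "\<epsilon> = 1 - 1 / r"
  have "0 < \<epsilon>" "1 - \<epsilon> = 1 / r" using r by (simp_all add: \<epsilon>_def)
  moreover have "1 + \<epsilon> \<le> r"
  proof -
    have "0 \<le> (r - 1)\<^sup>2 / r" using r by simp
    also have "(r - 1)\<^sup>2 / r = r - (1 + \<epsilon>)"
      using r by (simp add: \<epsilon>_def power2_eq_square field_simps)
    finally show ?thesis by simp
  qed
  ultimately have \<epsilon>: "0 < \<epsilon>" "1 + \<epsilon> \<le> r" "1 - \<epsilon> = 1 / r" by blast+
  obtain \<delta> where \<delta>: "0 < \<delta>" "\<forall>t\<in>cube d. \<forall>s. vplus d t s \<in> cube d \<and>
        0 < L2_set s {..<d} \<and> L2_set s {..<d} < \<delta> \<longrightarrow>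
        \<bar>(rv_norm M (\<lambda>w. X (vplus d t s) w - X t w))\<^sup>2 /
          (\<Sum>j<length l. c j t * (L2_set (component l j s) {..<l ! j}) powr \<alpha> j) - 1\<bar> < \<epsilon>"
    using ls[unfolded locally_stationary_def, THEN conjunct2, THEN spec, THEN mp, OF \<epsilon>(1)]
    by (elim exE conjE)
  have cpos: "0 < c j t" if "j < length l" "t \<in> cube d" for j t
    using ls that by (auto simp: locally_stationary_def)
  show ?thesis
  \<comment> \<open>The Euclidean norm is at most the sum of d coordinate distances, and dividing by
    d + 1 keeps that sum strictly below \<delta>, with no division by zero for d = 0.\<close>
  proof (rule that[of "\<delta> / (real d + 1)"])
    show "0 < \<delta> / (real d + 1)" using \<delta>(1) by simp
    fix t u assume t: "t \<in> cube d" and u: "u \<in> cube d" and near: "\<And>i. i < d \<Longrightarrow> \<bar>t i - u i\<bar> < \<delta> / (real d + 1)"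
    define s where "s i = u i - t i" for i
    let ?S = "\<Sum>j<length l. c j t * kern (\<alpha> j) (l ! j) (\<lambda>i. t (L l j + i) - u (L l j + i))"
    have vp: "vplus d t s = u"
      using t u by (auto simp: vplus_def s_def cube_def PiE_def extensional_def fun_eq_iff)
    have S: "(\<Sum>j<length l. c j t * (L2_set (component l j s) {..<l ! j}) powr \<alpha> j) = ?S"
      unfolding kern_def by (intro sum.cong refl arg_cong2[where f="(*)"] arg_cong2[where f="(powr)"])
        (auto simp: component_def s_def L2_set_def power2_commute)
    have v: "(rv_norm M (\<lambda>w. X (vplus d t s) w - X t w))\<^sup>2 = variogram M X t u"
      unfolding rv_norm_square vp variogram_def by (simp add: power2_commute)
    have S0: "0 \<le> ?S" using cpos t by (intro sum_nonneg mult_nonneg_nonneg kern_nonneg) (auto simp: less_imp_le)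
    show "variogram M X t u \<le> r * ?S \<and> ?S \<le> r * variogram M X t u"
    proof (cases "L2_set s {..<d} = 0")
      case True
      then have ut: "u i = t i" if "i < d" for i using that by (simp add: L2_set_eq_0_iff s_def)
      have "u = t" using u t ut unfolding cube_def by (rule PiE_ext) simp
      then have "variogram M X t u = 0" by (simp add: variogram_def)
      moreover have "?S = 0"
      proof (intro sum.neutral ballI)
        fix j assume "j \<in> {..<length l}"
        then show "c j t * kern (\<alpha> j) (l ! j) (\<lambda>i. t (L l j + i) - u (L l j + i)) = 0"
          using \<open>u = t\<close> by (simp add: kern_def L2_set_def)
      qed
      ultimately show ?thesis by simp
    next
      case False
      then have pos: "0 < L2_set s {..<d}" using L2_set_nonneg[of s "{..<d}"] by linarith
      have "L2_set s {..<d} \<le> (\<Sum>i<d. \<bar>s i\<bar>)" by (rule L2_set_le_sum_abs)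
      also have "\<dots> \<le> (\<Sum>i<d. \<delta> / (real d + 1))"
        using near by (intro sum_mono) (auto simp: s_def abs_minus_commute less_imp_le)
      also have "\<dots> < \<delta>" using \<delta>(1) by (simp add: field_simps)
      finally have "\<bar>variogram M X t u / ?S - 1\<bar> < \<epsilon>"
        using \<delta>(2)[THEN bspec, OF t, THEN spec, of s] u pos unfolding S v by (simp add: vp)
      then have b: "variogram M X t u / ?S < 1 + \<epsilon>" "1 / r < variogram M X t u / ?S" using \<epsilon>(3) by linarith+
      \<comment> \<open>Division by zero yields 0, so a vanishing sum would make the quotient 0,
        against its lower bound \<open>1 / r\<close>.\<close>
      have "?S \<noteq> 0"
      proof
        assume "?S = 0"
        then have "variogram M X t u / ?S = 0" by simp
        with b(2) r show False by (simp add: not_less)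
      qed
      with S0 have "0 < ?S" by linarith
      with b have "variogram M X t u < (1 + \<epsilon>) * ?S" "?S < r * variogram M X t u"
        using r by (simp_all only: pos_divide_less_eq) (simp add: field_simps)
      moreover have "(1 + \<epsilon>) * ?S \<le> r * ?S" using \<epsilon>(2) S0 by (rule mult_right_mono)
      ultimately show ?thesis by linarith
    qed
  qed
qed

end

section \<open>Error within one stratum\<close>

lemma L_Suc: "j < length l \<Longrightarrow> L l (Suc j) = L l j + l ! j"
  by (simp add: L_def take_Suc_conv_app_nth)

lemma L_mono: "i \<le> j \<Longrightarrow> L l i \<le> L l j"
  unfolding L_def by (metis le_add1 le_iff_add sum_list_append take_add)

lemma block_index_less:
  assumes "j < length l" "i < l ! j"
  shows "L l j + i < sum_list l"
proof -
  have "L l j + i < L l (Suc j)" using assms by (simp add: L_Suc)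
  also have "\<dots> \<le> L l (length l)" using assms by (intro L_mono) simp
  finally show ?thesis by (simp add: L_def)
qed

lemma comp_of_block:
  assumes "j < length l" "i < l ! j"
  shows "comp_of l (L l j + i) = j"
  unfolding comp_of_def
proof (rule Least_equality)
  show "L l j + i < L l (Suc j)" using assms by (simp add: L_Suc)
  fix k assume k: "L l j + i < L l (Suc k)"
  show "j \<le> k"
  proof (rule ccontr)
    assume "\<not> j \<le> k"
    then have "L l (Suc k) \<le> L l j" by (intro L_mono) simp
    with k show False by simp
  qed
qed

lemma comp_of_less:
  assumes "m < sum_list l"
  shows "comp_of l m < length l"
proof -
  have l: "0 < length l" using assms by (cases l) auto
  then have "m < L l (Suc (length l - 1))" using assms by (simp add: L_def)
  then have "comp_of l m \<le> length l - 1" unfolding comp_of_def by (rule Least_le)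
  with l show ?thesis by linarith
qed

lemma prod_lessThan_add: "(\<Prod>m<a + (b :: nat). f m) = (\<Prod>m<a. f m) * (\<Prod>i<b. f (a + i) :: 'a :: comm_monoid_mult)"
  by (induction b) (auto simp: mult.assoc)

text \<open>Collects equal factors block by block; it identifies the product of the starred grid
  numbers over all coordinates with N.\<close>

lemma prod_comp_of:
  "(\<Prod>m<sum_list l. f (comp_of l m)) = (\<Prod>j<length l. f j ^ (l ! j) :: 'a :: comm_monoid_mult)"
proof -
  have "(\<Prod>m<L l k. f (comp_of l m)) = (\<Prod>j<k. f j ^ (l ! j))" if "k \<le> length l" for k
    using that
  proof (induction k)
    case (Suc k)
    have "(\<Prod>i<l ! k. f (comp_of l (L l k + i))) = f k ^ (l ! k)"
      using Suc.prems by (simp add: comp_of_block)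
    with Suc show ?case by (simp add: L_Suc prod_lessThan_add)
  qed (simp add: L_def)
  from this[of "length l"] show ?thesis by (simp add: L_def)
qed

section \<open>The integrand of the limit constants\<close>

definition v_density ::
  "nat \<Rightarrow> nat list \<Rightarrow> (nat \<Rightarrow> real) \<Rightarrow> (nat \<Rightarrow> (nat \<Rightarrow> real) \<Rightarrow> real) \<Rightarrow>
    (nat \<Rightarrow> real \<Rightarrow> real) \<Rightarrow> nat \<Rightarrow> (nat \<Rightarrow> real) \<Rightarrow> real" where
  "v_density d l \<alpha> c h j t = c j t * b_const (\<alpha> j) (l ! j) (D_vec l h j t) *
        (\<Prod>m<d. inverse (h (comp_of l m) (t m)))"

lemma continuous_uniform_lower_bound:
  fixes h :: "nat \<Rightarrow> real \<Rightarrow> real"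
  assumes "\<And>j. j < k \<Longrightarrow> continuous_on {0..1} (h j)" "\<And>j v. j < k \<Longrightarrow> v \<in> {0..1} \<Longrightarrow> 0 < h j v"
  obtains x where "0 < x" "\<And>j v. j < k \<Longrightarrow> v \<in> {0..1} \<Longrightarrow> x \<le> h j v"
proof -
  have "\<exists>x>0. \<forall>j<k. \<forall>v\<in>{0..1}. x \<le> h j v"
    using assms
  proof (induction k)
    case 0 then show ?case by (intro exI[of _ 1]) auto
  next
    case (Suc k)
    then obtain x where x: "0 < x" "\<forall>j<k. \<forall>v\<in>{0..1}. x \<le> h j v" by (metis less_SucI)
    have "continuous_on {0..1} (h k)" using Suc.prems by simp
    then obtain z where z: "z \<in> {0..1}" "\<forall>v\<in>{0..1}. h k z \<le> h k v"
      using continuous_attains_inf[OF compact_Icc, of 0 1 "h k"] by auto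
    have "0 < h k z" using Suc.prems z(1) by simp
    with x z show ?case by (intro exI[of _ "min x (h k z)"]) (auto simp: less_Suc_eq min_le_iff_disj)
  qed
  then show ?thesis using that by blast
qed

context
  fixes d :: nat and l :: "nat list" and \<alpha> :: "nat \<Rightarrow> real"
    and c :: "nat \<Rightarrow> (nat \<Rightarrow> real) \<Rightarrow> real" and h :: "nat \<Rightarrow> real \<Rightarrow> real" and j :: nat
  assumes d: "sum_list l = d" and j: "j < length l" and lj: "0 < l ! j" and \<alpha>: "0 < \<alpha> j"
    and c: "continuous_on (cube d) (c j)" "\<And>t. t \<in> cube d \<Longrightarrow> 0 < c j t"
    and h: "\<And>i. i < length l \<Longrightarrow> continuous_on {0..1} (h i)" "\<And>i v. i < length l \<Longrightarrow> v \<in> {0..1} \<Longrightarrow> 0 < h i v"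
begin

lemma v_density_measurable: "(\<lambda>t. indicator (cube d) t * v_density d l \<alpha> c h j t) \<in> borel_measurable (leb d)"
proof -
  \<comment> \<open>Continuity constrains h only on the unit interval. Cutting it off outside gives
    a Borel function that agrees with h at all coordinates of points of the cube.\<close>
  define h' where "h' i v = indicator {0..1} v *\<^sub>R h i v" for i and v :: real
  have [measurable]: "h' i \<in> borel_measurable borel" if "i < length l" for i
    unfolding h'_def[abs_def] using h(1)[OF that] by (intro borel_measurable_continuous_on_indicator) auto
  have h': "h' i v = h i v" if "v \<in> {0..1}" for i v using that by (simp add: h'_def)
  have [measurable]: "(\<lambda>t. indicator (cube d) t * c j t) \<in> borel_measurable (leb d)"
    using c(1) by (rule continuous_on_cube_measurable)
  have mh [measurable]: "(\<lambda>t. h' i (t m)) \<in> borel_measurable (leb d)" if "m < d" "i < length l" for i m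
    using that by measurable
  have "(\<lambda>t. b_const (\<alpha> j) (l ! j) (\<lambda>i. 1 / h' j (t (L l j + i)))) \<in> borel_measurable (leb d)"
    using block_index_less[OF j] d j by (intro measurable_b_const borel_measurable_divide mh) auto
  moreover have "(\<lambda>t. \<Prod>m<d. inverse (h' (comp_of l m) (t m))) \<in> borel_measurable (leb d)"
    using comp_of_less[of _ l] d by (intro borel_measurable_prod borel_measurable_inverse mh) auto
  ultimately have "(\<lambda>t. (indicator (cube d) t * c j t) * b_const (\<alpha> j) (l ! j) (\<lambda>i. 1 / h' j (t (L l j + i))) *
      (\<Prod>m<d. inverse (h' (comp_of l m) (t m)))) \<in> borel_measurable (leb d)"
    by measurable
  also have "(\<lambda>t. (indicator (cube d) t * c j t) * b_const (\<alpha> j) (l ! j) (\<lambda>i. 1 / h' j (t (L l j + i))) *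
      (\<Prod>m<d. inverse (h' (comp_of l m) (t m)))) = (\<lambda>t. indicator (cube d) t * v_density d l \<alpha> c h j t)"
  proof
    fix t
    show "(indicator (cube d) t * c j t) * b_const (\<alpha> j) (l ! j) (\<lambda>i. 1 / h' j (t (L l j + i))) *
      (\<Prod>m<d. inverse (h' (comp_of l m) (t m))) = indicator (cube d) t * v_density d l \<alpha> c h j t"
    proof (cases "t \<in> cube d")
      case True
      \<comment> \<open>The two argument vectors agree only below \<open>l ! j\<close> and need not
        be equal as functions; monotonicity in both directions compares precisely those
        coordinates.\<close>
      have "b_const (\<alpha> j) (l ! j) (\<lambda>i. 1 / h' j (t (L l j + i))) = b_const (\<alpha> j) (l ! j) (D_vec l h j t)"
        using cube_component[OF True] block_index_less[OF j] d \<alpha>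
        by (intro antisym b_const_mono) (auto simp: D_vec_def component_def h')
      moreover have "(\<Prod>m<d. inverse (h' (comp_of l m) (t m))) = (\<Prod>m<d. inverse (h (comp_of l m) (t m)))"
        using cube_component[OF True] by (intro prod.cong) (auto simp: h')
      ultimately show ?thesis by (simp add: v_density_def)
    qed simp
  qed
  finally show ?thesis .
qed

lemma v_density_pos:
  assumes "t \<in> cube d"
  shows "0 < v_density d l \<alpha> c h j t"
  unfolding v_density_def
proof (intro mult_pos_pos prod_pos ballI)
  show "0 < c j t" using c assms by simp
  show "0 < b_const (\<alpha> j) (l ! j) (D_vec l h j t)"
  proof (rule b_const_pos)
    fix i assume i: "i < l ! j"
    then have "0 < h j (t (L l j + i))"
      using cube_component[OF assms] block_index_less[OF j i] d j by (intro h) auto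
    then show "D_vec l h j t i \<noteq> 0" using i by (simp add: D_vec_def component_def)
  qed (use \<alpha> lj in auto)
  fix m assume "m \<in> {..<d}"
  then have "0 < h (comp_of l m) (t m)"
    using cube_component[OF assms, of m] comp_of_less[of m l] d by (intro h) auto
  then show "0 < inverse (h (comp_of l m) (t m))" by simp
qed

text \<open>A common positive lower bound x of the densities bounds the entries of
  \<open>D_vec\<close> and the product of inverses, and \<open>c j\<close> attains its maximum.
  Boundedness makes the integrand integrable under every probability law, in particular on each
  stratum.\<close>

lemma v_density_bounded:
  obtains B where "\<And>t. norm (indicator (cube d) t * v_density d l \<alpha> c h j t) \<le> B"
proof -
  obtain x where x: "0 < x" "\<And>i v. i < length l \<Longrightarrow> v \<in> {0..1} \<Longrightarrow> x \<le> h i v"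
    using continuous_uniform_lower_bound[of "length l" h] h by blast
  have "cube d \<noteq> {}" using cube_nonempty by blast
  then obtain z where z: "z \<in> cube d" "\<And>t. t \<in> cube d \<Longrightarrow> c j t \<le> c j z"
    using continuous_attains_sup[OF compact_cube _ c(1)] by blast
  let ?B = "c j z * b_const (\<alpha> j) (l ! j) (\<lambda>_. 1 / x) * (\<Prod>m<d. inverse x)"
  have "norm (indicator (cube d) t * v_density d l \<alpha> c h j t) \<le> ?B" for t
  proof (cases "t \<in> cube d")
    case t: True
    have "v_density d l \<alpha> c h j t \<le> ?B"
      unfolding v_density_def
    proof (intro mult_mono prod_mono conjI)
      show "b_const (\<alpha> j) (l ! j) (D_vec l h j t) \<le> b_const (\<alpha> j) (l ! j) (\<lambda>_. 1 / x)"
      proof (rule b_const_mono)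
        fix i assume i: "i < l ! j"
        then have "x \<le> h j (t (L l j + i))"
          using cube_component[OF t] block_index_less[OF j i] d j by (intro x) auto
        then show "\<bar>D_vec l h j t i\<bar> \<le> \<bar>1 / x\<bar>"
          using i x(1) by (auto simp: D_vec_def component_def frac_le)
      qed (use \<alpha> in auto)
      fix m assume "m \<in> {..<d}"
      then have "x \<le> h (comp_of l m) (t m)"
        using cube_component[OF t, of m] comp_of_less[of m l] d by (intro x) auto
      then show "0 \<le> inverse (h (comp_of l m) (t m))" "inverse (h (comp_of l m) (t m)) \<le> inverse x"
        using x(1) by (auto intro: le_imp_inverse_le)
    next
      show "0 \<le> (\<Prod>m<d. inverse (h (comp_of l m) (t m)))"
      proof (intro prod_nonneg)
        fix m assume "m \<in> {..<d}"
        then have "x \<le> h (comp_of l m) (t m)"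
          using cube_component[OF t, of m] comp_of_less[of m l] d by (intro x) auto
        then show "0 \<le> inverse (h (comp_of l m) (t m))" using x(1) by auto
      qed
    qed (use z t c in \<open>auto simp: b_const_nonneg less_imp_le\<close>)
    then show ?thesis using t v_density_pos[OF t] by simp
  next
    case False
    have "0 \<le> c j z" using c z(1) by (simp add: less_imp_le)
    then have "0 \<le> ?B"
      using x(1) by (intro mult_nonneg_nonneg prod_nonneg b_const_nonneg) auto
    with False show ?thesis by simp
  qed
  then show ?thesis by (rule that)
qed

lemma v_density_integrable:
  assumes "prob_space Q" and Q: "sets Q = sets (leb d)"
  shows "integrable Q (\<lambda>t. indicator (cube d) t * v_density d l \<alpha> c h j t)"
proof -
  interpret prob_space Q by fact
  obtain B where "\<And>t. norm (indicator (cube d) t * v_density d l \<alpha> c h j t) \<le> B"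
    using v_density_bounded by blast
  moreover have "(\<lambda>t. indicator (cube d) t * v_density d l \<alpha> c h j t) \<in> borel_measurable Q"
    by (subst measurable_cong_sets[OF Q refl]) (rule v_density_measurable)
  ultimately show ?thesis by (intro integrable_const_bound[of _ B]) auto
qed

text \<open>The indicator makes the integrand measurable on the whole carrier; outside the cube
  \<open>v_density\<close> is not controlled.\<close>

lemma v_const_eq:
  "v_const d l \<alpha> c h j = (LINT t|unif_cube d. indicator (cube d) t * v_density d l \<alpha> c h j t)"
proof -
  have "v_const d l \<alpha> c h j = (LINT t:cube d|leb d. indicator (cube d) t * v_density d l \<alpha> c h j t)"
    unfolding v_const_def v_density_def set_lebesgue_integral_def
    by (intro Bochner_Integration.integral_cong) (auto simp: indicator_def)
  also have "\<dots> = (LINT t|unif_cube d. indicator (cube d) t * v_density d l \<alpha> c h j t)"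
    by (rule set_integral_cube[OF v_density_measurable])
  finally show ?thesis .
qed

text \<open>A nonnegative function with vanishing integral is almost everywhere 0, while this
  integrand is strictly positive throughout the cube.\<close>

lemma v_const_pos: "0 < v_const d l \<alpha> c h j"
proof (rule ccontr)
  assume neg: "\<not> ?thesis"
  have nn: "0 \<le> indicator (cube d) t * v_density d l \<alpha> c h j t" for t
    using v_density_pos[of t] by (auto simp: indicator_def)
  have "0 \<le> (LINT t|unif_cube d. indicator (cube d) t * v_density d l \<alpha> c h j t)"
    by (intro Bochner_Integration.integral_nonneg nn)
  with neg have "(LINT t|unif_cube d. indicator (cube d) t * v_density d l \<alpha> c h j t) = 0"
    unfolding v_const_eq by linarith
  then have "AE t in unif_cube d. indicator (cube d) t * v_density d l \<alpha> c h j t = 0"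
    using v_density_integrable[OF prob_unif_cube] nn by (subst (asm) integral_nonneg_eq_0_iff_AE) auto
  moreover have "AE t in unif_cube d. indicator (cube d) t * v_density d l \<alpha> c h j t > 0"
    using v_density_pos by (intro AE_unif_cubeI) simp
  ultimately have "AE t in unif_cube d. False" by eventually_elim linarith
  then show False using prob_space.AE_False[OF prob_unif_cube] by blast
qed

end

section \<open>Comparison on a single stratum\<close>

lemma uniform_rect_AE_I: "(\<And>t. t \<in> rect d a b \<Longrightarrow> P t) \<Longrightarrow> AE t in uniform_measure (leb d) (rect d a b). P t"
  by (rule AE_uniform_measureI) auto

lemma nn_integral_sum_kern_rect:
  fixes A :: "nat \<Rightarrow> real"
  assumes d: "sum_list l = d" and \<alpha>: "\<And>j. j < length l \<Longrightarrow> 0 \<le> \<alpha> j"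
    and ab: "\<And>i. i < d \<Longrightarrow> a i < b i" and A: "\<And>j. j < length l \<Longrightarrow> 0 \<le> A j"
  defines "U \<equiv> uniform_measure (leb d) (rect d a b)"
  shows "(\<integral>\<^sup>+t. \<integral>\<^sup>+u. ennreal (\<Sum>j<length l. A j * kern (\<alpha> j) (l ! j) (\<lambda>i. t (L l j + i) - u (L l j + i))) \<partial>U \<partial>U) =
    ennreal (2 * (\<Sum>j<length l. A j * b_const (\<alpha> j) (l ! j) (\<lambda>i. b (L l j + i) - a (L l j + i))))"
proof -
  have sU [measurable_cong]: "sets U = sets (leb d)" by (simp add: U_def)
  interpret U: prob_space U unfolding U_def using ab by (rule prob_uniform_rect)
  let ?k = "\<lambda>j t u. kern (\<alpha> j) (l ! j) (\<lambda>i. t (L l j + i) - u (L l j + i))"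
  let ?b = "\<lambda>j. b_const (\<alpha> j) (l ! j) (\<lambda>i. b (L l j + i) - a (L l j + i))"
  have coord: "(\<lambda>x. x (L l j + i)) \<in> borel_measurable (leb d)" if "j < length l" "i < l ! j" for i j
    using block_index_less[OF that] d by (intro leb_component) simp
  have k [measurable]: "(\<lambda>p. ?k j (fst p) (snd p)) \<in> borel_measurable (leb d \<Otimes>\<^sub>M leb d)"
    if "j < length l" for j
    by (intro measurable_kern borel_measurable_diff measurable_compose[OF measurable_fst coord]
        measurable_compose[OF measurable_snd coord] that)
  have [measurable]: "(\<lambda>u. ?k j t u) \<in> borel_measurable (leb d)" if "j < length l" for j t
    by (intro measurable_kern borel_measurable_diff coord that) simp
  have [measurable]: "(\<lambda>t. \<integral>\<^sup>+u. ennreal (?k j t u) \<partial>U) \<in> borel_measurable (leb d)" if "j < length l" for j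
  proof -
    have "(\<lambda>(t, u). ennreal (?k j t u)) \<in> borel_measurable (leb d \<Otimes>\<^sub>M U)"
      using k[OF that] by (simp add: case_prod_beta' cong: measurable_cong_sets sets_pair_measure_cong) measurable
    then show ?thesis by (rule U.borel_measurable_nn_integral)
  qed
  have "(\<integral>\<^sup>+t. \<integral>\<^sup>+u. ennreal (\<Sum>j<length l. A j * ?k j t u) \<partial>U \<partial>U) =
      (\<integral>\<^sup>+t. \<integral>\<^sup>+u. (\<Sum>j<length l. ennreal (A j) * ennreal (?k j t u)) \<partial>U \<partial>U)"
    using A by (intro nn_integral_cong, subst sum_ennreal[symmetric]) (auto simp: kern_nonneg ennreal_mult)
  also have "\<dots> = (\<integral>\<^sup>+t. (\<Sum>j<length l. ennreal (A j) * (\<integral>\<^sup>+u. ennreal (?k j t u) \<partial>U)) \<partial>U)"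
    by (subst nn_integral_sum) (auto intro!: nn_integral_cong sum.cong nn_integral_cmult)
  also have "\<dots> = (\<Sum>j<length l. ennreal (A j) * (\<integral>\<^sup>+t. \<integral>\<^sup>+u. ennreal (?k j t u) \<partial>U \<partial>U))"
    by (subst nn_integral_sum) (auto intro!: sum.cong nn_integral_cmult)
  also have "\<dots> = (\<Sum>j<length l. ennreal (A j) * ennreal (2 * ?b j))"
  proof (intro sum.cong refl arg_cong2[where f="(*)"])
    fix j assume "j \<in> {..<length l}"
    then have j: "j < length l" by simp
    show "(\<integral>\<^sup>+t. \<integral>\<^sup>+u. ennreal (?k j t u) \<partial>U \<partial>U) = ennreal (2 * ?b j)"
      unfolding U_def using \<alpha>[OF j] ab block_index_less[OF j] d
      by (intro nn_integral_kern_rect) (auto simp: inj_on_def)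
  qed
  also have "\<dots> = (\<Sum>j<length l. ennreal (2 * (A j * ?b j)))"
    using A by (intro sum.cong refl) (simp add: b_const_nonneg ennreal_mult[symmetric] mult.left_commute)
  also have "\<dots> = ennreal (2 * (\<Sum>j<length l. A j * ?b j))"
    using A by (subst sum_ennreal) (auto simp: b_const_nonneg sum_distrib_left)
  finally show ?thesis .
qed

text \<open>The hypotheses say that on this box the variogram, \<open>c j\<close> and the products
  of grid number, density and side length are all known up to a factor r. \<open>T\<close> is the
  contribution of the box to the leading term with the integrand of v frozen at \<tau>. Leaving
  \<tau> free permits integration over it afterwards.\<close>

lemma stratum_error_bounds:
  fixes q :: "nat \<Rightarrow> nat" and \<gamma> :: "(nat \<Rightarrow> real) \<Rightarrow> (nat \<Rightarrow> real) \<Rightarrow> real"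
  assumes d: "sum_list l = d" and r: "1 < r"
    and \<alpha>: "\<And>j. j < length l \<Longrightarrow> 0 < \<alpha> j \<and> \<alpha> j < 2"
    and ab: "\<And>m. m < d \<Longrightarrow> a m < b m"
    and c: "\<And>j t. j < length l \<Longrightarrow> t \<in> rect d a b \<Longrightarrow> 0 < c j t"
    and cr: "\<And>j t u. j < length l \<Longrightarrow> t \<in> rect d a b \<Longrightarrow> u \<in> rect d a b \<Longrightarrow> c j t \<le> r * c j u"
    and \<gamma>1: "\<And>t u. t \<in> rect d a b \<Longrightarrow> u \<in> rect d a b \<Longrightarrow> \<gamma> t u \<le>
      r * (\<Sum>j<length l. c j t * kern (\<alpha> j) (l ! j) (\<lambda>i. t (L l j + i) - u (L l j + i)))"
    and \<gamma>2: "\<And>t u. t \<in> rect d a b \<Longrightarrow> u \<in> rect d a b \<Longrightarrow>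
      (\<Sum>j<length l. c j t * kern (\<alpha> j) (l ! j) (\<lambda>i. t (L l j + i) - u (L l j + i))) \<le> r * \<gamma> t u"
    and q: "\<And>j. j < length l \<Longrightarrow> 0 < q j"
    and h: "\<And>m v. m < d \<Longrightarrow> v \<in> {a m..b m} \<Longrightarrow> 0 < h (comp_of l m) v"
    and w: "\<And>m v. m < d \<Longrightarrow> v \<in> {a m..b m} \<Longrightarrow>
      real (q (comp_of l m)) * h (comp_of l m) v * (b m - a m) \<le> r \<and>
      1 \<le> r * (real (q (comp_of l m)) * h (comp_of l m) v * (b m - a m))"
    and \<tau>: "\<tau> \<in> rect d a b"
  defines "U \<equiv> uniform_measure (leb d) (rect d a b)"
    and "vol \<equiv> measure (leb d) (rect d a b)"
    and "T \<equiv> measure (leb d) (rect d a b) * (inverse (\<Prod>m<d. real (q (comp_of l m))) *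
      (\<Sum>j<length l. v_density d l \<alpha> c h j \<tau> / real (q j) powr \<alpha> j))"
  shows "ennreal (vol\<^sup>2 / 2) * (\<integral>\<^sup>+t. \<integral>\<^sup>+u. ennreal (\<gamma> t u) \<partial>U \<partial>U) \<le> ennreal (r ^ (d + 4) * T)"
    and "ennreal (T / r ^ (d + 4)) \<le> ennreal (vol\<^sup>2 / 2) * (\<integral>\<^sup>+t. \<integral>\<^sup>+u. ennreal (\<gamma> t u) \<partial>U \<partial>U)"
proof -
  let ?k = "\<lambda>j t u. kern (\<alpha> j) (l ! j) (\<lambda>i. t (L l j + i) - u (L l j + i))"
  let ?b = "\<lambda>j. b_const (\<alpha> j) (l ! j) (\<lambda>i. b (L l j + i) - a (L l j + i))"
  let ?D = "\<lambda>j. b_const (\<alpha> j) (l ! j) (D_vec l h j \<tau>)"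
  define K where "K = (\<Sum>j<length l. c j \<tau> * ?b j)"
  define K' where "K' = (\<Sum>j<length l. c j \<tau> * (?D j / real (q j) powr \<alpha> j))"
  \<comment> \<open>\<open>G\<close> is the volume of a box whose sides are exactly
    \<open>1 / (n h)\<close> at \<tau>; when the grid numbers multiply to N, it is 1/N times the
    product of the \<open>1 / h\<close>.\<close>
  define G where "G = inverse (\<Prod>m<d. real (q (comp_of l m))) * (\<Prod>m<d. inverse (h (comp_of l m) (\<tau> m)))"
  have \<tau>m: "\<tau> m \<in> {a m..b m}" if "m < d" for m using \<tau> that by (auto simp: PiE_def Pi_def)
  have cm: "comp_of l m < length l" if "m < d" for m using that d comp_of_less by blast
  have vol: "vol = (\<Prod>m<d. b m - a m)"
    unfolding vol_def using ab by (intro measure_leb_rect) (simp add: less_imp_le)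
  have vol0: "0 < vol" unfolding vol using ab by (intro prod_pos) simp
  have width: "b m - a m \<le> r * (inverse (real (q (comp_of l m))) * inverse (h (comp_of l m) (\<tau> m)))"
    "inverse (real (q (comp_of l m))) * inverse (h (comp_of l m) (\<tau> m)) \<le> r * (b m - a m)" if m: "m < d" for m
  proof -
    have pos: "0 < real (q (comp_of l m)) * h (comp_of l m) (\<tau> m)"
      using q[OF cm[OF m]] h[OF m \<tau>m[OF m]] by simp
    show "b m - a m \<le> r * (inverse (real (q (comp_of l m))) * inverse (h (comp_of l m) (\<tau> m)))"
      using pos conjunct1[OF w[OF m \<tau>m[OF m]]]
      by (simp add: inverse_mult_distrib[symmetric] divide_inverse[symmetric] pos_le_divide_eq mult.commute del: inverse_mult_distrib)
    show "inverse (real (q (comp_of l m))) * inverse (h (comp_of l m) (\<tau> m)) \<le> r * (b m - a m)"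
      using pos conjunct2[OF w[OF m \<tau>m[OF m]]]
      by (simp add: inverse_mult_distrib[symmetric] inverse_eq_divide pos_divide_le_eq ac_simps del: inverse_mult_distrib)
  qed
  have G0: "0 < G" unfolding G_def
    using q[OF cm] h[OF _ \<tau>m] by (intro mult_pos_pos positive_imp_inverse_positive prod_pos) auto
  have G_prod: "G = (\<Prod>m<d. inverse (real (q (comp_of l m))) * inverse (h (comp_of l m) (\<tau> m)))"
    by (simp add: G_def prod.distrib prod_inversef[unfolded o_def])
  have volG: "vol \<le> r ^ d * G"
  proof -
    have "vol \<le> (\<Prod>m<d. r * (inverse (real (q (comp_of l m))) * inverse (h (comp_of l m) (\<tau> m))))"
      unfolding vol using ab width(1) by (intro prod_mono) (auto simp: less_imp_le)
    then show ?thesis by (simp add: G_prod prod.distrib)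
  qed
  have Gvol: "G \<le> r ^ d * vol"
  proof -
    have "G \<le> (\<Prod>m<d. r * (b m - a m))"
      unfolding G_prod using width(2) q[OF cm] h[OF _ \<tau>m] by (intro prod_mono) (auto simp: less_imp_le)
    then show ?thesis by (simp add: vol prod.distrib)
  qed
  \<comment> \<open>The bound 2 on the exponents gives one power of r for all components
    together.\<close>
  have r\<alpha>: "r powr \<alpha> j \<le> r\<^sup>2" if "j < length l" for j
    using powr_mono[of "\<alpha> j" 2 r] \<alpha>[OF that] r by simp
  have bD: "?b j \<le> r\<^sup>2 * (?D j / real (q j) powr \<alpha> j)" "?D j / real (q j) powr \<alpha> j \<le> r\<^sup>2 * ?b j"
    if j: "j < length l" for j
  proof -
    have q0: "0 < real (q j)" using q[OF j] by simp
    have Dv: "D_vec l h j \<tau> i = inverse (h j (\<tau> (L l j + i)))" if "i < l ! j" for i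
      using that by (simp add: D_vec_def component_def divide_inverse)
    have wd: "b (L l j + i) - a (L l j + i) \<le> r / real (q j) * D_vec l h j \<tau> i"
      "inverse (real (q j)) * D_vec l h j \<tau> i \<le> r * (b (L l j + i) - a (L l j + i))"
      "0 < b (L l j + i) - a (L l j + i)" "0 < D_vec l h j \<tau> i" if i: "i < l ! j" for i
    proof -
      have m: "L l j + i < d" using block_index_less[OF j i] d by simp
      show "b (L l j + i) - a (L l j + i) \<le> r / real (q j) * D_vec l h j \<tau> i"
        "inverse (real (q j)) * D_vec l h j \<tau> i \<le> r * (b (L l j + i) - a (L l j + i))"
        using width[OF m] by (simp_all add: comp_of_block[OF j i] Dv[OF i] divide_inverse mult.assoc)
      show "0 < b (L l j + i) - a (L l j + i)" using ab[OF m] by simp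
      show "0 < D_vec l h j \<tau> i" using h[OF m \<tau>m[OF m]] by (simp add: comp_of_block[OF j i] Dv[OF i])
    qed
    have "?b j \<le> b_const (\<alpha> j) (l ! j) (\<lambda>i. r / real (q j) * D_vec l h j \<tau> i)"
      using \<alpha>[OF j] wd r by (intro b_const_mono) (auto simp: less_imp_le abs_mult intro: order_trans)
    also have "\<dots> = r powr \<alpha> j * (?D j / real (q j) powr \<alpha> j)"
      using q0 r by (subst b_const_cmult) (auto simp: powr_divide)
    also have "\<dots> \<le> r\<^sup>2 * (?D j / real (q j) powr \<alpha> j)"
      using r\<alpha>[OF j] by (intro mult_right_mono) (auto simp: b_const_nonneg)
    finally show "?b j \<le> r\<^sup>2 * (?D j / real (q j) powr \<alpha> j)" .
    have "?D j / real (q j) powr \<alpha> j = b_const (\<alpha> j) (l ! j) (\<lambda>i. inverse (real (q j)) * D_vec l h j \<tau> i)"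
      using q0 by (subst b_const_cmult) (auto simp: powr_divide inverse_eq_divide)
    also have "\<dots> \<le> b_const (\<alpha> j) (l ! j) (\<lambda>i. r * (b (L l j + i) - a (L l j + i)))"
      using \<alpha>[OF j] wd r q0 by (intro b_const_mono) (auto simp: less_imp_le abs_mult)
    also have "\<dots> = r powr \<alpha> j * ?b j" using r by (subst b_const_cmult) auto
    also have "\<dots> \<le> r\<^sup>2 * ?b j"
      using r\<alpha>[OF j] by (intro mult_right_mono) (auto simp: b_const_nonneg)
    finally show "?D j / real (q j) powr \<alpha> j \<le> r\<^sup>2 * ?b j" .
  qed
  have c\<tau>: "0 \<le> c j \<tau>" if "j < length l" for j using c[OF that \<tau>] by simp
  have K0: "0 \<le> K" "0 \<le> K'"
    unfolding K_def K'_def using c\<tau>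
    by (auto intro!: sum_nonneg mult_nonneg_nonneg divide_nonneg_nonneg b_const_nonneg)
  have KK': "K \<le> r\<^sup>2 * K'" "K' \<le> r\<^sup>2 * K"
    unfolding K_def K'_def sum_distrib_left using c\<tau> bD
    by (auto intro!: sum_mono simp: mult.left_commute[of "r\<^sup>2"] intro: mult_left_mono simp del: times_divide_eq_right)
  have T: "T = vol * (G * K')"
    by (simp add: T_def vol_def G_def K'_def v_density_def sum_distrib_left sum_distrib_right mult_ac)
  have upper: "vol\<^sup>2 / 2 * (2 * (r\<^sup>2 * K)) \<le> r ^ (d + 4) * T"
  proof -
    have "vol\<^sup>2 / 2 * (2 * (r\<^sup>2 * K)) = vol * (r\<^sup>2 * (vol * K))" by (simp add: power2_eq_square)
    \<comment> \<open>Only one of the two volume factors is compared with \<open>G\<close>; the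
      other remains in \<open>T\<close>.\<close>
    also have "\<dots> \<le> vol * (r\<^sup>2 * ((r ^ d * G) * (r\<^sup>2 * K')))"
      using volG KK'(1) vol0 K0 G0 r by (intro mult_left_mono mult_mono) auto
    also have "\<dots> = r ^ (d + 4) * T" by (simp add: T power_add power2_eq_square power4_eq_xxxx)
    finally show ?thesis .
  qed
  have lower: "T / r ^ (d + 4) \<le> vol\<^sup>2 / 2 * (2 * (K / r\<^sup>2))"
  proof -
    have "T \<le> vol * ((r ^ d * vol) * (r\<^sup>2 * K))"
      unfolding T using Gvol KK'(2) vol0 K0 G0 r by (intro mult_left_mono mult_mono) auto
    also have "\<dots> = r ^ (d + 4) * (vol\<^sup>2 / 2 * (2 * (K / r\<^sup>2)))"
      using r by (simp add: power_add power2_eq_square power4_eq_xxxx)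
    finally show ?thesis using r by (simp add: pos_divide_le_eq mult.commute)
  qed
  \<comment> \<open>One factor r comes from the variogram, the second from freezing
    \<open>c j\<close> at \<tau>. After freezing, the coefficients are constants and the rescaling
    formula applies.\<close>
  have sumU: "r * (\<Sum>j<length l. c j t * ?k j t u) \<le> (\<Sum>j<length l. (r\<^sup>2 * c j \<tau>) * ?k j t u)"
    if "t \<in> rect d a b" for t u
  proof -
    have "r * (c j t * ?k j t u) \<le> (r\<^sup>2 * c j \<tau>) * ?k j t u" if j: "j < length l" for j
    proof -
      have "r * c j t \<le> r * (r * c j \<tau>)" using cr[OF j \<open>t \<in> _\<close> \<tau>] r by (intro mult_left_mono) auto
      then have "r * c j t * ?k j t u \<le> r * (r * c j \<tau>) * ?k j t u" by (rule mult_right_mono) (rule kern_nonneg)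
      then show ?thesis by (simp add: power2_eq_square mult.assoc)
    qed
    then show ?thesis unfolding sum_distrib_left by (intro sum_mono) auto
  qed
  have sumL: "(\<Sum>j<length l. (c j \<tau> / r\<^sup>2) * ?k j t u) \<le> (\<Sum>j<length l. c j t * ?k j t u) / r"
    if "t \<in> rect d a b" for t u
  proof -
    have "(c j \<tau> / r\<^sup>2) * ?k j t u \<le> c j t * ?k j t u / r" if j: "j < length l" for j
    proof -
      have "c j \<tau> / r\<^sup>2 \<le> c j t / r"
        using cr[OF j \<tau> \<open>t \<in> _\<close>] r by (simp add: power2_eq_square field_simps)
      then have "(c j \<tau> / r\<^sup>2) * ?k j t u \<le> (c j t / r) * ?k j t u" by (rule mult_right_mono) (rule kern_nonneg)
      then show ?thesis by simp
    qed
    then show ?thesis unfolding sum_divide_distrib by (intro sum_mono) auto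
  qed
  have "(\<integral>\<^sup>+t. \<integral>\<^sup>+u. ennreal (\<gamma> t u) \<partial>U \<partial>U) \<le>
      (\<integral>\<^sup>+t. \<integral>\<^sup>+u. ennreal (\<Sum>j<length l. (r\<^sup>2 * c j \<tau>) * ?k j t u) \<partial>U \<partial>U)"
    unfolding U_def using \<gamma>1 sumU
    by (intro nn_integral_mono_AE uniform_rect_AE_I) (meson ennreal_leI order_trans)
  also have "\<dots> = ennreal (2 * (\<Sum>j<length l. (r\<^sup>2 * c j \<tau>) * ?b j))"
    unfolding U_def using \<alpha> c\<tau> r ab d by (intro nn_integral_sum_kern_rect) (auto simp: less_imp_le)
  also have "(\<Sum>j<length l. (r\<^sup>2 * c j \<tau>) * ?b j) = r\<^sup>2 * K" by (simp add: K_def sum_distrib_left mult.assoc)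
  finally have "ennreal (vol\<^sup>2 / 2) * (\<integral>\<^sup>+t. \<integral>\<^sup>+u. ennreal (\<gamma> t u) \<partial>U \<partial>U) \<le>
      ennreal (vol\<^sup>2 / 2) * ennreal (2 * (r\<^sup>2 * K))" by (rule mult_left_mono) simp
  also have "\<dots> = ennreal (vol\<^sup>2 / 2 * (2 * (r\<^sup>2 * K)))"
    using K0 by (intro ennreal_mult[symmetric]) auto
  also have "\<dots> \<le> ennreal (r ^ (d + 4) * T)" using upper by (rule ennreal_leI)
  finally show "ennreal (vol\<^sup>2 / 2) * (\<integral>\<^sup>+t. \<integral>\<^sup>+u. ennreal (\<gamma> t u) \<partial>U \<partial>U) \<le> ennreal (r ^ (d + 4) * T)" .
  have "ennreal (T / r ^ (d + 4)) \<le> ennreal (vol\<^sup>2 / 2 * (2 * (K / r\<^sup>2)))" using lower by (rule ennreal_leI)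
  also have "\<dots> = ennreal (vol\<^sup>2 / 2) * ennreal (2 * (K / r\<^sup>2))"
    using K0 by (intro ennreal_mult) auto
  also have "K / r\<^sup>2 = (\<Sum>j<length l. (c j \<tau> / r\<^sup>2) * ?b j)" by (simp add: K_def sum_divide_distrib)
  also have "ennreal (2 * (\<Sum>j<length l. (c j \<tau> / r\<^sup>2) * ?b j)) =
      (\<integral>\<^sup>+t. \<integral>\<^sup>+u. ennreal (\<Sum>j<length l. (c j \<tau> / r\<^sup>2) * ?k j t u) \<partial>U \<partial>U)"
    unfolding U_def using \<alpha> c\<tau> r ab d
    by (intro nn_integral_sum_kern_rect[symmetric]) (auto simp: less_imp_le)
  also have "ennreal (vol\<^sup>2 / 2) * \<dots> \<le> ennreal (vol\<^sup>2 / 2) * (\<integral>\<^sup>+t. \<integral>\<^sup>+u. ennreal (\<gamma> t u) \<partial>U \<partial>U)"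
  proof (rule mult_left_mono)
    have "(\<Sum>j<length l. c j t * ?k j t u) / r \<le> \<gamma> t u" if "t \<in> rect d a b" "u \<in> rect d a b" for t u
      using \<gamma>2[OF that] r by (simp add: pos_divide_le_eq mult.commute)
    then show "(\<integral>\<^sup>+t. \<integral>\<^sup>+u. ennreal (\<Sum>j<length l. (c j \<tau> / r\<^sup>2) * ?k j t u) \<partial>U \<partial>U) \<le>
        (\<integral>\<^sup>+t. \<integral>\<^sup>+u. ennreal (\<gamma> t u) \<partial>U \<partial>U)"
      unfolding U_def using sumL by (intro nn_integral_mono_AE uniform_rect_AE_I) (meson ennreal_leI order_trans)
  qed simp
  finally show "ennreal (T / r ^ (d + 4)) \<le> ennreal (vol\<^sup>2 / 2) * (\<integral>\<^sup>+t. \<integral>\<^sup>+u. ennreal (\<gamma> t u) \<partial>U \<partial>U)" .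
qed

text \<open>The abstract error formula applied to the field. The true integral is first split into
  cell averages, so that each stratum contributes the difference between its mean and its sampled
  value.\<close>

lemma stratified_mse:
  fixes M F :: "'w measure" and X :: "(nat \<Rightarrow> real) \<Rightarrow> 'w \<Rightarrow> real" and a b :: "'i \<Rightarrow> nat \<Rightarrow> real"
  assumes M: "prob_space M" and rf: "random_field M F d X" and I: "finite I" "I \<noteq> {}"
    and ab: "\<And>i m. i \<in> I \<Longrightarrow> m < d \<Longrightarrow> 0 \<le> a i m \<and> a i m < b i m \<and> b i m \<le> 1"
    and cover: "AE t in unif_cube d. (\<Sum>i\<in>I. indicator (rect d (a i) (b i)) t :: real) = 1"
    and \<eta>: "\<And>i. i \<in> I \<Longrightarrow> \<eta> i \<in> M \<rightarrow>\<^sub>M leb d" "\<And>i w. i \<in> I \<Longrightarrow> w \<in> space M \<Longrightarrow> \<eta> i w \<in> rect d (a i) (b i)"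
    and law: "\<And>i. i \<in> I \<Longrightarrow> distr M (leb d) (\<eta> i) = uniform_measure (leb d) (rect d (a i) (b i))"
    and ind: "prob_space.indep_vars M (\<lambda>_. leb d) \<eta> I"
    and indF: "prob_space.indep_set M (sets F)
       (sets (vimage_algebra (space M) (\<lambda>w. \<lambda>i\<in>I. \<eta> i w) (PiM I (\<lambda>_. leb d))))"
  defines "err \<equiv> \<lambda>w. field_integral d X w - (\<Sum>i\<in>I. X (\<eta> i w) w * measure (leb d) (rect d (a i) (b i)))"
    and "U \<equiv> \<lambda>i. uniform_measure (leb d) (rect d (a i) (b i))"
  shows "(\<lambda>w. (err w)\<^sup>2) \<in> borel_measurable M"
    and "(\<integral>\<^sup>+w. ennreal ((err w)\<^sup>2) \<partial>M) = (\<Sum>i\<in>I. ennreal ((measure (leb d) (rect d (a i) (b i)))\<^sup>2 / 2) *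
      (\<integral>\<^sup>+t. \<integral>\<^sup>+u. ennreal (variogram M X t u) \<partial>U i \<partial>U i))"
proof -
  interpret M: prob_space M by fact
  have sub: "subalgebra M F" using rf by (simp add: random_field_def)
  \<comment> \<open>Extension by 0 supplies joint measurability on all of \<open>leb d\<close>. It
    leaves the error unchanged because every sampling point lies in its stratum for every
    outcome.\<close>
  define Y where "Y t w = indicator (cube d) t * X t w" for t w
  have Y [measurable]: "(\<lambda>(t, w). Y t w) \<in> borel_measurable (leb d \<Otimes>\<^sub>M F)"
    using field_extension_measurable[OF rf] by (simp add: Y_def)
  have Y_cube: "Y t w = X t w" if "t \<in> cube d" for t w using that by (simp add: Y_def)
  have idF [measurable]: "(\<lambda>w. w) \<in> M \<rightarrow>\<^sub>M F" using sub by (rule distr_id_subalgebra)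
  have YM [measurable]: "(\<lambda>(t, w). Y t w) \<in> borel_measurable (leb d \<Otimes>\<^sub>M M)"
  proof -
    have "(\<lambda>p. (fst p, snd p)) \<in> leb d \<Otimes>\<^sub>M M \<rightarrow>\<^sub>M leb d \<Otimes>\<^sub>M F"
      using measurable_compose[OF measurable_snd idF, of "leb d"] by measurable
    from measurable_compose[OF this Y] show ?thesis by simp
  qed
  have sub_cube: "rect d (a i) (b i) \<subseteq> cube d" if "i \<in> I" for i
    unfolding cube_eq_rect using ab[OF that] by (intro PiE_mono) fastforce
  have pU: "prob_space (U i)" if "i \<in> I" for i
    unfolding U_def using ab[OF that] by (intro prob_uniform_rect) auto
  obtain C where C: "0 \<le> C" "\<And>t. t \<in> cube d \<Longrightarrow> (LINT w|M. (X t w)\<^sup>2) \<le> C"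
    using field_second_moment_bounded[OF rf] by blast
  have Y2: "(\<integral>\<^sup>+w. ennreal ((Y t w)\<^sup>2) \<partial>M) \<le> ennreal C" for t
  proof (cases "t \<in> cube d")
    case True
    then have "(\<integral>\<^sup>+w. ennreal ((Y t w)\<^sup>2) \<partial>M) = ennreal (LINT w|M. (X t w)\<^sup>2)"
      using rf by (simp add: Y_cube random_field_def nn_integral_eq_integral)
    with C(2)[OF True] show ?thesis by (simp add: ennreal_leI)
  qed (simp add: Y_def)
  have fin: "(\<integral>\<^sup>+t. \<integral>\<^sup>+w. ennreal ((Y t w)\<^sup>2) \<partial>M \<partial>Q) < \<infinity>" if "prob_space Q" for Q
  proof -
    have "(\<integral>\<^sup>+t. \<integral>\<^sup>+w. ennreal ((Y t w)\<^sup>2) \<partial>M \<partial>Q) \<le> (\<integral>\<^sup>+t. ennreal C \<partial>Q)"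
      by (intro nn_integral_mono Y2)
    also have "\<dots> = ennreal C" using prob_space.emeasure_space_1[OF that] by simp
    finally show ?thesis by (rule le_less_trans) simp
  qed
  have AE_sq: "AE w in M. integrable (unif_cube d) (\<lambda>t. (Y t w)\<^sup>2)"
  proof (rule AE_square_integrable_section)
    show "(\<lambda>(t, w). Y t w) \<in> borel_measurable (unif_cube d \<Otimes>\<^sub>M M)"
      using YM by (simp cong: measurable_cong_sets sets_pair_measure_cong)
  qed (use fin[OF prob_unif_cube] prob_space_imp_sigma_finite[OF prob_unif_cube]
      prob_space_imp_sigma_finite[OF M] in auto)
  define err' where "err' w = (\<Sum>i\<in>I. measure (leb d) (rect d (a i) (b i)) * ((LINT t|U i. Y t w) - Y (\<eta> i w) w))" for w
  have field_Y: "field_integral d X w = (LINT t|unif_cube d. Y t w)" if "w \<in> space M" for w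
  proof -
    have "(\<lambda>t. Y t w) \<in> borel_measurable (leb d)" using that by measurable
    then have "(LINT t:cube d|leb d. Y t w) = (LINT t|unif_cube d. Y t w)" by (rule set_integral_cube)
    moreover have "field_integral d X w = (LINT t:cube d|leb d. Y t w)"
      unfolding field_integral_def set_lebesgue_integral_def
      by (intro Bochner_Integration.integral_cong) (auto simp: Y_def indicator_def)
    ultimately show ?thesis by simp
  qed
  have quad_Y: "X (\<eta> i w) w = Y (\<eta> i w) w" if "i \<in> I" "w \<in> space M" for i w
    using \<eta>(2)[OF that] sub_cube[OF that(1)] by (auto simp: Y_cube)
  \<comment> \<open>Splitting the integral into cells requires an integrable path, which is
    guaranteed only almost surely.\<close>
  have err_eq: "AE w in M. err w = err' w"
    using AE_sq
  proof (rule AE_mp, intro AE_I2 impI)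
    fix w assume w: "w \<in> space M" and sq: "integrable (unif_cube d) (\<lambda>t. (Y t w)\<^sup>2)"
    have m: "(\<lambda>t. Y t w) \<in> borel_measurable (leb d)" using w by measurable
    have int: "integrable (unif_cube d) (\<lambda>t. Y t w)"
    proof (rule finite_measure.square_integrable_imp_integrable[OF prob_space.finite_measure[OF prob_unif_cube] _ sq])
      show "(\<lambda>t. Y t w) \<in> borel_measurable (unif_cube d)"
        by (subst measurable_cong_sets[OF sets_uniform_measure refl]) (rule m)
    qed
    have "(LINT t|unif_cube d. Y t w) = (\<Sum>i\<in>I. measure (leb d) (rect d (a i) (b i)) * (LINT t|U i. Y t w))"
      unfolding U_def by (rule integral_cube_eq_sum_cells) (rule I(1) cover m int ab; assumption)+
    moreover have "(\<Sum>i\<in>I. X (\<eta> i w) w * measure (leb d) (rect d (a i) (b i))) =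
        (\<Sum>i\<in>I. measure (leb d) (rect d (a i) (b i)) * Y (\<eta> i w) w)"
      using w by (intro sum.cong) (auto simp: quad_Y)
    ultimately show "err w = err' w"
      unfolding err_def err'_def field_Y[OF w] right_diff_distrib sum_subtractf by (simp only:)
  qed
  have Y\<eta> [measurable]: "(\<lambda>w. Y (\<eta> i w) w) \<in> borel_measurable M" if "i \<in> I" for i
  proof -
    have "(\<lambda>w. (\<eta> i w, w)) \<in> M \<rightarrow>\<^sub>M leb d \<Otimes>\<^sub>M M" using \<eta>(1)[OF that] by measurable
    from measurable_compose[OF this YM] show ?thesis by simp
  qed
  have IY [measurable]: "(\<lambda>w. LINT t|unif_cube d. Y t w) \<in> borel_measurable M"
  proof -
    interpret Q: prob_space "unif_cube d" by (rule prob_unif_cube)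
    show ?thesis by measurable
  qed
  \<comment> \<open>Measurability is read off an expression equal to \<open>err\<close> at every
    outcome; the almost sure equality with \<open>err'\<close> would not transfer it when M is
    incomplete.\<close>
  have "(\<lambda>w. (LINT t|unif_cube d. Y t w) - (\<Sum>i\<in>I. Y (\<eta> i w) w * measure (leb d) (rect d (a i) (b i)))) \<in> borel_measurable M"
    by measurable
  then have "err \<in> borel_measurable M"
    by (rule measurable_cong[THEN iffD1, rotated]) (simp add: err_def field_Y quad_Y)
  then show "(\<lambda>w. (err w)\<^sup>2) \<in> borel_measurable M" by measurable
  have "(\<integral>\<^sup>+w. ennreal ((err w)\<^sup>2) \<partial>M) = (\<integral>\<^sup>+w. ennreal ((err' w)\<^sup>2) \<partial>M)"
    using err_eq by (intro nn_integral_cong_AE) auto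
  also have "\<dots> = (\<Sum>i\<in>I. ennreal ((measure (leb d) (rect d (a i) (b i)))\<^sup>2 / 2) *
      (\<integral>\<^sup>+t. \<integral>\<^sup>+u. \<integral>\<^sup>+w. ennreal ((Y t w - Y u w)\<^sup>2) \<partial>M \<partial>U i \<partial>U i))"
    unfolding err'_def
  proof (rule stratified_mean_square_error[where S="leb d" and F=F])
    show "\<And>i. i \<in> I \<Longrightarrow> distr M (leb d) (\<eta> i) = U i" unfolding U_def by (rule law)
  qed (use M sub I pU \<eta>(1) ind indF Y fin in \<open>auto simp: U_def\<close>)
  also have "\<dots> = (\<Sum>i\<in>I. ennreal ((measure (leb d) (rect d (a i) (b i)))\<^sup>2 / 2) *
      (\<integral>\<^sup>+t. \<integral>\<^sup>+u. ennreal (variogram M X t u) \<partial>U i \<partial>U i))"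
  proof (intro sum.cong refl arg_cong2[where f="(*)"])
    fix i assume i: "i \<in> I"
    have "(\<integral>\<^sup>+w. ennreal ((Y t w - Y u w)\<^sup>2) \<partial>M) = ennreal (variogram M X t u)"
      if "t \<in> rect d (a i) (b i)" "u \<in> rect d (a i) (b i)" for t u
    proof -
      have "t \<in> cube d" "u \<in> cube d" using sub_cube[OF i] that by auto
      then show ?thesis using nn_integral_field_increment[OF rf] by (simp add: Y_cube)
    qed
    then show "(\<integral>\<^sup>+t. \<integral>\<^sup>+u. \<integral>\<^sup>+w. ennreal ((Y t w - Y u w)\<^sup>2) \<partial>M \<partial>U i \<partial>U i) =
        (\<integral>\<^sup>+t. \<integral>\<^sup>+u. ennreal (variogram M X t u) \<partial>U i \<partial>U i)"
      unfolding U_def by (intro nn_integral_cong_AE uniform_rect_AE_I) auto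
  qed
  finally show "(\<integral>\<^sup>+w. ennreal ((err w)\<^sup>2) \<partial>M) = (\<Sum>i\<in>I. ennreal ((measure (leb d) (rect d (a i) (b i)))\<^sup>2 / 2) *
      (\<integral>\<^sup>+t. \<integral>\<^sup>+u. ennreal (variogram M X t u) \<partial>U i \<partial>U i))" .
qed

section \<open>Asymptotics\<close>

lemma common_positive_bound:
  assumes "\<And>j. j < (k :: nat) \<Longrightarrow> \<exists>\<delta>>0. P j (\<delta> :: real)"
    and "\<And>j \<delta> \<delta>'. P j \<delta> \<Longrightarrow> \<delta>' \<le> \<delta> \<Longrightarrow> P j \<delta>'"
  shows "\<exists>\<delta>>0. \<forall>j<k. P j \<delta>"
  using assms(1)
proof (induction k)
  case 0 then show ?case by (intro exI[of _ 1]) auto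
next
  case (Suc k)
  then obtain \<delta> where \<delta>: "0 < \<delta>" "\<forall>j<k. P j \<delta>" by (metis less_SucI)
  obtain \<delta>' where \<delta>': "0 < \<delta>'" "P k \<delta>'" using Suc.prems by blast
  have "P j (min \<delta> \<delta>')" if "j < Suc k" for j
    using that \<delta> \<delta>' assms(2)[of j \<delta> "min \<delta> \<delta>'"] assms(2)[of k \<delta>' "min \<delta> \<delta>'"]
    by (cases "j = k") auto
  with \<delta>(1) \<delta>'(1) show ?case by (intro exI[of _ "min \<delta> \<delta>'"]) auto
qed

context
  fixes M F :: "'w measure"
    and X :: "(nat \<Rightarrow> real) \<Rightarrow> 'w \<Rightarrow> real"
    and d :: nat and l :: "nat list" and \<alpha> :: "nat \<Rightarrow> real"
    and c :: "nat \<Rightarrow> (nat \<Rightarrow> real) \<Rightarrow> real"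
    and h :: "nat \<Rightarrow> real \<Rightarrow> real"
    and S :: "nat set" and n :: "nat \<Rightarrow> nat \<Rightarrow> nat"
    and \<eta> :: "nat \<Rightarrow> (nat \<Rightarrow> nat) \<Rightarrow> 'w \<Rightarrow> nat \<Rightarrow> real"
  assumes dec: "decomposition d l"
    and \<alpha>: "\<forall>j<length l. 0 < \<alpha> j \<and> \<alpha> j < 2"
    and M: "prob_space M"
    and rf: "random_field M F d X"
    and ls: "locally_stationary M d l \<alpha> c X"
    and cr: "cross_regular S l h n"
    and ss: "\<forall>N\<in>S. stratified_sampling M F d l h n N (\<eta> N)"
begin

lemma sum_l: "sum_list l = d"
  using dec by (simp add: decomposition_def)

lemma block_pos: "j < length l \<Longrightarrow> 0 < l ! j"
  using dec by (simp add: decomposition_def)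

lemma comp_less: "m < d \<Longrightarrow> comp_of l m < length l"
  using comp_of_less[of m l] sum_l by simp

lemma h_density:
  assumes "j < length l"
  shows "continuous_on {0..1} (h j)" "\<forall>v\<in>{0..1}. 0 < h j v" "(LINT v:{0..1}|lborel. h j v) = 1"
  using cr assms by (auto simp: cross_regular_def)

lemma c_positive:
  assumes "j < length l"
  shows "continuous_on (cube d) (c j)" "\<And>t. t \<in> cube d \<Longrightarrow> 0 < c j t"
  using ls assms by (auto simp: locally_stationary_def)

lemma n_pos: "N \<in> S \<Longrightarrow> j < length l \<Longrightarrow> 0 < n j N"
  using cr by (auto simp: cross_regular_def)

lemma v_const_positive: "j < length l \<Longrightarrow> 0 < v_const d l \<alpha> c h j"
  by (rule v_const_pos) (use sum_l block_pos \<alpha> c_positive h_density in auto)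

section \<open>Strata as boxes covering the cube\<close>

definition cell_lo :: "nat \<Rightarrow> (nat \<Rightarrow> nat) \<Rightarrow> nat \<Rightarrow> real" where
  "cell_lo N i m = grid_point (h (comp_of l m)) (n (comp_of l m) N) (i m)"

definition cell_hi :: "nat \<Rightarrow> (nat \<Rightarrow> nat) \<Rightarrow> nat \<Rightarrow> real" where
  "cell_hi N i m = grid_point (h (comp_of l m)) (n (comp_of l m) N) (Suc (i m))"

lemma stratum_eq: "stratum d l h n N i = rect d (cell_lo N i) (cell_hi N i)"
  by (simp add: stratum_def cell_lo_def cell_hi_def)

lemma index_less: "i \<in> multi_indices d l n N \<Longrightarrow> m < d \<Longrightarrow> i m < n (comp_of l m) N"
  by (auto simp: multi_indices_def PiE_def Pi_def)

lemma cell_range: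
  assumes "i \<in> multi_indices d l n N" "m < d"
  shows "0 \<le> cell_lo N i m \<and> cell_lo N i m < cell_hi N i m \<and> cell_hi N i m \<le> 1"
proof -
  note i = index_less[OF assms] and H = h_density[OF comp_less[OF assms(2)]]
  show ?thesis
    using grid_point_less[OF H, of "i m" "Suc (i m)"] i
      grid_point_props(1)[OF H, of "n (comp_of l m) N" "i m"]
      grid_point_props(1)[OF H, of "n (comp_of l m) N" "Suc (i m)"]
    by (auto simp: cell_lo_def cell_hi_def)
qed

lemma cells_cover:
  assumes "N \<in> S"
  shows "AE t in unif_cube d. (\<Sum>i\<in>multi_indices d l n N. indicator (rect d (cell_lo N i) (cell_hi N i)) t :: real) = 1"
  unfolding multi_indices_def cell_lo_def cell_hi_def
proof (rule AE_sum_indicator_grid[where p="\<lambda>m k. grid_point (h (comp_of l m)) (n (comp_of l m) N) k"])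
  fix m assume m: "m < d"
  note H = h_density[OF comp_less[OF m]]
  show "grid_point (h (comp_of l m)) (n (comp_of l m) N) 0 = 0 \<and>
      grid_point (h (comp_of l m)) (n (comp_of l m) N) (n (comp_of l m) N) = 1"
    using n_pos[OF assms comp_less[OF m]] grid_point_0[OF H] grid_point_q[OF H] by simp
  fix k assume "k < n (comp_of l m) N"
  then show "grid_point (h (comp_of l m)) (n (comp_of l m) N) k < grid_point (h (comp_of l m)) (n (comp_of l m) N) (Suc k)"
    by (intro grid_point_less[OF H]) auto
qed

lemma finite_indices: "finite (multi_indices d l n N)"
  unfolding multi_indices_def by (intro finite_PiE) auto

lemma indices_nonempty:
  assumes "N \<in> S"
  shows "multi_indices d l n N \<noteq> {}"
proof -
  have "(\<lambda>m\<in>{..<d}. 0) \<in> multi_indices d l n N"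
    using n_pos[OF assms comp_less] by (auto simp: multi_indices_def)
  then show ?thesis by blast
qed

section \<open>Comparison of the error with the leading term\<close>

definition mse :: "nat \<Rightarrow> real" where
  "mse N = (rv_norm M (\<lambda>w. field_integral d X w - quadrature d l h n N (\<eta> N) X w))\<^sup>2"

definition leading_term :: "nat \<Rightarrow> real" where
  "leading_term N = 1 / real N * (\<Sum>j<length l. v_const d l \<alpha> c h j / real (n j N) powr \<alpha> j)"

text \<open>The Bochner integral of a nonnegative measurable function is \<open>enn2real\<close> of
  its extended integral, even when that is infinite. The upper bounds on single strata later exclude
  the infinite case.\<close>

lemma mse_eq:
  assumes N: "N \<in> S"
  shows "mse N = enn2real (\<Sum>i\<in>multi_indices d l n N.
    ennreal ((measure (leb d) (rect d (cell_lo N i) (cell_hi N i)))\<^sup>2 / 2) *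
    (\<integral>\<^sup>+t. \<integral>\<^sup>+u. ennreal (variogram M X t u) \<partial>uniform_measure (leb d) (rect d (cell_lo N i) (cell_hi N i))
      \<partial>uniform_measure (leb d) (rect d (cell_lo N i) (cell_hi N i))))"
proof -
  from ss N have s: "stratified_sampling M F d l h n N (\<eta> N)" by blast
  note sampling = s[unfolded stratified_sampling_def stratum_eq]
  have \<eta>: "\<eta> N i \<in> M \<rightarrow>\<^sub>M leb d" "distr M (leb d) (\<eta> N i) = uniform_measure (leb d) (rect d (cell_lo N i) (cell_hi N i))"
    if "i \<in> multi_indices d l n N" for i
    using sampling that by blast+
  have \<eta>_in: "\<eta> N i w \<in> rect d (cell_lo N i) (cell_hi N i)" if "i \<in> multi_indices d l n N" "w \<in> space M" for i w
    using sampling that by blast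
  note facts = M rf finite_indices indices_nonempty[OF N] cell_range cells_cover[OF N] \<eta> \<eta>_in
    sampling[THEN conjunct2, THEN conjunct1] sampling[THEN conjunct2, THEN conjunct2]
  have meas: "(\<lambda>w. (field_integral d X w - (\<Sum>i\<in>multi_indices d l n N. X (\<eta> N i w) w *
        measure (leb d) (rect d (cell_lo N i) (cell_hi N i))))\<^sup>2) \<in> borel_measurable M"
    by (rule stratified_mse(1)[where M=M and F=F and X=X and d=d and I="multi_indices d l n N" and a="cell_lo N" and b="cell_hi N" and \<eta>="\<eta> N"])
      (rule facts; assumption)+
  have "(\<integral>\<^sup>+w. ennreal ((field_integral d X w - (\<Sum>i\<in>multi_indices d l n N. X (\<eta> N i w) w *
        measure (leb d) (rect d (cell_lo N i) (cell_hi N i))))\<^sup>2) \<partial>M) = (\<Sum>i\<in>multi_indices d l n N.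
    ennreal ((measure (leb d) (rect d (cell_lo N i) (cell_hi N i)))\<^sup>2 / 2) *
    (\<integral>\<^sup>+t. \<integral>\<^sup>+u. ennreal (variogram M X t u) \<partial>uniform_measure (leb d) (rect d (cell_lo N i) (cell_hi N i))
      \<partial>uniform_measure (leb d) (rect d (cell_lo N i) (cell_hi N i))))"
    by (rule stratified_mse(2)[where M=M and F=F and X=X and d=d and I="multi_indices d l n N" and a="cell_lo N" and b="cell_hi N" and \<eta>="\<eta> N"])
      (rule facts; assumption)+
  note nn = this
  show ?thesis
    unfolding mse_def rv_norm_square quadrature_def stratum_eq
      integral_eq_nn_integral[OF meas AE_I2[OF zero_le_power2]] nn ..
qed

text \<open>One scale for all three comparisons, because they are applied to the same strata.
  Closeness is coordinatewise, matching side lengths rather than the metric on functions.\<close>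

definition fine_scale :: "real \<Rightarrow> real \<Rightarrow> bool" where
  "fine_scale r \<delta> \<longleftrightarrow>
    (\<forall>t\<in>cube d. \<forall>u\<in>cube d. (\<forall>i<d. \<bar>t i - u i\<bar> < \<delta>) \<longrightarrow>
      variogram M X t u \<le> r * (\<Sum>j<length l. c j t * kern (\<alpha> j) (l ! j) (\<lambda>i. t (L l j + i) - u (L l j + i))) \<and>
      (\<Sum>j<length l. c j t * kern (\<alpha> j) (l ! j) (\<lambda>i. t (L l j + i) - u (L l j + i))) \<le> r * variogram M X t u) \<and>
    (\<forall>j<length l. \<forall>t\<in>cube d. \<forall>u\<in>cube d. (\<forall>i<d. \<bar>t i - u i\<bar> < \<delta>) \<longrightarrow> c j t \<le> r * c j u) \<and>
    (\<forall>j<length l. \<forall>x\<in>{0..1}. \<forall>y\<in>{0..1}. \<bar>x - y\<bar> < \<delta> \<longrightarrow> h j x \<le> r * h j y)"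

lemma fine_scaleD:
  assumes "fine_scale r \<delta>"
  shows "t \<in> cube d \<Longrightarrow> u \<in> cube d \<Longrightarrow> (\<And>i. i < d \<Longrightarrow> \<bar>t i - u i\<bar> < \<delta>) \<Longrightarrow> variogram M X t u \<le>
      r * (\<Sum>j<length l. c j t * kern (\<alpha> j) (l ! j) (\<lambda>i. t (L l j + i) - u (L l j + i)))"
    and "t \<in> cube d \<Longrightarrow> u \<in> cube d \<Longrightarrow> (\<And>i. i < d \<Longrightarrow> \<bar>t i - u i\<bar> < \<delta>) \<Longrightarrow>
      (\<Sum>j<length l. c j t * kern (\<alpha> j) (l ! j) (\<lambda>i. t (L l j + i) - u (L l j + i))) \<le> r * variogram M X t u"
    and "j < length l \<Longrightarrow> t \<in> cube d \<Longrightarrow> u \<in> cube d \<Longrightarrow> (\<And>i. i < d \<Longrightarrow> \<bar>t i - u i\<bar> < \<delta>) \<Longrightarrow> c j t \<le> r * c j u"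
    and "j < length l \<Longrightarrow> x \<in> {0..1} \<Longrightarrow> y \<in> {0..1} \<Longrightarrow> \<bar>x - y\<bar> < \<delta> \<Longrightarrow> h j x \<le> r * h j y"
  using assms unfolding fine_scale_def by simp_all

lemma fine_scale_exists:
  assumes r: "1 < r"
  shows "\<exists>\<delta>>0. fine_scale r \<delta>"
proof -
  obtain \<delta>1 where 1: "0 < \<delta>1" "\<And>t u. t \<in> cube d \<Longrightarrow> u \<in> cube d \<Longrightarrow> (\<And>i. i < d \<Longrightarrow> \<bar>t i - u i\<bar> < \<delta>1) \<Longrightarrow>
    variogram M X t u \<le> r * (\<Sum>j<length l. c j t * kern (\<alpha> j) (l ! j) (\<lambda>i. t (L l j + i) - u (L l j + i))) \<and>
    (\<Sum>j<length l. c j t * kern (\<alpha> j) (l ! j) (\<lambda>i. t (L l j + i) - u (L l j + i))) \<le> r * variogram M X t u"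
    using locally_stationary_ratio[OF rf ls r] by blast
  have "\<exists>\<delta>>0. \<forall>j<length l. (\<forall>t\<in>cube d. \<forall>u\<in>cube d. (\<forall>i<d. \<bar>t i - u i\<bar> < \<delta>) \<longrightarrow> c j t \<le> r * c j u)"
  proof (rule common_positive_bound)
    fix j assume j: "j < length l"
    obtain \<delta> where \<delta>: "0 < \<delta>" "\<And>t u. t \<in> cube d \<Longrightarrow> u \<in> cube d \<Longrightarrow> dist t u < \<delta> \<Longrightarrow> c j t \<le> r * c j u"
      using positive_continuous_ratio[OF compact_cube c_positive[OF j] r] by blast
    \<comment> \<open>The third of \<delta> converts coordinatewise closeness into closeness in the
      metric, as in \<open>dist_cube_less\<close>.\<close>
    then show "\<exists>\<delta>>0. \<forall>t\<in>cube d. \<forall>u\<in>cube d. (\<forall>i<d. \<bar>t i - u i\<bar> < \<delta>) \<longrightarrow> c j t \<le> r * c j u"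
      using dist_cube_less[of _ d _ \<delta>] by (intro exI[of _ "\<delta> / 3"]) auto
  qed (meson less_le_trans)
  then obtain \<delta>2 where 2: "0 < \<delta>2" "\<And>j t u. j < length l \<Longrightarrow> t \<in> cube d \<Longrightarrow> u \<in> cube d \<Longrightarrow>
      (\<And>i. i < d \<Longrightarrow> \<bar>t i - u i\<bar> < \<delta>2) \<Longrightarrow> c j t \<le> r * c j u" by blast
  have "\<exists>\<delta>>0. \<forall>j<length l. (\<forall>x\<in>{0..1}. \<forall>y\<in>{0..1}. \<bar>x - y\<bar> < \<delta> \<longrightarrow> h j x \<le> r * h j y)"
  proof (rule common_positive_bound)
    fix j assume j: "j < length l"
    obtain \<delta> where \<delta>: "0 < \<delta>" "\<And>x y. x \<in> {0..1} \<Longrightarrow> y \<in> {0..1} \<Longrightarrow> dist x y < \<delta> \<Longrightarrow> h j x \<le> r * h j y"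
      using positive_continuous_ratio[OF compact_Icc h_density(1)[OF j] _ r] h_density(2)[OF j] by blast
    then show "\<exists>\<delta>>0. \<forall>x\<in>{0..1}. \<forall>y\<in>{0..1}. \<bar>x - y\<bar> < \<delta> \<longrightarrow> h j x \<le> r * h j y"
      by (auto simp: dist_real_def)
  qed (meson less_le_trans)
  then obtain \<delta>3 where 3: "0 < \<delta>3" "\<And>j x y. j < length l \<Longrightarrow> x \<in> {0..1} \<Longrightarrow> y \<in> {0..1} \<Longrightarrow>
      \<bar>x - y\<bar> < \<delta>3 \<Longrightarrow> h j x \<le> r * h j y" by blast
  have "fine_scale r (min \<delta>1 (min \<delta>2 \<delta>3))"
    unfolding fine_scale_def
  proof (intro conjI)
    show "\<forall>t\<in>cube d. \<forall>u\<in>cube d. (\<forall>i<d. \<bar>t i - u i\<bar> < min \<delta>1 (min \<delta>2 \<delta>3)) \<longrightarrow>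
      variogram M X t u \<le> r * (\<Sum>j<length l. c j t * kern (\<alpha> j) (l ! j) (\<lambda>i. t (L l j + i) - u (L l j + i))) \<and>
      (\<Sum>j<length l. c j t * kern (\<alpha> j) (l ! j) (\<lambda>i. t (L l j + i) - u (L l j + i))) \<le> r * variogram M X t u"
      by (intro ballI impI 1(2)) auto
    show "\<forall>j<length l. \<forall>t\<in>cube d. \<forall>u\<in>cube d. (\<forall>i<d. \<bar>t i - u i\<bar> < min \<delta>1 (min \<delta>2 \<delta>3)) \<longrightarrow> c j t \<le> r * c j u"
      by (intro allI ballI impI 2(2)) auto
    show "\<forall>j<length l. \<forall>x\<in>{0..1}. \<forall>y\<in>{0..1}. \<bar>x - y\<bar> < min \<delta>1 (min \<delta>2 \<delta>3) \<longrightarrow> h j x \<le> r * h j y"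
      by (intro allI ballI impI 3(2)) auto
  qed
  then show ?thesis using 1(1) 2(1) 3(1) by (intro exI[of _ "min \<delta>1 (min \<delta>2 \<delta>3)"]) auto
qed

text \<open>A cell has mass \<open>1 / n\<close> and density at least x, hence width at most
  \<open>1 / (n x)\<close>.\<close>

lemma cell_width_small:
  assumes x: "0 < x" "\<And>j v. j < length l \<Longrightarrow> v \<in> {0..1} \<Longrightarrow> x \<le> h j v"
    and big: "\<And>j. j < length l \<Longrightarrow> 1 / real (n j N) < \<delta> * x"
    and i: "i \<in> multi_indices d l n N" and m: "m < d"
  shows "cell_hi N i m - cell_lo N i m < \<delta>"
proof -
  note j = comp_less[OF m] note H = h_density[OF j]
  obtain z where z: "\<forall>v\<in>{0..1}. h (comp_of l m) v \<le> h (comp_of l m) z"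
    using continuous_attains_sup[OF compact_Icc _ H(1)] by auto
  have "x * (cell_hi N i m - cell_lo N i m) \<le> 1 / real (n (comp_of l m) N)"
    unfolding cell_hi_def cell_lo_def
  proof (rule grid_cell_width(1)[OF H index_less[OF i m]])
    fix v assume "v \<in> {grid_point (h (comp_of l m)) (n (comp_of l m) N) (i m)..
        grid_point (h (comp_of l m)) (n (comp_of l m) N) (Suc (i m))}"
    then have "v \<in> {0..1}" using cell_range[OF i m] by (auto simp: cell_hi_def cell_lo_def)
    then show "x \<le> h (comp_of l m) v \<and> h (comp_of l m) v \<le> h (comp_of l m) z"
      using x(2)[OF j] z by blast
  qed
  also have "\<dots> < x * \<delta>" using big[OF j] by (simp add: mult.commute)
  finally show ?thesis using x(1) by simp
qed

lemma mse_bounds: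
  assumes r: "1 < r" and \<delta>: "fine_scale r \<delta>" and N: "N \<in> S"
    and small: "\<And>i m. i \<in> multi_indices d l n N \<Longrightarrow> m < d \<Longrightarrow> cell_hi N i m - cell_lo N i m < \<delta>"
  shows "mse N \<le> r ^ (d + 4) * leading_term N" "leading_term N \<le> r ^ (d + 4) * mse N"
proof -
  let ?I = "multi_indices d l n N"
  define R where "R i = rect d (cell_lo N i) (cell_hi N i)" for i
  define U where "U i = uniform_measure (leb d) (R i)" for i
  define vol where "vol i = measure (leb d) (R i)" for i
  define e where "e i = ennreal ((vol i)\<^sup>2 / 2) *
    (\<integral>\<^sup>+t. \<integral>\<^sup>+u. ennreal (variogram M X t u) \<partial>U i \<partial>U i)" for i
  \<comment> \<open>The cut-off integrand is measurable everywhere, so it can be integrated over the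
    cube and over every stratum; on the strata it equals \<open>v_density\<close>.\<close>
  define \<psi> where "\<psi> j t = indicator (cube d) t * v_density d l \<alpha> c h j t" for j t
  define T where "T i t = vol i * (1 / real N * (\<Sum>j<length l. \<psi> j t / real (n j N) powr \<alpha> j))" for i t
  have sub: "R i \<subseteq> cube d" if "i \<in> ?I" for i
    unfolding R_def cube_eq_rect using cell_range[OF that] by (intro PiE_mono) fastforce
  have pU: "prob_space (U i)" if "i \<in> ?I" for i
    unfolding U_def R_def using cell_range[OF that] by (intro prob_uniform_rect) auto
  have NN: "(\<Prod>m<d. real (n (comp_of l m) N)) = real N"
  proof -
    have "(\<Prod>m<d. n (comp_of l m) N) = N"
      using cr N prod_comp_of[of "\<lambda>j. n j N" l] sum_l by (simp add: cross_regular_def)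
    then show ?thesis by (metis of_nat_prod)
  qed
  have \<psi>: "\<psi> j t = v_density d l \<alpha> c h j t" if "t \<in> cube d" for j t using that by (simp add: \<psi>_def)
  have \<psi>0: "0 \<le> \<psi> j t" if "j < length l" for j t
  proof (cases "t \<in> cube d")
    case True
    have "0 < v_density d l \<alpha> c h j t"
      by (rule v_density_pos) (use that sum_l block_pos \<alpha> c_positive h_density True in auto)
    then show ?thesis using True by (simp add: \<psi>_def)
  qed (simp add: \<psi>_def)
  have \<psi>I: "integrable Q (\<psi> j)" if "j < length l" "prob_space Q" "sets Q = sets (leb d)" for j Q
    unfolding \<psi>_def by (rule v_density_integrable) (use that sum_l block_pos \<alpha> c_positive h_density in auto)
  have \<psi>m: "\<psi> j \<in> borel_measurable (leb d)" if "j < length l" for j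
    unfolding \<psi>_def by (rule v_density_measurable) (use that sum_l block_pos \<alpha> c_positive h_density in auto)
  have T0: "0 \<le> T i t" for i t
    unfolding T_def vol_def using \<psi>0 by (intro mult_nonneg_nonneg sum_nonneg divide_nonneg_nonneg) auto
  have eT: "e i \<le> ennreal (r ^ (d + 4) * T i \<tau>)" "ennreal (T i \<tau> / r ^ (d + 4)) \<le> e i"
    if i: "i \<in> ?I" and \<tau>: "\<tau> \<in> R i" for i \<tau>
  proof -
    have near: "\<bar>t m - u m\<bar> < \<delta>" if "t \<in> R i" "u \<in> R i" "m < d" for t u m
    proof -
      have "t m \<in> {cell_lo N i m..cell_hi N i m}" "u m \<in> {cell_lo N i m..cell_hi N i m}"
        using that by (auto simp: R_def PiE_def Pi_def)
      then show ?thesis using small[OF i \<open>m < d\<close>] by auto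
    qed
    have unit: "v \<in> {0..1}" if "m < d" "v \<in> {cell_lo N i m..cell_hi N i m}" for m v
      using cell_range[OF i \<open>m < d\<close>] that by auto
    have width: "real (n (comp_of l m) N) * h (comp_of l m) v * (cell_hi N i m - cell_lo N i m) \<le> r \<and>
      1 \<le> r * (real (n (comp_of l m) N) * h (comp_of l m) v * (cell_hi N i m - cell_lo N i m))"
      if m: "m < d" and v: "v \<in> {cell_lo N i m..cell_hi N i m}" for m v
    proof -
      note j = comp_less[OF m] note H = h_density[OF j]
      have q: "0 < real (n (comp_of l m) N)" using n_pos[OF N j] by simp
      \<comment> \<open>The density at v itself, divided and multiplied by r, serves as the lower
        and upper bound in \<open>grid_cell_width\<close>; hence the width estimate is available at
        every v of the cell.\<close>
      have "h (comp_of l m) v / r \<le> h (comp_of l m) y \<and> h (comp_of l m) y \<le> r * h (comp_of l m) v"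
        if y: "y \<in> {cell_lo N i m..cell_hi N i m}" for y
      proof -
        have "\<bar>v - y\<bar> < \<delta>" "\<bar>y - v\<bar> < \<delta>" using v y small[OF i m] by auto
        then have "h (comp_of l m) v \<le> r * h (comp_of l m) y" "h (comp_of l m) y \<le> r * h (comp_of l m) v"
          using fine_scaleD(4)[OF \<delta> j] unit[OF m v] unit[OF m y] by blast+
        then show ?thesis using r by (simp add: pos_divide_le_eq mult.commute)
      qed
      from grid_cell_width[OF H index_less[OF i m], folded cell_lo_def cell_hi_def, OF this]
      have "h (comp_of l m) v / r * (cell_hi N i m - cell_lo N i m) \<le> 1 / real (n (comp_of l m) N)"
        "1 / real (n (comp_of l m) N) \<le> r * h (comp_of l m) v * (cell_hi N i m - cell_lo N i m)" by auto
      then show ?thesis using q r by (simp add: field_simps)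
    qed
    have eq: "T i \<tau> = measure (leb d) (rect d (cell_lo N i) (cell_hi N i)) * (inverse (\<Prod>m<d. real (n (comp_of l m) N)) *
      (\<Sum>j<length l. v_density d l \<alpha> c h j \<tau> / real (n j N) powr \<alpha> j))"
      using sub[OF i] \<tau> by (simp add: T_def vol_def R_def NN \<psi> subset_iff inverse_eq_divide)
    have fine_\<gamma>: "variogram M X t u \<le> r * (\<Sum>j<length l. c j t * kern (\<alpha> j) (l ! j) (\<lambda>i. t (L l j + i) - u (L l j + i)))"
      "(\<Sum>j<length l. c j t * kern (\<alpha> j) (l ! j) (\<lambda>i. t (L l j + i) - u (L l j + i))) \<le> r * variogram M X t u"
      if "t \<in> R i" "u \<in> R i" for t u
      using that sub[OF i] near[OF that] by (auto intro!: fine_scaleD(1,2)[OF \<delta>])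
    have fine_c: "c j t \<le> r * c j u" if "j < length l" "t \<in> R i" "u \<in> R i" for j t u
      using that sub[OF i] near[OF that(2,3)] by (auto intro!: fine_scaleD(3)[OF \<delta>])
    have ab: "cell_lo N i m < cell_hi N i m" if "m < d" for m using cell_range[OF i that] by simp
    have cp: "0 < c j t" if "j < length l" "t \<in> R i" for j t using c_positive(2) sub[OF i] that by blast
    have hp: "0 < h (comp_of l m) v" if "m < d" "v \<in> {cell_lo N i m..cell_hi N i m}" for m v
      using h_density(2)[OF comp_less[OF that(1)]] unit[OF that] by blast
    note facts = sum_l r \<alpha>[rule_format] ab cp[unfolded R_def] fine_c[unfolded R_def]
        fine_\<gamma>[unfolded R_def] n_pos[OF N] hp width \<tau>[unfolded R_def]
    show "e i \<le> ennreal (r ^ (d + 4) * T i \<tau>)"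
      unfolding e_def eq U_def vol_def R_def
      by (rule stratum_error_bounds(1)[where d=d and l=l and \<alpha>=\<alpha> and a="cell_lo N i" and b="cell_hi N i" and c=c and h=h
          and q="\<lambda>j. n j N" and \<gamma>="variogram M X" and r=r and \<tau>=\<tau>])
        (rule facts; assumption)+
    show "ennreal (T i \<tau> / r ^ (d + 4)) \<le> e i"
      unfolding e_def eq U_def vol_def R_def
      by (rule stratum_error_bounds(2)[where d=d and l=l and \<alpha>=\<alpha> and a="cell_lo N i" and b="cell_hi N i" and c=c and h=h
          and q="\<lambda>j. n j N" and \<gamma>="variogram M X" and r=r and \<tau>=\<tau>])
        (rule facts; assumption)+
  qed
  define E where "E i = enn2real (e i)" for i
  have E: "e i = ennreal (E i)" if i: "i \<in> ?I" for i
  proof -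
    \<comment> \<open>The lower corner witnesses that the stratum is nonempty, and any single point
      of it yields a finite upper bound for \<open>e i\<close>.\<close>
    have "(\<lambda>m\<in>{..<d}. cell_lo N i m) \<in> R i" using cell_range[OF i] by (auto simp: R_def less_imp_le)
    then have "e i \<le> ennreal (r ^ (d + 4) * T i (\<lambda>m\<in>{..<d}. cell_lo N i m))" by (rule eT(1)[OF i])
    then have "e i < top" by (rule le_less_trans) simp
    then show ?thesis by (simp add: E_def)
  qed
  have E0: "0 \<le> E i" for i by (simp add: E_def)
  have ET: "E i \<le> r ^ (d + 4) * T i \<tau>" "T i \<tau> \<le> r ^ (d + 4) * E i" if "i \<in> ?I" "\<tau> \<in> R i" for i \<tau>
  proof -
    show "E i \<le> r ^ (d + 4) * T i \<tau>"
      using eT(1)[OF that] T0[of i \<tau>] r unfolding E[OF that(1)] by (subst (asm) ennreal_le_iff) auto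
    show "T i \<tau> \<le> r ^ (d + 4) * E i"
      using eT(2)[OF that] E0[of i] r unfolding E[OF that(1)]
      by (subst (asm) ennreal_le_iff) (auto simp: pos_divide_le_eq mult.commute)
  qed
  have TI: "integrable (U i) (T i)" if "i \<in> ?I" for i
    unfolding T_def using \<psi>I[OF _ pU[OF that]] by (intro integrable_mult_right Bochner_Integration.integrable_sum) (auto simp: U_def)
  have ET_int: "E i \<le> r ^ (d + 4) * (LINT t|U i. T i t)" "(LINT t|U i. T i t) \<le> r ^ (d + 4) * E i" if i: "i \<in> ?I" for i
  proof -
    interpret prob_space "U i" by (rule pU[OF i])
    have const: "(LINT t|U i. x) = x" for x :: real using prob_space by simp
    have "(LINT t|U i. E i) \<le> (LINT t|U i. r ^ (d + 4) * T i t)"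
      using TI[OF i] ET(1)[OF i] unfolding U_def R_def
      by (intro integral_mono_AE uniform_rect_AE_I) (auto simp: U_def[symmetric] R_def[symmetric])
    then show "E i \<le> r ^ (d + 4) * (LINT t|U i. T i t)" unfolding const by simp
    have "(LINT t|U i. T i t) \<le> (LINT t|U i. r ^ (d + 4) * E i)"
      using TI[OF i] ET(2)[OF i] unfolding U_def R_def
      by (intro integral_mono_AE uniform_rect_AE_I) (auto simp: U_def[symmetric] R_def[symmetric])
    then show "(LINT t|U i. T i t) \<le> r ^ (d + 4) * E i" unfolding const .
  qed
  have v: "v_const d l \<alpha> c h j = (\<Sum>i\<in>?I. vol i * (LINT t|U i. \<psi> j t))" if j: "j < length l" for j
  proof -
    have "v_const d l \<alpha> c h j = (LINT t|unif_cube d. \<psi> j t)"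
      unfolding \<psi>_def by (rule v_const_eq) (use j sum_l block_pos \<alpha> c_positive h_density in auto)
    also have "\<dots> = (\<Sum>i\<in>?I. vol i * (LINT t|U i. \<psi> j t))"
      unfolding vol_def U_def R_def
      by (rule integral_cube_eq_sum_cells[where d=d and f="\<psi> j" and a="cell_lo N" and b="cell_hi N" and I="?I"])
        (rule finite_indices cell_range cells_cover[OF N] \<psi>m[OF j] \<psi>I[OF j prob_unif_cube sets_uniform_measure]; assumption)+
    finally show ?thesis .
  qed
  have "(LINT t|U i. T i t) = vol i * (1 / real N * (\<Sum>j<length l. (LINT t|U i. \<psi> j t) / real (n j N) powr \<alpha> j))"
    if "i \<in> ?I" for i
    unfolding T_def using \<psi>I[OF _ pU[OF that]]
    by (subst integral_mult_right_zero, subst integral_mult_right_zero, subst Bochner_Integration.integral_sum)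
       (auto simp: U_def)
  \<comment> \<open>The volume weight already sits inside \<open>T i\<close>, so the plain sum of
    the averages reassembles the integrals over the whole cube.\<close>
  then have "(\<Sum>i\<in>?I. LINT t|U i. T i t) =
      (\<Sum>i\<in>?I. \<Sum>j<length l. 1 / real N * (vol i * (LINT t|U i. \<psi> j t) / real (n j N) powr \<alpha> j))"
    by (simp add: sum_distrib_left mult_ac)
  also have "\<dots> = (\<Sum>j<length l. \<Sum>i\<in>?I. 1 / real N * (vol i * (LINT t|U i. \<psi> j t) / real (n j N) powr \<alpha> j))"
    by (rule sum.swap)
  also have "\<dots> = leading_term N"
    unfolding leading_term_def by (simp add: v sum_distrib_left sum_divide_distrib)
  finally have sumT: "(\<Sum>i\<in>?I. LINT t|U i. T i t) = leading_term N" .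
  have "mse N = enn2real (\<Sum>i\<in>?I. e i)"
    unfolding mse_eq[OF N] e_def U_def vol_def R_def ..
  also have "(\<Sum>i\<in>?I. e i) = ennreal (\<Sum>i\<in>?I. E i)"
    using E E0 by (simp add: sum_ennreal)
  also have "enn2real \<dots> = (\<Sum>i\<in>?I. E i)" using E0 by (simp add: sum_nonneg)
  finally have sumE: "mse N = (\<Sum>i\<in>?I. E i)" .
  show "mse N \<le> r ^ (d + 4) * leading_term N"
    unfolding sumE sumT[symmetric] sum_distrib_left using ET_int(1) by (intro sum_mono)
  show "leading_term N \<le> r ^ (d + 4) * mse N"
    unfolding sumE sumT[symmetric] sum_distrib_left using ET_int(2) by (intro sum_mono)
qed

section \<open>Passage to the limit\<close>

lemma eventually_mse_bounds:
  assumes r: "1 < r"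
  shows "\<forall>\<^sub>F N in inf sequentially (principal S). N \<in> S \<and> mse N \<le> r ^ (d + 4) * leading_term N \<and> leading_term N \<le> r ^ (d + 4) * mse N"
proof -
  obtain \<delta> where \<delta>: "0 < \<delta>" "fine_scale r \<delta>" using fine_scale_exists[OF r] by blast
  obtain x where x: "0 < x" "\<And>j v. j < length l \<Longrightarrow> v \<in> {0..1} \<Longrightarrow> x \<le> h j v"
    using continuous_uniform_lower_bound[of "length l" h] h_density by blast
  \<comment> \<open>The threshold \<open>\<delta> * x\<close> is the one that
    \<open>cell_width_small\<close> turns into width below \<delta>; there are finitely many
    components, so it is eventually met by all of them at once.\<close>
  have "\<forall>\<^sub>F N in inf sequentially (principal S). \<forall>j\<in>{..<length l}. 1 / real (n j N) < \<delta> * x"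
  proof (intro eventually_ball_finite ballI)
    fix j assume "j \<in> {..<length l}"
    then have "filterlim (n j) at_top (inf sequentially (principal S))"
      using cr by (auto simp: cross_regular_def)
    then have "filterlim (\<lambda>N. real (n j N)) at_top (inf sequentially (principal S))"
      by (rule filterlim_compose[OF filterlim_real_sequentially])
    then have "((\<lambda>N. inverse (real (n j N))) \<longlongrightarrow> 0) (inf sequentially (principal S))"
      by (rule tendsto_inverse_0_at_top)
    then have "\<forall>\<^sub>F N in inf sequentially (principal S). inverse (real (n j N)) < \<delta> * x"
      using \<delta>(1) x(1) by (intro order_tendstoD(2)) auto
    then show "\<forall>\<^sub>F N in inf sequentially (principal S). 1 / real (n j N) < \<delta> * x"
      by (simp add: inverse_eq_divide)
  qed simp
  moreover have "\<forall>\<^sub>F N in inf sequentially (principal S). N \<in> S"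
    by (simp add: eventually_inf_principal)
  ultimately show ?thesis
  proof eventually_elim
    fix N assume big: "\<forall>j\<in>{..<length l}. 1 / real (n j N) < \<delta> * x" and N: "N \<in> S"
    have "cell_hi N i m - cell_lo N i m < \<delta>" if "i \<in> multi_indices d l n N" "m < d" for i m
      using cell_width_small[OF x _ that] big by blast
    from mse_bounds[OF r \<delta>(2) N this] N
    show "N \<in> S \<and> mse N \<le> r ^ (d + 4) * leading_term N \<and> leading_term N \<le> r ^ (d + 4) * mse N" by blast
  qed
qed

text \<open>Positive dimension provides at least one component; for d = 0 the sum would be empty and
  the quotient meaningless.\<close>

lemma leading_term_pos:
  assumes N: "N \<in> S" and d: "1 \<le> d"
  shows "0 < leading_term N"
proof -
  have "0 < length l" using d sum_l by (cases l) auto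
  then have "0 < (\<Sum>j<length l. v_const d l \<alpha> c h j / real (n j N) powr \<alpha> j)"
    using v_const_positive n_pos[OF N] by (intro sum_pos) auto
  moreover have "0 < N" using cr N by (auto simp: cross_regular_def)
  ultimately show ?thesis by (simp add: leading_term_def)
qed

lemma mse_ratio_tendsto:
  assumes d: "1 \<le> d"
  shows "((\<lambda>N. mse N / leading_term N) \<longlongrightarrow> 1) (inf sequentially (principal S))"
proof (rule tendstoI)
  fix \<epsilon> :: real assume \<epsilon>: "0 < \<epsilon>"
  \<comment> \<open>The dimension is fixed, so the accumulated loss \<open>r ^ (d + 4)\<close> can
    be brought below \<open>1 + \<epsilon>\<close> by taking r close to 1.\<close>
  have "((\<lambda>r :: real. r ^ (d + 4)) \<longlongrightarrow> 1 ^ (d + 4)) (at_right 1)" by (intro tendsto_intros)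
  then have "\<forall>\<^sub>F r :: real in at_right 1. r ^ (d + 4) < 1 + \<epsilon>"
    using \<epsilon> by (intro order_tendstoD(2)) auto
  moreover have "\<forall>\<^sub>F r :: real in at_right 1. 1 < r" by (rule eventually_at_right_less)
  ultimately have "\<forall>\<^sub>F r :: real in at_right 1. r ^ (d + 4) < 1 + \<epsilon> \<and> 1 < r"
    by (rule eventually_conj)
  then obtain r :: real where r: "r ^ (d + 4) < 1 + \<epsilon>" "1 < r"
    using eventually_happens'[OF trivial_limit_at_right_real] by blast
  from eventually_mse_bounds[OF r(2)]
  show "\<forall>\<^sub>F N in inf sequentially (principal S). dist (mse N / leading_term N) 1 < \<epsilon>"
  proof eventually_elim
    fix N assume A: "N \<in> S \<and> mse N \<le> r ^ (d + 4) * leading_term N \<and> leading_term N \<le> r ^ (d + 4) * mse N"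
    define q where "q = mse N / leading_term N"
    have t: "0 < leading_term N" using A d by (intro leading_term_pos) auto
    have q1: "q \<le> r ^ (d + 4)" using A t by (simp add: q_def pos_divide_le_eq)
    have q2: "1 \<le> r ^ (d + 4) * q" using A t by (simp add: q_def pos_le_divide_eq)
    have "0 \<le> q" using t by (simp add: q_def mse_def)
    then have "r ^ (d + 4) * q \<le> (1 + \<epsilon>) * q" using r(1) by (intro mult_right_mono) auto
    with q2 have "1 \<le> (1 + \<epsilon>) * q" by simp
    \<comment> \<open>The lower bound available for q is \<open>1 / (1 + \<epsilon>)\<close>; this
      inequality shows that it exceeds \<open>1 - \<epsilon>\<close>.\<close>
    moreover have "(1 + \<epsilon>) * (1 - \<epsilon>) < 1" using \<epsilon> by (simp add: algebra_simps)
    ultimately have "(1 + \<epsilon>) * (1 - \<epsilon>) < (1 + \<epsilon>) * q" by simp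
    then have "1 - \<epsilon> < q" using \<epsilon> by simp
    with q1 r(1) have "dist q 1 < \<epsilon>" by (simp add: dist_real_def abs_less_iff)
    then show "dist (mse N / leading_term N) 1 < \<epsilon>" by (simp add: q_def)
  qed
qed

end

theorem theorem1:
  fixes M F :: "'w measure"
    and X :: "(nat \<Rightarrow> real) \<Rightarrow> 'w \<Rightarrow> real"
    and d :: nat and l :: "nat list"
    and \<alpha> :: "nat \<Rightarrow> real"
    and c :: "nat \<Rightarrow> (nat \<Rightarrow> real) \<Rightarrow> real"
    and h :: "nat \<Rightarrow> real \<Rightarrow> real"
    and S :: "nat set" and n :: "nat \<Rightarrow> nat \<Rightarrow> nat"
    and \<eta> :: "nat \<Rightarrow> (nat \<Rightarrow> nat) \<Rightarrow> 'w \<Rightarrow> nat \<Rightarrow> real"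
  assumes "d \<ge> 1"
    and "decomposition d l"
    and "\<forall>j<length l. 0 < \<alpha> j \<and> \<alpha> j < 2"
    and "prob_space M"
    and "random_field M F d X"
    and "locally_stationary M d l \<alpha> c X"
    and "cross_regular S l h n"
    and "\<forall>N\<in>S. stratified_sampling M F d l h n N (\<eta> N)"
  shows "(\<forall>j<length l. 0 < v_const d l \<alpha> c h j) \<and>
    ((\<lambda>N. (rv_norm M (\<lambda>w. field_integral d X w - quadrature d l h n N (\<eta> N) X w))\<^sup>2 /
          (1 / real N * (\<Sum>j<length l. v_const d l \<alpha> c h j / real (n j N) powr \<alpha> j)))
      \<longlongrightarrow> 1) (inf sequentially (principal S))"
  using v_const_positive[OF assms(2-8)] mse_ratio_tendsto[OF assms(2-8) assms(1)]
  unfolding mse_def[OF assms(2-8)] leading_term_def[OF assms(2-8)] by blast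

end
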